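(* Let $R=k[x_1,\ldots,x_d]$ be a polynomial ring over a field $k$ with $d\geq 2$, and let $I$ be a zero dimensional monomial ideal of $R$, with minimal monomial generators $x^{v_1},\ldots,x^{v_q}$ ordered as in the context, and let $P$, $S$ be the polytopes defined in the context. Let $f$ be the Hilbert function of $I$, i.e. $f(0)=0$ and $f(n)=\ell_R(R/\overline{I^n})$ for $n\geq 1$, and let $E_S$, $E_P$ be the Ehrhart polynomials of $S$ and $P$. Then $$f(n)=E_{S}(n)-E_P(n)\quad\text{for all } n\in\mathbb{N}.$$ In particular, if $c_dx^d+c_{d-1}x^{d-1}+\cdots+c_1x+c_0$ is the Hilbert polynomial of the filtration $\{\overline{I^n}\}_{n=0}^\infty$ (the polynomial with rational coefficients agreeing with $f(n)$ for $n\gg 0$), then $f(n)=c_dn^d+c_{d-1}n^{d-1}+\cdots+c_1n+c_0$ for all $n\in\mathbb{N}$, and $c_0=0$.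
   Context: $\mathbb{N}$ denotes the non-negative integers. For $a\in\mathbb{N}^d$, $x^a=x_1^{a_1}\cdots x_d^{a_d}$. Zero dimensional means $\dim(R/I)=0$. $\overline{J}$ is the integral closure of an ideal $J$ in $R$, and $\ell_R$ is length as an $R$-module (with $\ell_R(R/\overline{I^n})=\dim_k(R/\overline{I^n})$). The generators are ordered so that $v_i=a_ie_i$ for $1\leq i\leq d$, where $a_1,\ldots,a_d$ are positive integers and $e_i$ is the $i$th unit vector of $\mathbb{Q}^d$; set $\alpha_0=(1/a_1,\ldots,1/a_d)$; $\{v_{d+1},\ldots,v_s\}$ is the set of those $v_i$ with $\langle v_i,\alpha_0\rangle<1$, and $\{v_{s+1},\ldots,v_q\}$ is the set of those $v_i$ with $i>d$ and $\langle v_i,\alpha_0\rangle\geq 1$. The polytopes in $\mathbb{Q}^d$ are $P={\rm conv}(v_1,\ldots,v_s)$ and $S={\rm conv}(0,v_1,\ldots,v_d)=\{x\mid x\geq 0,\ \langle x,\alpha_0\rangle\leq 1\}$. For a polytope $T$ with integral vertices, the Ehrhart function is $\chi_T(n)=|\mathbb{Z}^d\cap nT|$ for $n\in\mathbb{N}$; the Ehrhart polynomial $E_T(x)\in\mathbb{Q}[x]$ is the polynomial agreeing with $\chi_T(n)$ for $n\gg 0$. *)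

theory Defs
  imports
    "HOL-Analysis.Finite_Cartesian_Product"
    "HOL-Library.Poly_Mapping"
    "HOL-Library.Extended_Nat"
    "HOL-Library.Extended_Real"
    "HOL-Computational_Algebra.Polynomial"
    "HOL-Algebra.Ideal_Product"
    "HOL-Algebra.Module"
    "HOL-Algebra.Algebraic_Closure_Type"
begin

section \<open>Commutative algebra\<close>

text \<open>
  The supremum is taken in the extended reals, so that the zero ring, which has no prime
  ideals, gets dimension \<open>-\<infinity>\<close> and not \<open>0\<close>.
\<close>

definition krull_dim :: "('a, 'b) ring_scheme \<Rightarrow> ereal" where
  "krull_dim R =
     (SUP n \<in> {n. \<exists>\<pp>. (\<forall>i\<le>n. primeideal (\<pp> i) R) \<and> (\<forall>i<n. \<pp> i \<subset> \<pp> (Suc i))}. ereal (real n))"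

text \<open>
  The powers of \<open>J\<close> are taken in the semiring of ideals; in particular the power with
  exponent \<open>0\<close> is the whole ring.
\<close>

definition integral_closure_ideal :: "('a, 'b) ring_scheme \<Rightarrow> 'a set \<Rightarrow> 'a set" where
  "integral_closure_ideal R J =
     {r \<in> carrier R. \<exists>n::nat. 1 \<le> n \<and> (\<exists>c. (\<forall>i\<in>{1..n}. c i \<in> J [^]\<^bsub>ideals_set R\<^esub> i) \<and>
        r [^]\<^bsub>R\<^esub> n \<oplus>\<^bsub>R\<^esub> (\<Oplus>\<^bsub>R\<^esub>i\<in>{1..n}. c i \<otimes>\<^bsub>R\<^esub> r [^]\<^bsub>R\<^esub> (n - i)) = \<zero>\<^bsub>R\<^esub>)}"

text \<open>
  \<open>R/J\<close> as an \<open>R\<close>-module. The record type of modules extends that of rings, so the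
  multiplicative fields have to be filled in, but they play no role.
\<close>

definition quotient_module :: "('a, 'b) ring_scheme \<Rightarrow> 'a set \<Rightarrow> ('a, 'a set) module" where
  "quotient_module R J = ring.extend (R Quot J)
     (module.fields (\<lambda>r A. (J +>\<^bsub>R\<^esub> r) \<otimes>\<^bsub>R Quot J\<^esub> A))"

definition module_length ::
    "('a, 'b) ring_scheme \<Rightarrow> ('a, 'c, 'd) module_scheme \<Rightarrow> enat" where
  "module_length R M =
     (SUP n \<in> {n. \<exists>N. (\<forall>i\<le>n. submodule (N i) R M) \<and> (\<forall>i<n. N i \<subset> N (Suc i))}. enat n)"

text \<open>
  \<open>the_enat \<infinity>\<close> is unspecified, so an equation for a value of this function is only
  provable when the length is finite.
\<close>

definition hilbert_function :: "('a, 'b) ring_scheme \<Rightarrow> 'a set \<Rightarrow> nat \<Rightarrow> nat" where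
  "hilbert_function R I n =
     (if n = 0 then 0
      else the_enat (module_length R
             (quotient_module R (integral_closure_ideal R (I [^]\<^bsub>ideals_set R\<^esub> n)))))"

definition eventual_poly :: "(nat \<Rightarrow> nat) \<Rightarrow> rat poly" where
  "eventual_poly g = (THE p. \<forall>\<^sub>F n in sequentially. poly p (of_nat n) = of_nat (g n))"

definition hilbert_poly :: "('a, 'b) ring_scheme \<Rightarrow> 'a set \<Rightarrow> rat poly" where
  "hilbert_poly R I = eventual_poly (hilbert_function R I)"


section \<open>The polynomial ring and its monomials\<close>

text \<open>
  The variables are indexed by the finite type \<open>'n\<close>, so \<open>d = CARD('n)\<close>. Exponent vectors
  are elements of \<open>nat ^ 'n\<close>, and polynomials are finitely supported functions from exponent
  vectors to coefficients, with the convolution product.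
\<close>

type_synonym ('n, 'k) mpoly = "(nat ^ 'n) \<Rightarrow>\<^sub>0 'k"

abbreviation mpoly_ring :: "('n::finite, 'k::field) mpoly ring" where
  "mpoly_ring \<equiv> ring_of_type_algebra"

definition monomial :: "nat ^ 'n \<Rightarrow> ('n::finite, 'k::field) mpoly" where
  "monomial v = Poly_Mapping.single v 1"

text \<open>
  \<open>V\<close> is the set of exponent vectors of the minimal monomial generators of \<open>I\<close>.
\<close>

definition minimal_monomial_generators ::
    "(nat ^ 'n) set \<Rightarrow> ('n::finite, 'k::field) mpoly set \<Rightarrow> bool" where
  "minimal_monomial_generators V I \<longleftrightarrow>
     finite V \<and> I = Idl\<^bsub>mpoly_ring\<^esub> (monomial ` V) \<and>
     (\<forall>W. W \<subset> V \<longrightarrow> Idl\<^bsub>mpoly_ring\<^esub> (monomial ` W) \<noteq> I)"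


section \<open>Rational polytopes and Ehrhart polynomials\<close>

text \<open>The library's \<open>convex hull\<close> is only available over the reals.\<close>

definition conv :: "(rat ^ 'n::finite) set \<Rightarrow> (rat ^ 'n) set" where
  "conv A = {y. \<exists>F c. finite F \<and> F \<subseteq> A \<and> (\<forall>x\<in>F. 0 \<le> c x) \<and> (\<Sum>x\<in>F. c x) = 1 \<and>
                      y = (\<Sum>x\<in>F. c x *s x)}"

definition ehrhart_function :: "(rat ^ 'n::finite) set \<Rightarrow> nat \<Rightarrow> nat" where
  "ehrhart_function T n =
     card {z :: int ^ 'n. (\<chi> i. of_int (z $ i)) \<in> (\<lambda>x. of_nat n *s x) ` T}"

definition ehrhart_poly :: "(rat ^ 'n::finite) set \<Rightarrow> rat poly" where
  "ehrhart_poly T = eventual_poly (ehrhart_function T)"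


section \<open>The polytopes of a zero dimensional monomial ideal\<close>

definition rat_vec :: "nat ^ 'n \<Rightarrow> rat ^ 'n::finite" where
  "rat_vec v = (\<chi> i. of_nat (v $ i))"

text \<open>
  If \<open>V\<close> is the set of exponents of the minimal monomial generators of a zero dimensional
  ideal, then for each variable \<open>i\<close> exactly one element of \<open>V\<close> has the form \<open>a\<^sub>i e\<^sub>i\<close>, and
  \<open>a\<^sub>i > 0\<close>. These are the vectors \<open>v\<^sub>1, \<dots>, v\<^sub>d\<close>.
\<close>

definition pure_exponent :: "(nat ^ 'n::finite) set \<Rightarrow> 'n \<Rightarrow> nat" where
  "pure_exponent V i = (THE m. axis i m \<in> V)"

definition pure_vectors :: "(nat ^ 'n::finite) set \<Rightarrow> (nat ^ 'n) set" where
  "pure_vectors V = range (\<lambda>i. axis i (pure_exponent V i))"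

definition alpha0 :: "(nat ^ 'n::finite) set \<Rightarrow> rat ^ 'n" where
  "alpha0 V = (\<chi> i. 1 / of_nat (pure_exponent V i))"

definition polytope_P :: "(nat ^ 'n::finite) set \<Rightarrow> (rat ^ 'n) set" where
  "polytope_P V =
     conv (rat_vec ` (pure_vectors V \<union> {v \<in> V. scalar_product (rat_vec v) (alpha0 V) < 1}))"

definition polytope_S :: "(nat ^ 'n::finite) set \<Rightarrow> (rat ^ 'n) set" where
  "polytope_S V = conv (insert 0 (rat_vec ` pure_vectors V))"

end

theory Submission
  imports Defs "HOL-Analysis.Cartesian_Space"
begin

text \<open>
  Let \<open>Q\<close> be the Newton polyhedron of \<open>I\<close>, the convex hull of the exponents of its generators plus the
  positive orthant. The proof compares three descriptions of the number of lattice points in the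
  orthant outside \<open>n Q\<close>.

  The algebraic description: the integral closure of \<open>I ^ n\<close> is spanned by the monomials with exponents
  in \<open>n Q\<close> (\<open>integral_closure_monomial_ideal_pow\<close>), so that \<open>f n\<close> is the number of the other
  monomials (\<open>module_length_supported\<close>). If a polynomial \<open>g\<close> is supported on \<open>n Q\<close>, then it
  multiplies the module \<open>N\<close> spanned by the monomials in a fixed large dilate of \<open>Q\<close> into
  \<open>I ^ n N\<close>, and the determinant trick gives an integral equation. Conversely, if \<open>g\<close> is integral, then the powers \<open>g ^ M\<close> are
  supported on \<open>n (M - m) Q\<close> for a constant \<open>m\<close>. An exponent \<open>a\<close> of \<open>g\<close> of maximal Euclidean norm is
  a vertex of the Newton polytope of \<open>g\<close>, so \<open>M a\<close> is an exponent of \<open>g ^ M\<close>; letting \<open>M\<close> grow shows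
  that \<open>a\<close> lies in \<open>n Q\<close>, and the term with exponent \<open>a\<close> can be removed from \<open>g\<close>.

  The geometric description: dimension zero means that \<open>I\<close> contains a power of every variable
  (\<open>zero_dimensional\<close>). Hence the points outside \<open>n Q\<close> lie in \<open>n S\<close>. The points of \<open>n S\<close> inside
  \<open>n Q\<close> are those of \<open>n P\<close>: a representation that uses too much weight can trade weight on the
  generators of height less than \<open>1\<close> for weight on the powers of the variables. Counting gives
  \<open>f n = \<chi>\<^sub>S n - \<chi>\<^sub>P n\<close> for all \<open>n\<close> (\<open>card_below_newton\<close>).

  The Ehrhart functions \<open>\<chi>\<^sub>S\<close> and \<open>\<chi>\<^sub>P\<close> are polynomials of degree at most the dimension, for all \<open>n\<close> and
  not just for large \<open>n\<close> (\<open>ehrhart\<close>). For this the cone over the polytope is cut into half-open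
  simplicial cones. The cells come from a pulling triangulation: every point has a unique
  lexicographically maximal representation by the vertices, and whether a representation is maximal
  depends on its support only. So \<open>f\<close> agrees everywhere with the
  difference of the two Ehrhart polynomials, and its constant term is \<open>f 0 = 0\<close>.
\<close>

no_notation fps_nth (infixl \<open>$\<close> 75)

section \<open>Optimal nonnegative representations\<close>

text \<open>
  A point of a cone has many representations as a nonnegative combination of given vectors, indexed
  by \<open>A\<close>; two of them differ by an element of the space \<open>K\<close> of linear dependencies. The total order
  \<open>pos\<close> on \<open>K\<close> singles out one representation of each point. The cone is present
  through \<open>K\<close> alone.
\<close>

locale optimal_representation =
  fixes A :: "'i set" and K :: "('i \<Rightarrow> rat) set" and pos :: "('i \<Rightarrow> rat) \<Rightarrow> bool"
  assumes finite_index: "finite A"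
    and kernel_outside: "\<mu> \<in> K \<Longrightarrow> i \<notin> A \<Longrightarrow> \<mu> i = 0"
    and kernel_nonempty: "K \<noteq> {}"
    and kernel_add: "\<mu> \<in> K \<Longrightarrow> \<nu> \<in> K \<Longrightarrow> (\<lambda>i. \<mu> i + \<nu> i) \<in> K"
    and kernel_scale: "\<mu> \<in> K \<Longrightarrow> (\<lambda>i. c * \<mu> i) \<in> K"
    and pos_total: "\<mu> \<in> K \<Longrightarrow> \<mu> \<noteq> (\<lambda>_. 0) \<Longrightarrow> pos \<mu> \<or> pos (\<lambda>i. - \<mu> i)"
    and pos_add: "pos \<mu> \<Longrightarrow> pos \<nu> \<Longrightarrow> pos (\<lambda>i. \<mu> i + \<nu> i)"
    and pos_scale: "pos \<mu> \<Longrightarrow> 0 < c \<Longrightarrow> pos (\<lambda>i. c * \<mu> i)"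
    and not_pos_zero: "\<not> pos (\<lambda>_. 0)"
    and pos_negative_entry: "\<mu> \<in> K \<Longrightarrow> pos \<mu> \<Longrightarrow> \<exists>i\<in>A. \<mu> i < 0"
begin

definition weights :: "('i \<Rightarrow> rat) set" where
  "weights = {\<alpha>. (\<forall>i. 0 \<le> \<alpha> i) \<and> (\<forall>i. i \<notin> A \<longrightarrow> \<alpha> i = 0)}"

definition supp :: "('i \<Rightarrow> rat) \<Rightarrow> 'i set" where
  "supp \<alpha> = {i. \<alpha> i \<noteq> 0}"

definition equivalent :: "('i \<Rightarrow> rat) \<Rightarrow> ('i \<Rightarrow> rat) \<Rightarrow> bool" where
  "equivalent \<alpha> \<alpha>' \<longleftrightarrow> (\<lambda>i. \<alpha>' i - \<alpha> i) \<in> K"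

definition better :: "('i \<Rightarrow> rat) \<Rightarrow> ('i \<Rightarrow> rat) \<Rightarrow> bool" where
  "better \<alpha> \<alpha>' \<longleftrightarrow> pos (\<lambda>i. \<alpha>' i - \<alpha> i)"

text \<open>
  Whether a representation with support \<open>\<sigma>\<close> can be improved depends on \<open>\<sigma>\<close> only, since its positive
  coefficients leave room for a small step in every direction. Hence the optimal representations
  form full open cells, and the sets with this property are the cells of a triangulation.
\<close>

definition unimprovable :: "'i set \<Rightarrow> bool" where
  "unimprovable \<sigma> \<longleftrightarrow> \<not> (\<exists>\<mu>\<in>K. pos \<mu> \<and> (\<forall>i. i \<notin> \<sigma> \<longrightarrow> 0 \<le> \<mu> i))"

lemma equivalent_trans:
  assumes "equivalent \<alpha> \<alpha>'" "equivalent \<alpha>' \<alpha>''" shows "equivalent \<alpha> \<alpha>''"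
  using kernel_add[of "\<lambda>i. \<alpha>' i - \<alpha> i" "\<lambda>i. \<alpha>'' i - \<alpha>' i"] assms
  by (simp add: equivalent_def)

lemma kernel_uminus: "\<mu> \<in> K \<Longrightarrow> (\<lambda>i. - \<mu> i) \<in> K"
  using kernel_scale[of \<mu> "-1"] by simp

lemma equivalent_sym: "equivalent \<alpha> \<alpha>' \<Longrightarrow> equivalent \<alpha>' \<alpha>"
  using kernel_uminus[of "\<lambda>i. \<alpha>' i - \<alpha> i"] by (simp add: equivalent_def)

lemma better_trans:
  assumes "better \<alpha> \<alpha>'" "better \<alpha>' \<alpha>''" shows "better \<alpha> \<alpha>''"
  using pos_add[of "\<lambda>i. \<alpha>' i - \<alpha> i" "\<lambda>i. \<alpha>'' i - \<alpha>' i"] assms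
  by (simp add: better_def)

lemma better_irrefl: "\<not> better \<alpha> \<alpha>"
  using not_pos_zero by (simp add: better_def)

lemma unimprovable_mono: "unimprovable \<sigma> \<Longrightarrow> \<tau> \<subseteq> \<sigma> \<Longrightarrow> unimprovable \<tau>"
  unfolding unimprovable_def by blast

lemma unimprovable_independent:
  assumes "unimprovable \<sigma>" "\<mu> \<in> K" "\<And>i. i \<notin> \<sigma> \<Longrightarrow> \<mu> i = 0"
  shows "\<mu> = (\<lambda>_. 0)"
proof (rule ccontr)
  assume "\<mu> \<noteq> (\<lambda>_. 0)"
  then have "pos \<mu> \<or> pos (\<lambda>i. - \<mu> i)" using pos_total assms(2) by blast
  then show False
    using assms kernel_uminus[OF assms(2)] unfolding unimprovable_def by force
qed

definition basic :: "('i \<Rightarrow> rat) \<Rightarrow> bool" where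
  "basic \<alpha> \<longleftrightarrow> \<alpha> \<in> weights \<and> (\<forall>\<mu>\<in>K. supp \<mu> \<subseteq> supp \<alpha> \<longrightarrow> \<mu> = (\<lambda>_. 0))"

lemma supp_subset: "\<alpha> \<in> weights \<Longrightarrow> supp \<alpha> \<subseteq> A"
  by (auto simp: weights_def supp_def)

text \<open>
  Caratheodory's argument: a dependency among the vectors in use can be followed in the direction
  in which it improves the representation, until one more coefficient vanishes.
\<close>

lemma improve_to_basic:
  assumes "\<alpha> \<in> weights"
  shows "\<exists>\<beta>. basic \<beta> \<and> equivalent \<alpha> \<beta> \<and> (\<beta> = \<alpha> \<or> better \<alpha> \<beta>)"
  using assms
proof (induction "card (supp \<alpha>)" arbitrary: \<alpha> rule: less_induct)
  case less
  have fin: "finite (supp \<alpha>)" using supp_subset[OF less.prems] finite_index finite_subset by blast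
  show ?case
  proof (cases "basic \<alpha>")
    case True
    obtain \<mu> where "\<mu> \<in> K" using kernel_nonempty by blast
    then have "equivalent \<alpha> \<alpha>" using kernel_scale[of \<mu> 0] by (simp add: equivalent_def)
    then show ?thesis using True by blast
  next
    case False
    then obtain \<nu> where \<nu>: "\<nu> \<in> K" "supp \<nu> \<subseteq> supp \<alpha>" "\<nu> \<noteq> (\<lambda>_. 0)"
      using less.prems unfolding basic_def by blast
    obtain \<mu> where \<mu>: "\<mu> \<in> K" "supp \<mu> \<subseteq> supp \<alpha>" "pos \<mu>"
    proof (cases "pos \<nu>")
      case False
      with \<nu> have "pos (\<lambda>i. - \<nu> i)" using pos_total by blast
      with \<nu> show ?thesis using that[of "\<lambda>i. - \<nu> i"] kernel_uminus by (auto simp: supp_def)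
    qed (use \<nu> that in blast)
    define D where "D = {i \<in> supp \<alpha>. \<mu> i < 0}"
    have inD: "i \<in> D" if "\<mu> i < 0" for i
    proof -
      have "i \<in> supp \<mu>" using that by (simp add: supp_def)
      then show ?thesis using that \<mu>(2) unfolding D_def by blast
    qed
    have "D \<noteq> {}" using pos_negative_entry[OF \<mu>(1,3)] inD by blast
    have "finite D" using fin by (simp add: D_def)
    define t where "t = Min ((\<lambda>i. \<alpha> i / - \<mu> i) ` D)"
    have "t \<in> (\<lambda>i. \<alpha> i / - \<mu> i) ` D"
      unfolding t_def using \<open>D \<noteq> {}\<close> \<open>finite D\<close> by (intro Min_in) auto
    then obtain k where k: "k \<in> D" "t = \<alpha> k / - \<mu> k" by blast
    have lp: "0 \<le> \<alpha> i" for i using less.prems by (simp add: weights_def)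
    have "0 < \<alpha> k" using k(1) lp[of k] by (auto simp: D_def supp_def)
    then have "0 < t" using k by (simp add: D_def divide_pos_neg)
    define \<alpha>' where "\<alpha>' = (\<lambda>i. \<alpha> i + t * \<mu> i)"
    have nonneg: "0 \<le> \<alpha>' i" for i
    proof (cases "\<mu> i < 0")
      case True
      then have "i \<in> D" by (rule inD)
      then have "t \<le> \<alpha> i / - \<mu> i" unfolding t_def using \<open>finite D\<close> by (intro Min_le) auto
      then have "t * - \<mu> i \<le> \<alpha> i" using True by (simp add: field_simps)
      then show ?thesis by (simp add: \<alpha>'_def)
    next
      case False
      then show ?thesis using lp[of i] \<open>0 < t\<close> by (simp add: \<alpha>'_def)
    qed
    have sub: "supp \<alpha>' \<subseteq> supp \<alpha>" using \<mu>(2) by (force simp: supp_def \<alpha>'_def)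
    have "\<alpha>' k = 0" using k by (simp add: \<alpha>'_def D_def field_simps)
    then have "supp \<alpha>' \<subset> supp \<alpha>" using sub k(1) by (auto simp: D_def supp_def)
    then have lt: "card (supp \<alpha>') < card (supp \<alpha>)" using fin psubset_card_mono by blast
    have c': "\<alpha>' \<in> weights" using nonneg sub supp_subset[OF less.prems]
      by (auto simp: weights_def supp_def)
    from less.hyps[OF lt c'] obtain \<beta> where \<beta>: "basic \<beta>" "equivalent \<alpha>' \<beta>" "\<beta> = \<alpha>' \<or> better \<alpha>' \<beta>"
      by blast
    have "equivalent \<alpha> \<alpha>'" using kernel_scale[OF \<mu>(1)] by (simp add: equivalent_def \<alpha>'_def)
    moreover have "better \<alpha> \<alpha>'" using pos_scale[OF \<mu>(3) \<open>0 < t\<close>] by (simp add: better_def \<alpha>'_def)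
    ultimately show ?thesis
      using \<beta>(1) \<beta>(3) equivalent_trans[OF _ \<beta>(2)] better_trans[of \<alpha> \<alpha>' \<beta>] by blast
  qed
qed

lemma finite_basic_equivalent: "finite {\<beta>. basic \<beta> \<and> equivalent \<alpha> \<beta>}"
proof (rule inj_on_finite[of supp _ "Pow A"])
  show "inj_on supp {\<beta>. basic \<beta> \<and> equivalent \<alpha> \<beta>}"
  proof (rule inj_onI, clarify)
    fix \<beta> \<gamma> assume *: "supp \<beta> = supp \<gamma>" "basic \<beta>" "equivalent \<alpha> \<beta>" "basic \<gamma>" "equivalent \<alpha> \<gamma>"
    then have "equivalent \<beta> \<gamma>" using equivalent_trans[OF equivalent_sym, of \<alpha>] by blast
    then have K: "(\<lambda>i. \<gamma> i - \<beta> i) \<in> K" by (simp add: equivalent_def)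
    have "supp (\<lambda>i. \<gamma> i - \<beta> i) \<subseteq> supp \<beta> \<union> supp \<gamma>" by (auto simp: supp_def)
    then have "supp (\<lambda>i. \<gamma> i - \<beta> i) \<subseteq> supp \<gamma>" using *(1) by simp
    then have "(\<lambda>i. \<gamma> i - \<beta> i) = (\<lambda>_. 0)" using *(4) K unfolding basic_def by blast
    then show "\<beta> = \<gamma>" by (simp add: fun_eq_iff)
  qed
  show "supp ` {\<beta>. basic \<beta> \<and> equivalent \<alpha> \<beta>} \<subseteq> Pow A"
    using supp_subset by (auto simp: basic_def)
  show "finite (Pow A)" using finite_index by simp
qed

text \<open>
  There are only finitely many representations with independent support, so one of them is the best;
  an improvement of it could be turned into a better one of the same kind.
\<close>

theorem optimal_representation_exists:
  assumes "\<alpha> \<in> weights"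
  shows "\<exists>\<beta>\<in>weights. equivalent \<alpha> \<beta> \<and> unimprovable (supp \<beta>)"
proof -
  define B where "B = {\<beta>. basic \<beta> \<and> equivalent \<alpha> \<beta>}"
  have "finite B" unfolding B_def by (rule finite_basic_equivalent)
  have "B \<noteq> {}" using improve_to_basic[OF assms] by (auto simp: B_def)
  have tr: "transp_on B better" 
    by (rule transp_onI) (rule better_trans)
  have as: "asymp_on B better" 
    by (rule asymp_onI) (use better_trans better_irrefl in blast)
  obtain \<beta> where \<beta>: "\<beta> \<in> B" "\<forall>\<gamma>\<in>B. \<gamma> \<noteq> \<beta> \<longrightarrow> \<not> better \<beta> \<gamma>"
    using Finite_Set.bex_max_element[OF \<open>finite B\<close> as tr \<open>B \<noteq> {}\<close>] by blast
  have \<beta>c: "\<beta> \<in> weights" and \<beta>e: "equivalent \<alpha> \<beta>" using \<beta>(1) by (auto simp: B_def basic_def)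
  have "unimprovable (supp \<beta>)"
    unfolding unimprovable_def
  proof clarify
    fix \<mu> assume \<mu>: "\<mu> \<in> K" "pos \<mu>" "\<forall>i. i \<notin> supp \<beta> \<longrightarrow> 0 \<le> \<mu> i"
    have fin: "finite (supp \<beta>)" using supp_subset[OF \<beta>c] finite_index finite_subset by blast
    have "\<exists>\<epsilon>>0. \<forall>i\<in>supp \<beta>. 0 \<le> \<beta> i + \<epsilon> * \<mu> i"
    proof -
      define \<epsilon> where "\<epsilon> = Min (insert 1 ((\<lambda>i. \<beta> i / (\<bar>\<mu> i\<bar> + 1)) ` supp \<beta>))"
      have bp: "0 < \<beta> i" if "i \<in> supp \<beta>" for i
        using that \<beta>c by (auto simp: supp_def weights_def less_le)
      have "\<epsilon> > 0" unfolding \<epsilon>_def using fin bp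
        by (subst Min_gr_iff) (auto intro!: divide_pos_pos add_nonneg_pos)
      moreover have "0 \<le> \<beta> i + \<epsilon> * \<mu> i" if "i \<in> supp \<beta>" for i
      proof -
        have "\<epsilon> \<le> \<beta> i / (\<bar>\<mu> i\<bar> + 1)" unfolding \<epsilon>_def using fin that by (intro Min_le) auto
        then have "\<epsilon> * (\<bar>\<mu> i\<bar> + 1) \<le> \<beta> i" by (simp add: pos_le_divide_eq add_nonneg_pos)
        moreover have "- (\<epsilon> * \<mu> i) \<le> \<epsilon> * (\<bar>\<mu> i\<bar> + 1)"

        proof -
          have "\<epsilon> * - \<mu> i \<le> \<epsilon> * (\<bar>\<mu> i\<bar> + 1)"
            using \<open>\<epsilon> > 0\<close> by (intro mult_left_mono) auto
          then show ?thesis by simp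
        qed
        ultimately show ?thesis by linarith
      qed
      ultimately show ?thesis by blast
    qed
    then obtain \<epsilon> where \<epsilon>: "\<epsilon> > 0" "\<And>i. i \<in> supp \<beta> \<Longrightarrow> 0 \<le> \<beta> i + \<epsilon> * \<mu> i" by blast
    define \<gamma> where "\<gamma> = (\<lambda>i. \<beta> i + \<epsilon> * \<mu> i)"
    have "0 \<le> \<gamma> i" for i
      using \<epsilon> \<mu>(3) \<beta>c by (cases "i \<in> supp \<beta>") (auto simp: \<gamma>_def weights_def)
    then have "\<gamma> \<in> weights" using \<beta>c kernel_outside[OF \<mu>(1)] by (auto simp: weights_def \<gamma>_def)
    then obtain \<delta> where \<delta>: "basic \<delta>" "equivalent \<gamma> \<delta>" "\<delta> = \<gamma> \<or> better \<gamma> \<delta>"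
      using improve_to_basic by blast
    have "equivalent \<beta> \<gamma>" using kernel_scale[OF \<mu>(1)] by (simp add: equivalent_def \<gamma>_def)
    then have "equivalent \<alpha> \<delta>"
      using equivalent_trans[OF equivalent_trans[OF \<beta>e] \<delta>(2)] by blast
    then have "\<delta> \<in> B" using \<delta>(1) by (simp add: B_def)
    moreover have "better \<beta> \<gamma>" using pos_scale[OF \<mu>(2) \<epsilon>(1)] by (simp add: better_def \<gamma>_def)
    then have "better \<beta> \<delta>" using \<delta>(3) better_trans[of \<beta> \<gamma> \<delta>] by blast
    ultimately show False using \<beta>(2) better_irrefl[of \<beta>] by auto
  qed
  then show ?thesis using \<beta>c \<beta>e by blast
qed

lemma optimal_representation_best:
  assumes "\<alpha> \<in> weights" "\<beta> \<in> weights" "equivalent \<alpha> \<beta>" "unimprovable (supp \<beta>)"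
  shows "\<alpha> = \<beta> \<or> better \<alpha> \<beta>"
proof (rule ccontr)
  assume *: "\<not> (\<alpha> = \<beta> \<or> better \<alpha> \<beta>)"
  have K: "(\<lambda>i. \<alpha> i - \<beta> i) \<in> K" using equivalent_sym[OF assms(3)] by (simp add: equivalent_def)
  have "(\<lambda>i. \<alpha> i - \<beta> i) \<noteq> (\<lambda>_. 0)" using * by (auto simp: fun_eq_iff)
  then have "pos (\<lambda>i. \<alpha> i - \<beta> i)" using pos_total[OF K] * by (simp add: better_def)
  moreover have "0 \<le> \<alpha> i - \<beta> i" if "i \<notin> supp \<beta>" for i
    using that assms(1) by (simp add: supp_def weights_def)
  ultimately show False using assms(4) K unfolding unimprovable_def by blast
qed

lemma optimal_representation_unique:
  assumes "\<alpha> \<in> weights" "\<beta> \<in> weights" "equivalent \<alpha> \<beta>" "unimprovable (supp \<beta>)" "unimprovable (supp \<alpha>)"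
  shows "\<alpha> = \<beta>"
proof (rule ccontr)
  assume "\<alpha> \<noteq> \<beta>"
  then have "better \<alpha> \<beta>" "better \<beta> \<alpha>"
    using optimal_representation_best[of \<alpha> \<beta>] optimal_representation_best[of \<beta> \<alpha>]
      equivalent_sym[OF assms(3)] assms by auto
  then show False using better_trans[of \<alpha> \<beta> \<alpha>] better_irrefl by blast
qed

end

section \<open>Counting lattice points of half-open simplices\<close>

text \<open>
  Stars and bars, by induction on the index set.
\<close>

lemma card_compositions:
  assumes "finite \<tau>" "\<tau> \<noteq> {}"
  shows "finite {k :: 'i \<Rightarrow> nat. (\<forall>i. i \<notin> \<tau> \<longrightarrow> k i = 0) \<and> sum k \<tau> = s} \<and>
    card {k :: 'i \<Rightarrow> nat. (\<forall>i. i \<notin> \<tau> \<longrightarrow> k i = 0) \<and> sum k \<tau> = s} =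
      (s + (card \<tau> - 1)) choose (card \<tau> - 1)"
  using assms
proof (induction arbitrary: s rule: finite_ne_induct)
  case (singleton a)
  have "{k :: 'i \<Rightarrow> nat. (\<forall>i. i \<notin> {a} \<longrightarrow> k i = 0) \<and> sum k {a} = s} = {\<lambda>i. if i = a then s else 0}"
    by (auto simp: fun_eq_iff)
  then show ?case by simp
next
  case (insert a \<tau>)
  define P where "P = (\<lambda>\<sigma> s. {k :: 'i \<Rightarrow> nat. (\<forall>i. i \<notin> \<sigma> \<longrightarrow> k i = 0) \<and> sum k \<sigma> = s})"
  define m where "m = card \<tau> - 1"
  have m: "card \<tau> = Suc m" using insert.hyps by (cases "card \<tau>") (auto simp: m_def)
  have IH: "finite (P \<tau> r)" "card (P \<tau> r) = (r + m) choose m" for r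
    using insert.IH[of r] by (auto simp: P_def m_def)
  have "bij_betw (\<lambda>(j, k). k(a := j)) (SIGMA j:{..s}. P \<tau> (s - j)) (P (insert a \<tau>) s)"
  proof (rule bij_betw_byWitness[where f' = "\<lambda>k. (k a, k(a := 0))"])
    have "k a = 0" if "k \<in> P \<tau> r" for k r using that insert.hyps by (auto simp: P_def)
    then show "\<forall>x\<in>SIGMA j:{..s}. P \<tau> (s - j). (\<lambda>k. (k a, k(a := 0))) ((\<lambda>(j, k). k(a := j)) x) = x"
      by (auto simp: fun_eq_iff)
    show "\<forall>k\<in>P (insert a \<tau>) s. (\<lambda>(j, k). k(a := j)) ((\<lambda>k. (k a, k(a := 0))) k) = k" by auto
    have *: "(\<Sum>i\<in>\<tau>. if i = a then j else k i) = sum k \<tau>" for k :: "'i \<Rightarrow> nat" and j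
      using insert.hyps by (intro sum.cong) auto
    show "(\<lambda>(j, k). k(a := j)) ` (SIGMA j:{..s}. P \<tau> (s - j)) \<subseteq> P (insert a \<tau>) s"
      using insert.hyps by (auto simp: P_def *)
    show "(\<lambda>k. (k a, k(a := 0))) ` P (insert a \<tau>) s \<subseteq> (SIGMA j:{..s}. P \<tau> (s - j))"
      using insert.hyps by (auto simp: P_def *)
  qed
  then have "card (P (insert a \<tau>) s) = card (SIGMA j:{..s}. P \<tau> (s - j))"
    and fin: "finite (P (insert a \<tau>) s)"
    using IH by (auto simp: bij_betw_same_card dest: bij_betw_finite)
  then have "card (P (insert a \<tau>) s) = (\<Sum>j\<le>s. (s - j + m) choose m)"
    using IH by simp
  also have "\<dots> = (\<Sum>j\<le>s. (m + j) choose m)"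
    by (rule sum.reindex_bij_witness[of _ "\<lambda>j. s - j" "\<lambda>j. s - j"]) (auto simp: add.commute)
  also have "\<dots> = (m + s + 1) choose (m + 1)"
    by (rule choose_rising_sum(1))
  also have "\<dots> = (s + Suc m) choose Suc m"
    by (simp only: add.commute[of m s] Suc_eq_plus1 add.assoc)
  finally have "card (P (insert a \<tau>) s) = (s + Suc m) choose Suc m" .
  then show ?case using fin insert.hyps m by (simp add: P_def)
qed

lemma gbinomial_poly:
  "\<exists>p :: rat poly. degree p \<le> k \<and> (\<forall>x. poly p x = (x + c) gchoose k)"
proof -
  define p where "p = smult (1 / fact k) (\<Prod>i\<in>{0..<k}. [:c - of_nat i, 1:])"
  have "degree (\<Prod>i\<in>{0..<k}. [:c - of_nat i, 1:]) \<le> k"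
    using degree_prod_sum_le[of "{0..<k}" "\<lambda>i. [:c - of_nat i, 1:]"] by simp
  then have "degree p \<le> k" unfolding p_def using degree_smult_le le_trans by blast
  moreover have "poly p x = (x + c) gchoose k" for x
    by (simp add: p_def gbinomial_prod_rev poly_prod algebra_simps)
  ultimately show ?thesis by blast
qed

text \<open>
  The condition \<open>h < m\<close> makes the polynomial vanish at all \<open>n < h\<close>, so that it is correct from
  \<open>n = 0\<close> on.
\<close>

lemma shifted_binomial_poly:
  assumes "h < m"
  shows "\<exists>p :: rat poly. degree p \<le> m - 1 \<and>
    (\<forall>n::nat. poly p (of_nat n) = of_nat (if h \<le> n then (n - h + (m - 1)) choose (m - 1) else 0))"
proof -
  obtain p :: "rat poly" where p: "degree p \<le> m - 1"
    "\<And>x. poly p x = (x + of_nat (m - 1 - h)) gchoose (m - 1)"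
    using gbinomial_poly[of "m - 1" "of_nat (m - 1 - h)"] by blast
  have "poly p (of_nat n) = of_nat (if h \<le> n then (n - h + (m - 1)) choose (m - 1) else 0)" for n
  proof -
    have "poly p (of_nat n) = of_nat ((n + (m - 1 - h)) choose (m - 1))"
      by (simp only: p(2) of_nat_add[symmetric] binomial_gbinomial)
    moreover have "n + (m - 1 - h) = n - h + (m - 1)" if "h \<le> n" using that assms by simp
    moreover have "(n + (m - 1 - h)) choose (m - 1) = 0" if "\<not> h \<le> n"
      using that assms by (intro binomial_eq_0) simp
    ultimately show ?thesis by auto
  qed
  then show ?thesis using p(1) by blast
qed

definition integral :: "rat ^ 'n \<Rightarrow> bool" where
  "integral v \<longleftrightarrow> (\<forall>j. v $ j \<in> \<int>)"

lemma integral_add: "integral v \<Longrightarrow> integral w \<Longrightarrow> integral (v + w)"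
  and integral_diff: "integral v \<Longrightarrow> integral w \<Longrightarrow> integral (v - w)"
  by (simp_all add: integral_def)

lemma integral_scale: "c \<in> \<int> \<Longrightarrow> integral v \<Longrightarrow> integral (c *s v)"
  by (simp add: integral_def)

lemma integral_sum: "(\<And>i. i \<in> \<tau> \<Longrightarrow> integral (f i)) \<Longrightarrow> integral (\<Sum>i\<in>\<tau>. f i)"
  by (simp add: integral_def Ints_sum)

lemma finite_bounded_integral:
  "finite {v :: rat ^ 'n::finite. integral v \<and> (\<forall>j. \<bar>v $ j\<bar> \<le> C)}"
proof -
  define Z where "Z = (of_int :: int \<Rightarrow> rat) ` {-\<lceil>C\<rceil>..\<lceil>C\<rceil>}"
  have "v $ j \<in> Z" if "integral v" "\<bar>v $ j\<bar> \<le> C" for v :: "rat ^ 'n" and j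
  proof -
    obtain z where z: "v $ j = of_int z" using \<open>integral v\<close> by (auto simp: integral_def elim: Ints_cases)
    have "of_int \<bar>z\<bar> \<le> C" using that(2) z by simp
    then have "\<bar>z\<bar> \<le> \<lceil>C\<rceil>" by linarith
    then show ?thesis using z by (auto simp: Z_def abs_le_iff)
  qed
  then have "{v :: rat ^ 'n. integral v \<and> (\<forall>j. \<bar>v $ j\<bar> \<le> C)} \<subseteq> vec_lambda ` (UNIV \<rightarrow>\<^sub>E Z)"
    by (auto simp: image_iff intro!: bexI[of _ "vec_nth _"])
  moreover have "finite (vec_lambda ` (UNIV \<rightarrow>\<^sub>E Z) :: (rat ^ 'n) set)"
    by (simp add: Z_def finite_PiE)
  ultimately show ?thesis by (rule finite_subset)
qed

text \<open>
  The lattice points at height \<open>n\<close> in the cone over the simplex with vertices \<open>w i\<close>, by their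
  coefficients. All facets are removed except the one on which the coefficient of \<open>w a\<close> vanishes.
\<close>

definition half_open_points ::
    "'i set \<Rightarrow> 'i \<Rightarrow> ('i \<Rightarrow> rat ^ 'n::finite) \<Rightarrow> nat \<Rightarrow> ('i \<Rightarrow> rat) set" where
  "half_open_points \<tau> a w n =
    {\<beta>. 0 \<le> \<beta> a \<and> (\<forall>i\<in>\<tau> - {a}. 0 < \<beta> i) \<and> (\<forall>i. i \<notin> \<tau> \<longrightarrow> \<beta> i = 0) \<and>
        sum \<beta> \<tau> = of_nat n \<and> integral (\<Sum>i\<in>\<tau>. \<beta> i *s w i)}"

definition affinely_free :: "'i set \<Rightarrow> ('i \<Rightarrow> rat ^ 'n::finite) \<Rightarrow> bool" where
  "affinely_free \<tau> w \<longleftrightarrow>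
    (\<forall>\<mu>. (\<forall>i. i \<notin> \<tau> \<longrightarrow> \<mu> i = 0) \<and> sum \<mu> \<tau> = 0 \<and> (\<Sum>i\<in>\<tau>. \<mu> i *s w i) = 0 \<longrightarrow> (\<forall>i. \<mu> i = 0))"

text \<open>
  Subtracting integers from the coefficients moves every point into the fundamental box, in a unique
  way, and a box point at height \<open>h\<close> accounts for as many points at height \<open>n\<close> as there are
  ways to write \<open>n - h\<close> as a sum of \<open>card \<tau>\<close> natural numbers. The one closed facet makes the
  coefficient at \<open>a\<close> less than \<open>1\<close> in the box, so that \<open>h < card \<tau>\<close>; this is what makes the count polynomial from
  \<open>n = 0\<close> on and not only for large \<open>n\<close>.
\<close>

theorem card_half_open_points:
  fixes w :: "'i \<Rightarrow> rat ^ 'n::finite"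
  assumes "finite \<tau>" and a: "a \<in> \<tau>" and int: "\<And>i. i \<in> \<tau> \<Longrightarrow> integral (w i)"
    and free: "affinely_free \<tau> w"
  shows "\<exists>p :: rat poly. degree p \<le> card \<tau> - 1 \<and> (\<forall>n. finite (half_open_points \<tau> a w n) \<and>
    poly p (of_nat n) = of_nat (card (half_open_points \<tau> a w n)))"
proof -
  define m where "m = card \<tau>"
  define B where "B = {\<beta> :: 'i \<Rightarrow> rat. 0 \<le> \<beta> a \<and> \<beta> a < 1 \<and> (\<forall>i\<in>\<tau> - {a}. 0 < \<beta> i \<and> \<beta> i \<le> 1) \<and>
    (\<forall>i. i \<notin> \<tau> \<longrightarrow> \<beta> i = 0) \<and> sum \<beta> \<tau> \<in> \<int> \<and> integral (\<Sum>i\<in>\<tau>. \<beta> i *s w i)}"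
  have m0: "0 < m" using assms by (auto simp: m_def card_gt_0_iff)
  have Bnn: "0 \<le> \<beta> i" "\<beta> i \<le> 1" if "\<beta> \<in> B" for \<beta> i
  proof -
    consider "i \<notin> \<tau>" | "i = a" | "i \<in> \<tau> - {a}" by blast
    then have "0 \<le> \<beta> i \<and> \<beta> i \<le> 1" using that by cases (force simp: B_def)+
    then show "0 \<le> \<beta> i" "\<beta> i \<le> 1" by auto
  qed
  have height: "\<exists>h<m. sum \<beta> \<tau> = of_nat h" if "\<beta> \<in> B" for \<beta>
  proof -
    have "sum \<beta> \<tau> \<in> \<int>" using that by (simp add: B_def)
    then obtain z where z: "sum \<beta> \<tau> = of_int z" by (auto elim: Ints_cases)
    have "0 \<le> sum \<beta> \<tau>" using Bnn[OF that] by (simp add: sum_nonneg)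
    moreover have "sum \<beta> \<tau> < sum (\<lambda>_. 1) \<tau>"
      using Bnn(2)[OF that] a that \<open>finite \<tau>\<close> by (intro sum_strict_mono_ex1) (auto simp: B_def)
    ultimately have "0 \<le> z" "of_int z < (of_int (int m) :: rat)" using z by (simp_all add: m_def)
    then have "0 \<le> z" "z < int m" by (simp_all only: of_int_less_iff)
    then show ?thesis using z by (intro exI[of _ "nat z"]) auto
  qed
  define ht where "ht = (\<lambda>\<beta> :: 'i \<Rightarrow> rat. SOME h. h < m \<and> sum \<beta> \<tau> = of_nat h)"
  have ht: "ht \<beta> < m" "sum \<beta> \<tau> = of_nat (ht \<beta>)" if "\<beta> \<in> B" for \<beta>
    using someI_ex[OF height[OF that]] by (simp_all add: ht_def)
  have "finite B"
  proof -
    define C where "C = (\<Sum>j\<in>UNIV. \<Sum>i\<in>\<tau>. \<bar>w i $ j\<bar>)"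
    have bound: "\<bar>(\<Sum>i\<in>\<tau>. \<beta> i *s w i) $ j\<bar> \<le> C" if "\<beta> \<in> B" for \<beta> and j :: 'n
    proof -
      have "\<bar>(\<Sum>i\<in>\<tau>. \<beta> i *s w i) $ j\<bar> \<le> (\<Sum>i\<in>\<tau>. \<bar>\<beta> i * w i $ j\<bar>)"
        by simp
      also have "\<dots> \<le> (\<Sum>i\<in>\<tau>. \<bar>w i $ j\<bar>)"
        using Bnn[OF that] by (intro sum_mono) (auto simp: abs_mult intro: mult_left_le_one_le)
      also have "\<dots> \<le> C" unfolding C_def
        by (rule member_le_sum) (auto intro: sum_nonneg)
      finally show ?thesis .
    qed
    have "inj_on (\<lambda>\<beta>. (ht \<beta>, \<Sum>i\<in>\<tau>. \<beta> i *s w i)) B"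
    proof (rule inj_onI)
      fix \<beta> \<gamma> assume *: "\<beta> \<in> B" "\<gamma> \<in> B"
        "(ht \<beta>, \<Sum>i\<in>\<tau>. \<beta> i *s w i) = (ht \<gamma>, \<Sum>i\<in>\<tau>. \<gamma> i *s w i)"
      define \<mu> where "\<mu> = (\<lambda>i. \<beta> i - \<gamma> i)"
      from *(3) have eq: "ht \<beta> = ht \<gamma>" "(\<Sum>i\<in>\<tau>. \<beta> i *s w i) = (\<Sum>i\<in>\<tau>. \<gamma> i *s w i)"
        by (simp_all only: prod.inject)
      have "sum \<mu> \<tau> = 0"
        unfolding \<mu>_def sum_subtractf ht(2)[OF *(1)] ht(2)[OF *(2)] eq(1) by (rule diff_self)
      moreover have "(\<Sum>i\<in>\<tau>. \<mu> i *s w i) = 0"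
        unfolding \<mu>_def vec.scale_left_diff_distrib sum_subtractf eq(2) by (rule diff_self)
      moreover have "\<forall>i. i \<notin> \<tau> \<longrightarrow> \<mu> i = 0" using *(1,2) by (auto simp: \<mu>_def B_def)
      ultimately have "\<forall>i. \<mu> i = 0" using free unfolding affinely_free_def by blast
      then show "\<beta> = \<gamma>" by (auto simp: \<mu>_def)
    qed
    moreover have "(\<lambda>\<beta>. (ht \<beta>, \<Sum>i\<in>\<tau>. \<beta> i *s w i)) ` B \<subseteq>
        {..<m} \<times> {v. integral v \<and> (\<forall>j. \<bar>v $ j\<bar> \<le> C)}"
    proof (rule image_subsetI)
      fix \<beta> assume "\<beta> \<in> B"
      moreover from this have "integral (\<Sum>i\<in>\<tau>. \<beta> i *s w i)" by (simp add: B_def)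
      ultimately show "(ht \<beta>, \<Sum>i\<in>\<tau>. \<beta> i *s w i) \<in> {..<m} \<times> {v. integral v \<and> (\<forall>j. \<bar>v $ j\<bar> \<le> C)}"
        using ht(1) bound by (simp del: sum_component)
    qed
    moreover have "finite ({..<m} \<times> {v :: rat ^ 'n. integral v \<and> (\<forall>j. \<bar>v $ j\<bar> \<le> C)})"
      by (intro finite_cartesian_product finite_bounded_integral) simp
    ultimately show ?thesis by (rule inj_on_finite)
  qed
  define D where "D = (\<lambda>\<beta> n. {k :: 'i \<Rightarrow> nat. (\<forall>i. i \<notin> \<tau> \<longrightarrow> k i = 0) \<and> ht \<beta> + sum k \<tau> = n})"
  have D: "finite (D \<beta> n)"
      "card (D \<beta> n) = (if ht \<beta> \<le> n then (n - ht \<beta> + (m - 1)) choose (m - 1) else 0)" for \<beta> n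
  proof -
    have Deq: "D \<beta> n = (if ht \<beta> \<le> n then {k. (\<forall>i. i \<notin> \<tau> \<longrightarrow> k i = 0) \<and> sum k \<tau> = n - ht \<beta>} else {})"
      by (auto simp: D_def)
    have "\<tau> \<noteq> {}" using a by blast
    note c = card_compositions[OF \<open>finite \<tau>\<close> this, of "n - ht \<beta>", folded m_def]
    show "finite (D \<beta> n)" unfolding Deq using c by simp
    show "card (D \<beta> n) = (if ht \<beta> \<le> n then (n - ht \<beta> + (m - 1)) choose (m - 1) else 0)"
      unfolding Deq using c by (simp only: if_distrib card.empty if_True if_False split: if_split) simp
  qed
  have bij: "bij_betw (\<lambda>(\<beta>, k) i. \<beta> i + of_nat (k i)) (SIGMA \<beta>:B. D \<beta> n) (half_open_points \<tau> a w n)" for n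
  proof -
    \<comment> \<open>the unique number of unit steps down into the box: \<open>[0, 1)\<close> at \<open>a\<close>, \<open>(0, 1]\<close> elsewhere\<close>
    define steps :: "('i \<Rightarrow> rat) \<Rightarrow> 'i \<Rightarrow> nat" where
      "steps = (\<lambda>\<beta> i. if i = a then nat \<lfloor>\<beta> i\<rfloor> else nat (\<lceil>\<beta> i\<rceil> - 1))"
    have steps_add: "steps (\<lambda>i. \<beta> i + of_nat (k i)) = k" if "\<beta> \<in> B" "k \<in> D \<beta> n" for \<beta> k
    proof
      fix i
      consider "i \<notin> \<tau>" | "i = a" | "i \<in> \<tau> - {a}" by blast
      then show "steps (\<lambda>i. \<beta> i + of_nat (k i)) i = k i"
      proof cases
        case 1
        then have "\<beta> i = 0" "k i = 0" using that by (auto simp: B_def D_def)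
        then show ?thesis using 1 a by (auto simp: steps_def)
      next
        case 2
        have "\<lfloor>\<beta> a\<rfloor> = 0" using that by (simp add: B_def floor_eq_iff)
        then show ?thesis using 2 by (simp add: steps_def)
      next
        case 3
        then have "\<lceil>\<beta> i\<rceil> = 1" using that by (simp add: B_def ceiling_eq_iff)
        moreover have "\<lceil>\<beta> i + of_nat (k i)\<rceil> = \<lceil>\<beta> i\<rceil> + int (k i)"
          using ceiling_add_of_int[of "\<beta> i" "int (k i)"] by simp
        ultimately show ?thesis using 3 by (simp add: steps_def)
      qed
    qed
    show ?thesis
    proof (rule bij_betw_byWitness[where f' = "\<lambda>\<gamma>. (\<lambda>i. \<gamma> i - of_nat (steps \<gamma> i), steps \<gamma>)"])
      show "\<forall>x\<in>SIGMA \<beta>:B. D \<beta> n. (\<lambda>\<gamma>. (\<lambda>i. \<gamma> i - of_nat (steps \<gamma> i), steps \<gamma>))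
          ((\<lambda>(\<beta>, k) i. \<beta> i + of_nat (k i)) x) = x"
      proof clarify
        fix \<beta> k assume "\<beta> \<in> B" "k \<in> D \<beta> n"
        then have "steps (\<lambda>i. \<beta> i + of_nat (k i)) = k" by (rule steps_add)
        then show "(\<lambda>i. (\<beta> i + of_nat (k i)) - of_nat (steps (\<lambda>i. \<beta> i + of_nat (k i)) i)) = \<beta> \<and>
            steps (\<lambda>i. \<beta> i + of_nat (k i)) = k"
          by simp
      qed
      show "\<forall>\<gamma>\<in>half_open_points \<tau> a w n. (\<lambda>(\<beta>, k) i. \<beta> i + of_nat (k i))
          ((\<lambda>\<gamma>. (\<lambda>i. \<gamma> i - of_nat (steps \<gamma> i), steps \<gamma>)) \<gamma>) = \<gamma>"
        by (auto simp: fun_eq_iff)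
      show "(\<lambda>(\<beta>, k) i. \<beta> i + of_nat (k i)) ` (SIGMA \<beta>:B. D \<beta> n) \<subseteq> half_open_points \<tau> a w n"
      proof clarify
        fix \<beta> k assume *: "\<beta> \<in> B" "k \<in> D \<beta> n"
        have "integral ((\<Sum>i\<in>\<tau>. \<beta> i *s w i) + (\<Sum>i\<in>\<tau>. of_nat (k i) *s w i))"
          using *(1) int by (intro integral_add[OF _ integral_sum] integral_scale) (auto simp: B_def)
        then have "integral (\<Sum>i\<in>\<tau>. (\<beta> i + of_nat (k i)) *s w i)"
          by (simp add: vec.scale_left_distrib sum.distrib)
        moreover have "(\<Sum>i\<in>\<tau>. \<beta> i + of_nat (k i)) = of_nat n"
          using ht(2)[OF *(1)] *(2) by (auto simp: sum.distrib D_def)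
        ultimately show "(\<lambda>i. \<beta> i + of_nat (k i)) \<in> half_open_points \<tau> a w n"
          using * by (auto simp: half_open_points_def B_def D_def intro: add_pos_nonneg)
      qed
      show "(\<lambda>\<gamma>. (\<lambda>i. \<gamma> i - of_nat (steps \<gamma> i), steps \<gamma>)) ` half_open_points \<tau> a w n \<subseteq> (SIGMA \<beta>:B. D \<beta> n)"
      proof (rule image_subsetI)
        fix \<gamma> assume *: "\<gamma> \<in> half_open_points \<tau> a w n"
        define \<beta> where "\<beta> = (\<lambda>i. \<gamma> i - of_nat (steps \<gamma> i))"
        have "0 \<le> \<beta> a \<and> \<beta> a < 1"
        proof -
          have "0 \<le> \<gamma> a" using * by (simp add: half_open_points_def)
          then have "\<beta> a = \<gamma> a - of_int \<lfloor>\<gamma> a\<rfloor>" by (simp add: \<beta>_def steps_def)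
          then show ?thesis by linarith
        qed
        moreover have "0 < \<beta> i \<and> \<beta> i \<le> 1" if "i \<in> \<tau> - {a}" for i
        proof -
          have "0 < \<gamma> i" using * that by (simp add: half_open_points_def)
          then have "1 \<le> \<lceil>\<gamma> i\<rceil>" by linarith
          then have "\<beta> i = \<gamma> i - of_int (\<lceil>\<gamma> i\<rceil> - 1)" using that by (simp add: \<beta>_def steps_def)
          then show ?thesis by linarith
        qed
        moreover have off: "\<forall>i. i \<notin> \<tau> \<longrightarrow> \<beta> i = 0 \<and> steps \<gamma> i = 0"
          using * a by (auto simp: half_open_points_def \<beta>_def steps_def)
        moreover have sum: "sum \<beta> \<tau> = of_nat n - of_nat (sum (steps \<gamma>) \<tau>)"
          using * by (simp add: half_open_points_def \<beta>_def sum_subtractf)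
        moreover have "integral (\<Sum>i\<in>\<tau>. \<beta> i *s w i)"
        proof -
          have "integral ((\<Sum>i\<in>\<tau>. \<gamma> i *s w i) - (\<Sum>i\<in>\<tau>. of_nat (steps \<gamma> i) *s w i))"
            using * int by (intro integral_diff[OF _ integral_sum] integral_scale)
              (auto simp: half_open_points_def)
          then show ?thesis by (simp add: \<beta>_def vec.scale_left_diff_distrib sum_subtractf)
        qed
        ultimately have "\<beta> \<in> B" unfolding B_def mem_Collect_eq
          using Ints_of_nat[where ?'a = rat] by (intro conjI ballI allI impI) (simp_all add: sum del: of_nat_sum)
        moreover have "steps \<gamma> \<in> D \<beta> n"
        proof -
          have "of_nat (ht \<beta>) + of_nat (sum (steps \<gamma>) \<tau>) = (of_nat n :: rat)"
            unfolding ht(2)[OF \<open>\<beta> \<in> B\<close>, symmetric] sum by (rule diff_add_cancel)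
          then have "ht \<beta> + sum (steps \<gamma>) \<tau> = n" by (simp only: of_nat_add[symmetric] of_nat_eq_iff)
          then show ?thesis using off by (simp add: D_def)
        qed
        ultimately show "(\<lambda>i. \<gamma> i - of_nat (steps \<gamma> i), steps \<gamma>) \<in> (SIGMA \<beta>:B. D \<beta> n)"
          by (simp add: \<beta>_def)
      qed
    qed
  qed
  have finS: "finite (SIGMA \<beta>:B. D \<beta> n)" for n
    by (rule finite_SigmaI[OF \<open>finite B\<close> D(1)])
  have fin: "finite (half_open_points \<tau> a w n)" for n
    using finS[of n] unfolding bij_betw_finite[OF bij[of n]] .
  have cd: "card (half_open_points \<tau> a w n) = (\<Sum>\<beta>\<in>B. card (D \<beta> n))" for n
    unfolding bij_betw_same_card[OF bij[of n], symmetric]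
    by (rule card_SigmaI) (use \<open>finite B\<close> D(1) in auto)
  have "\<forall>\<beta>\<in>B. \<exists>p :: rat poly. degree p \<le> m - 1 \<and> (\<forall>n. poly p (of_nat n) = of_nat (card (D \<beta> n)))"
    unfolding D(2) by (rule ballI, rule shifted_binomial_poly, rule ht(1))
  from bchoice[OF this] obtain p where p:
    "\<forall>\<beta>\<in>B. degree (p \<beta>) \<le> m - 1 \<and> (\<forall>n. poly (p \<beta>) (of_nat n :: rat) = of_nat (card (D \<beta> n)))" ..
  show ?thesis
  proof (intro exI[of _ "\<Sum>\<beta>\<in>B. p \<beta>"] conjI allI)
    show "degree (\<Sum>\<beta>\<in>B. p \<beta>) \<le> card \<tau> - 1"
      using p \<open>finite B\<close> by (intro degree_sum_le) (auto simp: m_def)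
    show "finite (half_open_points \<tau> a w n)" for n by (rule fin)
    show "poly (\<Sum>\<beta>\<in>B. p \<beta>) (of_nat n) = of_nat (card (half_open_points \<tau> a w n))" for n
      unfolding cd poly_sum of_nat_sum using p by (intro sum.cong refl) blast
  qed
qed

lemma card_affinely_free:
  fixes w :: "'i \<Rightarrow> rat ^ 'n::finite"
  assumes "finite \<tau>" "affinely_free \<tau> w"
  shows "card \<tau> - 1 \<le> CARD('n)"
proof (cases "\<tau> = {}")
  case False
  then obtain a where a: "a \<in> \<tau>" by blast
  define u where "u = (\<lambda>i. w i - w a)"
  have key: "\<forall>i\<in>\<tau> - {a}. \<nu> i = 0" if "(\<Sum>i\<in>\<tau> - {a}. \<nu> i *s u i) = 0" for \<nu>
  proof -
    define \<mu> where "\<mu> = (\<lambda>i. if i = a then - sum \<nu> (\<tau> - {a}) else if i \<in> \<tau> then \<nu> i else 0)"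
    have 1: "sum \<mu> \<tau> = 0" 
      unfolding sum.remove[OF assms(1) a] by (simp add: \<mu>_def)
    have "(\<Sum>i\<in>\<tau> - {a}. \<mu> i *s w i) = (\<Sum>i\<in>\<tau> - {a}. \<nu> i *s w i)"
      by (intro sum.cong) (auto simp: \<mu>_def)
    moreover have "(\<Sum>i\<in>\<tau> - {a}. \<nu> i *s u i) = (\<Sum>i\<in>\<tau> - {a}. \<nu> i *s w i) - sum \<nu> (\<tau> - {a}) *s w a"
      by (simp add: u_def vector_ssub_ldistrib sum_subtractf vec.scale_sum_left)
    ultimately have 2: "(\<Sum>i\<in>\<tau>. \<mu> i *s w i) = 0"
      unfolding sum.remove[OF assms(1) a] using that by (simp add: \<mu>_def vector_smult_lneg)
    have "\<forall>i. i \<notin> \<tau> \<longrightarrow> \<mu> i = 0" using a by (auto simp: \<mu>_def)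
    then have "\<forall>i. \<mu> i = 0" using assms(2) 1 2 unfolding affinely_free_def by blast
    then show ?thesis by (auto simp: \<mu>_def split: if_splits)
  qed
  have inj: "inj_on u (\<tau> - {a})"
  proof (rule inj_onI, rule ccontr)
    fix i j assume *: "i \<in> \<tau> - {a}" "j \<in> \<tau> - {a}" "u i = u j" "i \<noteq> j"
    define \<nu> where "\<nu> = (\<lambda>l. if l = i then 1 else if l = j then -1 else 0 :: rat)"
    have "(\<Sum>l\<in>\<tau> - {a}. \<nu> l *s u l) = (\<Sum>l\<in>{i, j}. \<nu> l *s u l)"
      using * assms(1) by (intro sum.mono_neutral_right) (auto simp: \<nu>_def)
    also have "\<dots> = 0" using * by (simp add: \<nu>_def vector_smult_lneg)
    finally show False using key * by (force simp: \<nu>_def)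
  qed
  have "vec.independent (u ` (\<tau> - {a}))"
  proof (rule vec.independent_if_scalars_zero)
    fix f x assume *: "(\<Sum>x\<in>u ` (\<tau> - {a}). f x *s x) = 0" "x \<in> u ` (\<tau> - {a})"
    have "(\<Sum>i\<in>\<tau> - {a}. f (u i) *s u i) = 0"
      using *(1) unfolding sum.reindex[OF inj] o_def .
    from key[OF this] show "f x = 0" using *(2) by blast
  qed (use assms in simp)
  from vec.independent_card_le_dim[OF subset_UNIV this]
  have "card (u ` (\<tau> - {a})) \<le> CARD('n)" by (simp add: vec.dim_UNIV card_cart_basis)
  then show ?thesis using inj assms(1) a by (simp add: card_image)
qed simp

section \<open>Ehrhart polynomials\<close>

text \<open>
  Maximizing the coefficients lexicographically amounts to pulling the vertices one after the other.
\<close>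

definition lexicographic_pos :: "(nat \<Rightarrow> rat) \<Rightarrow> bool" where
  "lexicographic_pos \<mu> \<longleftrightarrow> (\<exists>i. 0 < \<mu> i \<and> (\<forall>j<i. \<mu> j = 0))"

lemma lexicographic_pos_total:
  assumes "\<mu> \<noteq> (\<lambda>_. 0)"
  shows "lexicographic_pos \<mu> \<or> lexicographic_pos (\<lambda>i. - \<mu> i)"
proof -
  define i where "i = (LEAST i. \<mu> i \<noteq> 0)"
  have "\<exists>i. \<mu> i \<noteq> 0" using assms by auto
  then have "\<mu> i \<noteq> 0" unfolding i_def by (rule LeastI_ex)
  moreover have "\<forall>j<i. \<mu> j = 0" unfolding i_def using not_less_Least by blast
  ultimately show ?thesis unfolding lexicographic_pos_def by (metis neg_0_less_iff_less neg_equal_0_iff_equal linorder_neqE_linordered_idom)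
qed

lemma lexicographic_pos_add:
  assumes "lexicographic_pos \<mu>" "lexicographic_pos \<nu>"
  shows "lexicographic_pos (\<lambda>i. \<mu> i + \<nu> i)"
proof -
  obtain i where i: "0 < \<mu> i" "\<forall>l<i. \<mu> l = 0" using assms(1) by (auto simp: lexicographic_pos_def)
  obtain j where j: "0 < \<nu> j" "\<forall>l<j. \<nu> l = 0" using assms(2) by (auto simp: lexicographic_pos_def)
  consider "i < j" | "j < i" | "i = j" by linarith
  then have "0 < \<mu> (min i j) + \<nu> (min i j) \<and> (\<forall>l<min i j. \<mu> l + \<nu> l = 0)"
    using i j by cases auto
  then show ?thesis unfolding lexicographic_pos_def by blast
qed

lemma lexicographic_pos_scale:
  assumes "lexicographic_pos \<mu>" "0 < c" shows "lexicographic_pos (\<lambda>i. c * \<mu> i)"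
  using assms unfolding lexicographic_pos_def by (metis mult_pos_pos mult_zero_right)

lemma not_lexicographic_pos_zero: "\<not> lexicographic_pos (\<lambda>_. 0)"
  by (simp add: lexicographic_pos_def)

definition dependencies :: "nat \<Rightarrow> (nat \<Rightarrow> rat ^ 'n::finite) \<Rightarrow> (nat \<Rightarrow> rat) set" where
  "dependencies N w = {\<mu>. (\<forall>i\<ge>N. \<mu> i = 0) \<and> (\<Sum>i<N. \<mu> i) = 0 \<and> (\<Sum>i<N. \<mu> i *s w i) = 0}"

lemma optimal_representation_dependencies:
  "optimal_representation {..<N} (dependencies N w) lexicographic_pos"
proof
  show "dependencies N w \<noteq> {}"
    by (auto simp: dependencies_def intro!: exI[of _ "\<lambda>_. 0"])
  show "(\<lambda>i. \<mu> i + \<nu> i) \<in> dependencies N w" if "\<mu> \<in> dependencies N w" "\<nu> \<in> dependencies N w" for \<mu> \<nu>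
    using that by (simp add: dependencies_def sum.distrib vec.scale_left_distrib)
  show "(\<lambda>i. c * \<mu> i) \<in> dependencies N w" if "\<mu> \<in> dependencies N w" for \<mu> c
  proof -
    have "(\<Sum>i<N. (c * \<mu> i) *s w i) = c *s (\<Sum>i<N. \<mu> i *s w i)"
      by (simp add: vec.scale_sum_right)
    then show ?thesis using that by (simp add: dependencies_def flip: sum_distrib_left)
  qed
  show "\<exists>i\<in>{..<N}. \<mu> i < 0" if \<mu>: "\<mu> \<in> dependencies N w" "lexicographic_pos \<mu>" for \<mu>
  proof (rule ccontr)
    assume "\<not> ?thesis"
    then have nn: "\<forall>i\<in>{..<N}. 0 \<le> \<mu> i" by force
    then have "\<forall>i\<in>{..<N}. \<mu> i = 0"
      using \<mu>(1) sum_nonneg_eq_0_iff[of "{..<N}" \<mu>] by (auto simp: dependencies_def)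
    then have "\<mu> i = 0" for i
      using \<mu>(1) by (cases "i < N") (auto simp: dependencies_def)
    then have "\<mu> = (\<lambda>_. 0)" by blast
    then show False using \<mu>(2) not_lexicographic_pos_zero by simp
  qed
qed (auto simp: dependencies_def lexicographic_pos_total lexicographic_pos_add
    lexicographic_pos_scale not_lexicographic_pos_zero)

lemma subset_conv:
  assumes "v \<in> F" shows "v \<in> conv F"
  unfolding conv_def mem_Collect_eq
  by (rule exI[of _ "{v}"], rule exI[of _ "\<lambda>_. 1"]) (use assms in simp)

lemma conv_finite:
  assumes "finite F"
  shows "y \<in> conv F \<longleftrightarrow> (\<exists>c. (\<forall>v\<in>F. 0 \<le> c v) \<and> sum c F = 1 \<and> y = (\<Sum>v\<in>F. c v *s v))"
proof
  assume "y \<in> conv F"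
  then obtain G c where G: "finite G" "G \<subseteq> F" "\<forall>x\<in>G. 0 \<le> c x" "sum c G = 1" "y = (\<Sum>x\<in>G. c x *s x)"
    unfolding conv_def by blast
  define c' where "c' = (\<lambda>x. if x \<in> G then c x else 0)"
  have "sum c' F = sum c' G"
    using assms G(2) by (intro sum.mono_neutral_right) (auto simp: c'_def)
  also have "\<dots> = 1" using G(4) by (simp add: c'_def)
  finally have 1: "sum c' F = 1" .
  have "(\<Sum>x\<in>F. c' x *s x) = (\<Sum>x\<in>G. c' x *s x)"
    using assms G(2) by (intro sum.mono_neutral_right) (auto simp: c'_def)
  also have "\<dots> = y" using G(5) by (simp add: c'_def)
  finally have 2: "y = (\<Sum>x\<in>F. c' x *s x)" by simp
  have "\<forall>v\<in>F. 0 \<le> c' v" using G(3) by (simp add: c'_def)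
  then show "\<exists>c. (\<forall>v\<in>F. 0 \<le> c v) \<and> sum c F = 1 \<and> y = (\<Sum>v\<in>F. c v *s v)"
    using 1 2 by blast
next
  assume "\<exists>c. (\<forall>v\<in>F. 0 \<le> c v) \<and> sum c F = 1 \<and> y = (\<Sum>v\<in>F. c v *s v)"
  then show "y \<in> conv F" unfolding conv_def mem_Collect_eq using assms by blast
qed

lemma dilate_conv:
  fixes F :: "(rat ^ 'n::finite) set"
  assumes "finite F" "F \<noteq> {}"
  shows "x \<in> (\<lambda>x. of_nat n *s x) ` conv F \<longleftrightarrow>
    (\<exists>c. (\<forall>v\<in>F. 0 \<le> c v) \<and> sum c F = of_nat n \<and> x = (\<Sum>v\<in>F. c v *s v))"
proof
  assume "x \<in> (\<lambda>x. of_nat n *s x) ` conv F"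
  then obtain y where y: "y \<in> conv F" "x = of_nat n *s y" by blast
  from y(1) obtain c where c: "\<forall>v\<in>F. 0 \<le> c v" "sum c F = 1" "y = (\<Sum>v\<in>F. c v *s v)"
    unfolding conv_finite[OF assms(1)] by blast
  have "x = (\<Sum>v\<in>F. (of_nat n * c v) *s v)" unfolding y(2) c(3) by (simp add: vec.scale_sum_right)
  moreover have "(\<Sum>v\<in>F. of_nat n * c v) = of_nat n" by (simp add: c(2) flip: sum_distrib_left)
  moreover have "\<forall>v\<in>F. 0 \<le> of_nat n * c v" using c(1) by simp
  ultimately show "\<exists>c. (\<forall>v\<in>F. 0 \<le> c v) \<and> sum c F = of_nat n \<and> x = (\<Sum>v\<in>F. c v *s v)"
    by (intro exI[of _ "\<lambda>v. of_nat n * c v"]) simp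
next
  assume "\<exists>c. (\<forall>v\<in>F. 0 \<le> c v) \<and> sum c F = of_nat n \<and> x = (\<Sum>v\<in>F. c v *s v)"
  then obtain c where c: "\<forall>v\<in>F. 0 \<le> c v" "sum c F = of_nat n" "x = (\<Sum>v\<in>F. c v *s v)" by blast
  show "x \<in> (\<lambda>x. of_nat n *s x) ` conv F"
  proof (cases "n = 0")
    case True
    then have "\<forall>v\<in>F. c v = 0" using c(1,2) sum_nonneg_eq_0_iff[OF assms(1), of c] by simp
    then have "x = 0" using c(3) by simp
    obtain v where "v \<in> F" using \<open>F \<noteq> {}\<close> by blast
    then have "v \<in> conv F" by (rule subset_conv)
    then show ?thesis unfolding image_iff using True \<open>x = 0\<close> by (intro bexI[of _ v]) simp_all
  next
    case False
    define b where "b = (\<lambda>v. c v / of_nat n)"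
    have "sum b F = 1" using c(2) False by (simp add: b_def flip: sum_divide_distrib)
    moreover have "\<forall>v\<in>F. 0 \<le> b v" using c(1) by (simp add: b_def)
    ultimately have "(\<Sum>v\<in>F. b v *s v) \<in> conv F"
      unfolding conv_finite[OF assms(1)] by blast
    moreover have "of_nat n *s (\<Sum>v\<in>F. b v *s v) = x"
      using False unfolding c(3) by (simp add: b_def vec.scale_sum_right)
    ultimately show ?thesis by blast
  qed
qed

definition of_int_vec :: "int ^ 'n \<Rightarrow> rat ^ 'n::finite" where
  "of_int_vec z = (\<chi> i. of_int (z $ i))"

lemma dilate_conv_indexed:
  fixes w :: "nat \<Rightarrow> rat ^ 'n::finite"
  assumes w: "bij_betw w {..<N} F" and "F \<noteq> {}"
  shows "x \<in> (\<lambda>x. of_nat n *s x) ` conv F \<longleftrightarrow>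
    (\<exists>\<alpha>. (\<forall>i. 0 \<le> \<alpha> i) \<and> (\<forall>i\<ge>N. \<alpha> i = 0) \<and> (\<Sum>i<N. \<alpha> i) = of_nat n \<and> x = (\<Sum>i<N. \<alpha> i *s w i))"
    (is "_ \<longleftrightarrow> ?R")
proof -
  have fin: "finite F" unfolding bij_betw_finite[OF w, symmetric] by simp
  have wF: "w i \<in> F" if "i < N" for i using that w by (auto simp: bij_betw_def)
  have sums: "sum c F = (\<Sum>i<N. c (w i))" "(\<Sum>v\<in>F. c v *s v) = (\<Sum>i<N. c (w i) *s w i)" for c
    by (rule sum.reindex_bij_betw[OF w, symmetric])+
  show ?thesis
    unfolding dilate_conv[OF fin assms(2)]
  proof
    assume "\<exists>c. (\<forall>v\<in>F. 0 \<le> c v) \<and> sum c F = of_nat n \<and> x = (\<Sum>v\<in>F. c v *s v)"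
    then obtain c where c: "\<forall>v\<in>F. 0 \<le> c v" "sum c F = of_nat n" "x = (\<Sum>v\<in>F. c v *s v)" by blast
    show ?R
    proof (intro exI[of _ "\<lambda>i. if i < N then c (w i) else 0"] conjI allI impI)
      show "0 \<le> (if i < N then c (w i) else 0)" for i using c(1) wF[of i] by simp
      show "(\<Sum>i<N. if i < N then c (w i) else 0) = of_nat n"
        unfolding c(2)[symmetric] sums by (rule sum.cong) simp_all
      show "x = (\<Sum>i<N. (if i < N then c (w i) else 0) *s w i)"
        unfolding c(3) sums by (rule sum.cong) simp_all
    qed simp
  next
    assume ?R
    then obtain \<alpha> where \<alpha>: "\<forall>i. 0 \<le> \<alpha> i" "(\<Sum>i<N. \<alpha> i) = of_nat n" "x = (\<Sum>i<N. \<alpha> i *s w i)" by blast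
    define c where "c = (\<lambda>v. \<alpha> (the_inv_into {..<N} w v))"
    have c: "c (w i) = \<alpha> i" if "i < N" for i
      using that w by (simp add: c_def the_inv_into_f_f bij_betw_def)
    have "sum c F = of_nat n" unfolding sums using c \<alpha>(2) by simp
    moreover have "x = (\<Sum>v\<in>F. c v *s v)" unfolding sums using c \<alpha>(3) by simp
    moreover have "\<forall>v\<in>F. 0 \<le> c v" using \<alpha>(1) by (simp add: c_def)
    ultimately show "\<exists>c. (\<forall>v\<in>F. 0 \<le> c v) \<and> sum c F = of_nat n \<and> x = (\<Sum>v\<in>F. c v *s v)" by blast
  qed
qed

text \<open>
  Every point of the cone over \<open>conv F\<close> has exactly one lexicographically maximal representation, and
  the supports of these representations are the cells of a triangulation. Since the coefficient of
  the first vertex is maximized first, raising it is never an obstacle: a cell remains a cell when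
  this vertex is added. The cells \<open>\<tau>\<close> and \<open>\<tau> - {0}\<close> together form a half-open simplex with one closed
  facet. The cone is thus a disjoint union of such simplices, all of whose counting functions are
  polynomials from \<open>n = 0\<close> on.
\<close>

theorem ehrhart:
  fixes F :: "(rat ^ 'n::finite) set"
  assumes "finite F" "F \<noteq> {}" and int: "\<And>v. v \<in> F \<Longrightarrow> integral v"
  shows "\<exists>p :: rat poly. degree p \<le> CARD('n) \<and>
    (\<forall>n. poly p (of_nat n) = of_nat (ehrhart_function (conv F) n))"
proof -
  obtain w where w0: "bij_betw w {0..<card F} F" using ex_bij_betw_nat_finite[OF \<open>finite F\<close>] by blast
  define N where "N = card F"
  have w: "bij_betw w {..<N} F" using w0 by (simp add: N_def lessThan_atLeast0)
  have N: "0 < N" using assms(1,2) by (simp add: N_def card_gt_0_iff)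
  have wint: "integral (w i)" if "i < N" for i using int that w by (auto simp: bij_betw_def)
  interpret O: optimal_representation "{..<N}" "dependencies N w" lexicographic_pos
    by (rule optimal_representation_dependencies)
  have mem_dep: "O.equivalent \<alpha> \<beta> \<longleftrightarrow> (\<Sum>i<N. \<alpha> i) = (\<Sum>i<N. \<beta> i) \<and> (\<Sum>i<N. \<alpha> i *s w i) = (\<Sum>i<N. \<beta> i *s w i)"
    if "\<alpha> \<in> O.weights" "\<beta> \<in> O.weights" for \<alpha> \<beta>
  proof -
    have "\<forall>i\<ge>N. \<beta> i - \<alpha> i = 0" using that by (simp add: O.weights_def)
    then show ?thesis
      unfolding O.equivalent_def
      unfolding dependencies_def mem_Collect_eq sum_subtractf
        vec.scale_left_diff_distrib right_minus_eq by auto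
  qed
  define R where "R = (\<lambda>n. {\<alpha> \<in> O.weights. O.unimprovable (O.supp \<alpha>) \<and>
    (\<Sum>i<N. \<alpha> i) = of_nat n \<and> integral (\<Sum>i<N. \<alpha> i *s w i)})"
  define L where "L = (\<lambda>n. {z :: int ^ 'n. of_int_vec z \<in> (\<lambda>x. of_nat n *s x) ` conv F})"
  have cardL: "ehrhart_function (conv F) n = card (L n)" for n
    by (simp add: ehrhart_function_def L_def of_int_vec_def)
  have L: "z \<in> L n \<longleftrightarrow> (\<exists>\<alpha>\<in>O.weights. (\<Sum>i<N. \<alpha> i) = of_nat n \<and> of_int_vec z = (\<Sum>i<N. \<alpha> i *s w i))" for z n
    unfolding L_def mem_Collect_eq dilate_conv_indexed[OF w assms(2)]
    by (auto simp: O.weights_def not_less)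
  define fl where "fl = (\<lambda>x :: rat ^ 'n. \<chi> j. \<lfloor>x $ j\<rfloor>)"
  have fl: "of_int_vec (fl x) = x" if "integral x" for x
    using that by (simp add: of_int_vec_def fl_def integral_def vec_eq_iff)
  have fl': "fl (of_int_vec z) = z" for z by (simp add: of_int_vec_def fl_def vec_eq_iff)
  have int_of: "integral (of_int_vec z)" for z :: "int ^ 'n" by (simp add: integral_def of_int_vec_def)
  have bij: "bij_betw (\<lambda>\<alpha>. fl (\<Sum>i<N. \<alpha> i *s w i)) (R n) (L n)" for n
    unfolding bij_betw_def
  proof
    show "inj_on (\<lambda>\<alpha>. fl (\<Sum>i<N. \<alpha> i *s w i)) (R n)"
    proof (rule inj_onI)
      fix \<alpha> \<beta> assume *: "\<alpha> \<in> R n" "\<beta> \<in> R n" "fl (\<Sum>i<N. \<alpha> i *s w i) = fl (\<Sum>i<N. \<beta> i *s w i)"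
      have "(\<Sum>i<N. \<alpha> i *s w i) = of_int_vec (fl (\<Sum>i<N. \<alpha> i *s w i))"
        by (rule fl[symmetric]) (use *(1) in \<open>simp add: R_def\<close>)
      also have "\<dots> = (\<Sum>i<N. \<beta> i *s w i)"
        unfolding *(3) by (rule fl) (use *(2) in \<open>simp add: R_def\<close>)
      finally have "(\<Sum>i<N. \<alpha> i *s w i) = (\<Sum>i<N. \<beta> i *s w i)" .
      moreover have "(\<Sum>i<N. \<alpha> i) = (\<Sum>i<N. \<beta> i)" using *(1,2) by (simp add: R_def)
      moreover have W: "\<alpha> \<in> O.weights" "\<beta> \<in> O.weights" using *(1,2) by (simp_all add: R_def)
      ultimately have "O.equivalent \<alpha> \<beta>" using mem_dep[OF W] by blast
      moreover have "O.unimprovable (O.supp \<beta>)" "O.unimprovable (O.supp \<alpha>)"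
        using *(1,2) by (simp_all add: R_def)
      ultimately show "\<alpha> = \<beta>" by (rule O.optimal_representation_unique[OF W])
    qed
    show "(\<lambda>\<alpha>. fl (\<Sum>i<N. \<alpha> i *s w i)) ` R n = L n"
    proof (rule equalityI)
      show "(\<lambda>\<alpha>. fl (\<Sum>i<N. \<alpha> i *s w i)) ` R n \<subseteq> L n"
      proof (rule image_subsetI)
        fix \<alpha> assume \<alpha>: "\<alpha> \<in> R n"
        then have "of_int_vec (fl (\<Sum>i<N. \<alpha> i *s w i)) = (\<Sum>i<N. \<alpha> i *s w i)"
          by (intro fl) (simp add: R_def)
        moreover have "\<alpha> \<in> O.weights" "(\<Sum>i<N. \<alpha> i) = of_nat n" using \<alpha> by (simp_all add: R_def)
        ultimately show "fl (\<Sum>i<N. \<alpha> i *s w i) \<in> L n" unfolding L by blast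
      qed
      show "L n \<subseteq> (\<lambda>\<alpha>. fl (\<Sum>i<N. \<alpha> i *s w i)) ` R n"
      proof
        fix z assume "z \<in> L n"
        then obtain \<alpha> where \<alpha>: "\<alpha> \<in> O.weights" "(\<Sum>i<N. \<alpha> i) = of_nat n" "of_int_vec z = (\<Sum>i<N. \<alpha> i *s w i)"
          unfolding L by blast
        obtain \<beta> where \<beta>: "\<beta> \<in> O.weights" "O.equivalent \<alpha> \<beta>" "O.unimprovable (O.supp \<beta>)"
          using O.optimal_representation_exists[OF \<alpha>(1)] by blast
        have e: "(\<Sum>i<N. \<beta> i) = of_nat n" "(\<Sum>i<N. \<beta> i *s w i) = of_int_vec z"
          using \<beta>(2) unfolding mem_dep[OF \<alpha>(1) \<beta>(1)] \<alpha>(2,3) by auto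
        have "\<beta> \<in> R n" unfolding R_def mem_Collect_eq e using \<beta> int_of by simp
        moreover have "z = fl (\<Sum>i<N. \<beta> i *s w i)" unfolding e fl' ..
        ultimately show "z \<in> (\<lambda>\<alpha>. fl (\<Sum>i<N. \<alpha> i *s w i)) ` R n" by blast
      qed
    qed
  qed
  \<comment> \<open>the cells of the pulling triangulation at the first vertex that contain this vertex\<close>
  define T where "T = {\<tau>. \<tau> \<subseteq> {..<N} \<and> 0 \<in> \<tau> \<and> O.unimprovable \<tau>}"
  have "finite T" unfolding T_def by (rule finite_subset[of _ "Pow {..<N}"]) auto
  have cone: "O.unimprovable (insert 0 \<sigma>)" if "O.unimprovable \<sigma>" for \<sigma>
  proof -
    have "0 \<le> \<mu> 0" if "lexicographic_pos \<mu>" for \<mu>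
      using that unfolding lexicographic_pos_def by (metis gr0I less_eq_rat_def order_refl)
    then show ?thesis using that unfolding O.unimprovable_def by (metis insert_iff)
  qed
  have restrict: "(\<Sum>i<N. f i) = (\<Sum>i\<in>\<tau>. f i)" if "\<tau> \<subseteq> {..<N}" "\<And>i. i \<notin> \<tau> \<Longrightarrow> f i = 0"
    for \<tau> and f :: "nat \<Rightarrow> 'b::comm_monoid_add"
    using that by (intro sum.mono_neutral_right) auto
  have points: "\<alpha> \<in> half_open_points \<tau> 0 w n \<longleftrightarrow> \<alpha> \<in> R n \<and> insert 0 (O.supp \<alpha>) = \<tau>" if \<tau>: "\<tau> \<in> T" for \<tau> \<alpha> n
  proof -
    have sub: "\<tau> \<subseteq> {..<N}" "0 \<in> \<tau>" "O.unimprovable \<tau>" using \<tau> by (auto simp: T_def)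
    show ?thesis
    proof
      assume h: "\<alpha> \<in> half_open_points \<tau> 0 w n"
      then have off: "\<And>i. i \<notin> \<tau> \<Longrightarrow> \<alpha> i = 0" by (simp add: half_open_points_def)
      have pos: "0 \<le> \<alpha> 0" "\<And>i. i \<in> \<tau> - {0} \<Longrightarrow> 0 < \<alpha> i" using h by (simp_all add: half_open_points_def)
      have "0 \<le> \<alpha> i" for i
      proof -
        consider "i = 0" | "i \<in> \<tau> - {0}" | "i \<notin> \<tau>" by blast
        then show ?thesis using pos(1) pos(2)[of i] off[of i] by cases simp_all
      qed
      then have W: "\<alpha> \<in> O.weights" using off sub(1) unfolding O.weights_def by blast
      have s: "insert 0 (O.supp \<alpha>) = \<tau>"
      proof (intro equalityI subsetI)
        fix i assume "i \<in> insert 0 (O.supp \<alpha>)"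
        then show "i \<in> \<tau>" using off[of i] sub(2) by (auto simp: O.supp_def)
      next
        fix i assume "i \<in> \<tau>"
        then show "i \<in> insert 0 (O.supp \<alpha>)" using pos(2)[of i] by (cases "i = 0") (simp_all add: O.supp_def)
      qed
      then have "O.unimprovable (O.supp \<alpha>)" using O.unimprovable_mono[OF sub(3)] by blast
      moreover have "(\<Sum>i<N. \<alpha> i) = of_nat n"
        using h restrict[OF sub(1), of \<alpha>] off by (simp add: half_open_points_def)
      moreover have "integral (\<Sum>i<N. \<alpha> i *s w i)"
        using h restrict[OF sub(1), of "\<lambda>i. \<alpha> i *s w i"] off by (simp add: half_open_points_def)
      ultimately show "\<alpha> \<in> R n \<and> insert 0 (O.supp \<alpha>) = \<tau>" using W s by (simp add: R_def)
    next
      assume h: "\<alpha> \<in> R n \<and> insert 0 (O.supp \<alpha>) = \<tau>"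
      then have off: "\<And>i. i \<notin> \<tau> \<Longrightarrow> \<alpha> i = 0" by (auto simp: O.supp_def)
      have nn: "\<And>i. 0 \<le> \<alpha> i" using h by (simp add: R_def O.weights_def)
      have "0 < \<alpha> i" if "i \<in> \<tau> - {0}" for i
      proof -
        have "i \<in> O.supp \<alpha>" using that h by blast
        then show ?thesis using nn[of i] by (simp add: O.supp_def less_le)
      qed
      moreover have "sum \<alpha> \<tau> = of_nat n"
        using h restrict[OF sub(1), of \<alpha>] off by (simp add: R_def)
      moreover have "integral (\<Sum>i\<in>\<tau>. \<alpha> i *s w i)"
        using h restrict[OF sub(1), of "\<lambda>i. \<alpha> i *s w i"] off by (simp add: R_def)
      ultimately show "\<alpha> \<in> half_open_points \<tau> 0 w n"
        using nn off by (simp add: half_open_points_def)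
    qed
  qed
  have cell_of: "insert 0 (O.supp \<alpha>) \<in> T" if "\<alpha> \<in> R n" for \<alpha> n
    using that N O.supp_subset[of \<alpha>] cone by (auto simp: T_def R_def)
  have R_eq: "R n = (\<Union>\<tau>\<in>T. half_open_points \<tau> 0 w n)" for n
  proof (intro equalityI subsetI)
    fix \<alpha> assume "\<alpha> \<in> R n"
    then show "\<alpha> \<in> (\<Union>\<tau>\<in>T. half_open_points \<tau> 0 w n)"
      using points[OF cell_of, of \<alpha> n] cell_of[of \<alpha> n] by blast
  next
    fix \<alpha> assume "\<alpha> \<in> (\<Union>\<tau>\<in>T. half_open_points \<tau> 0 w n)"
    then show "\<alpha> \<in> R n" using points by blast
  qed
  have free: "affinely_free \<tau> w" if \<tau>: "\<tau> \<in> T" for \<tau>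
    unfolding affinely_free_def
  proof (intro allI impI)
    fix \<mu> i assume \<mu>: "(\<forall>i. i \<notin> \<tau> \<longrightarrow> \<mu> i = 0) \<and> sum \<mu> \<tau> = 0 \<and> (\<Sum>i\<in>\<tau>. \<mu> i *s w i) = 0"
    have sub: "\<tau> \<subseteq> {..<N}" "O.unimprovable \<tau>" using \<tau> by (auto simp: T_def)
    have "(\<Sum>i<N. \<mu> i) = 0" using restrict[OF sub(1), of \<mu>] \<mu> by simp
    moreover have "(\<Sum>i<N. \<mu> i *s w i) = 0" using restrict[OF sub(1), of "\<lambda>i. \<mu> i *s w i"] \<mu> by simp
    moreover have "\<forall>i\<ge>N. \<mu> i = 0" using \<mu> sub(1) by force
    ultimately have "\<mu> \<in> dependencies N w" by (simp add: dependencies_def)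
    then have "\<mu> = (\<lambda>_. 0)" using O.unimprovable_independent[OF sub(2)] \<mu> by blast
    then show "\<mu> i = 0" by simp
  qed
  have "\<forall>\<tau>\<in>T. \<exists>p :: rat poly. degree p \<le> CARD('n) \<and> (\<forall>n. finite (half_open_points \<tau> 0 w n) \<and>
    poly p (of_nat n) = of_nat (card (half_open_points \<tau> 0 w n)))"
  proof
    fix \<tau> assume \<tau>: "\<tau> \<in> T"
    have fin: "finite \<tau>" using \<tau> finite_subset by (auto simp: T_def)
    have "\<exists>p :: rat poly. degree p \<le> card \<tau> - 1 \<and> (\<forall>n. finite (half_open_points \<tau> 0 w n) \<and>
        poly p (of_nat n) = of_nat (card (half_open_points \<tau> 0 w n)))"
      by (rule card_half_open_points[OF fin _ _ free[OF \<tau>]]) (use \<tau> wint in \<open>auto simp: T_def\<close>)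
    then show "\<exists>p :: rat poly. degree p \<le> CARD('n) \<and> (\<forall>n. finite (half_open_points \<tau> 0 w n) \<and>
        poly p (of_nat n) = of_nat (card (half_open_points \<tau> 0 w n)))"
      using card_affinely_free[OF fin free[OF \<tau>]] le_trans by blast
  qed
  from bchoice[OF this] obtain p where p: "\<forall>\<tau>\<in>T. degree (p \<tau>) \<le> CARD('n) \<and>
    (\<forall>n. finite (half_open_points \<tau> 0 w n) \<and>
      poly (p \<tau>) (of_nat n :: rat) = of_nat (card (half_open_points \<tau> 0 w n)))" ..
  have card: "card (R n) = (\<Sum>\<tau>\<in>T. card (half_open_points \<tau> 0 w n))" for n
    unfolding R_eq
  proof (rule card_UN_disjoint[OF \<open>finite T\<close>])
    show "\<forall>\<tau>\<in>T. finite (half_open_points \<tau> 0 w n)" using p by blast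
    show "\<forall>\<tau>\<in>T. \<forall>\<tau>'\<in>T. \<tau> \<noteq> \<tau>' \<longrightarrow> half_open_points \<tau> 0 w n \<inter> half_open_points \<tau>' 0 w n = {}"
    proof (intro ballI impI, unfold disjoint_iff, intro allI impI notI)
      fix \<tau> \<tau>' \<alpha> assume "\<tau> \<in> T" "\<tau>' \<in> T" "\<tau> \<noteq> \<tau>'"
        "\<alpha> \<in> half_open_points \<tau> 0 w n" "\<alpha> \<in> half_open_points \<tau>' 0 w n"
      then show False using points[of \<tau> \<alpha> n] points[of \<tau>' \<alpha> n] by simp
    qed
  qed
  show ?thesis
  proof (intro exI[of _ "\<Sum>\<tau>\<in>T. p \<tau>"] conjI allI)
    show "degree (\<Sum>\<tau>\<in>T. p \<tau>) \<le> CARD('n)"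
      by (rule degree_sum_le[OF \<open>finite T\<close>]) (use p in blast)
    show "poly (\<Sum>\<tau>\<in>T. p \<tau>) (of_nat n) = of_nat (ehrhart_function (conv F) n)" for n
      unfolding cardL bij_betw_same_card[OF bij[of n], symmetric] card poly_sum of_nat_sum
      using p by (intro sum.cong refl) blast
  qed
qed

lemma eventual_poly_eqI:
  assumes "\<And>n. poly p (of_nat n) = of_nat (g n)"
  shows "eventual_poly g = p"
  unfolding eventual_poly_def
proof (rule the_equality)
  show "\<forall>\<^sub>F n in sequentially. poly p (of_nat n) = of_nat (g n)" using assms by simp
  fix q :: "rat poly" assume "\<forall>\<^sub>F n in sequentially. poly q (of_nat n) = of_nat (g n)"
  then obtain M where M: "\<And>n. n \<ge> M \<Longrightarrow> poly q (of_nat n) = of_nat (g n)"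
    by (auto simp: eventually_sequentially)
  have "q - p = 0"
  proof (rule ccontr)
    assume "q - p \<noteq> 0"
    then have "finite {x. poly (q - p) x = 0}" by (rule poly_roots_finite)
    moreover have "(of_nat :: nat \<Rightarrow> rat) ` {M..} \<subseteq> {x. poly (q - p) x = 0}"
    proof (rule image_subsetI)
      fix n assume "n \<in> {M..}"
      then show "of_nat n \<in> {x. poly (q - p) x = 0}" using M[of n] assms[of n] by simp
    qed
    moreover have "infinite ((of_nat :: nat \<Rightarrow> rat) ` {M..})"
      by (subst finite_image_iff) (simp_all add: inj_on_def infinite_Ici)
    ultimately show False using infinite_super by blast
  qed
  then show "q = p" by simp
qed

section \<open>Dilates of the Newton polyhedron\<close>

text \<open>
  The exponents in \<open>t\<close> times the Newton polyhedron, which is the convex hull of \<open>V\<close> plus the positive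
  orthant.
\<close>

definition newton :: "(nat ^ 'n::finite) set \<Rightarrow> rat \<Rightarrow> (nat ^ 'n) set" where
  "newton V t = {a. \<exists>c. (\<forall>v\<in>V. 0 \<le> c v) \<and> sum c V = t \<and>
    (\<forall>j. (\<Sum>v\<in>V. c v * of_nat (v $ j)) \<le> of_nat (a $ j))}"

lemma newtonI:
  fixes a :: "nat ^ 'n::finite"
  assumes "\<And>v. v \<in> V \<Longrightarrow> 0 \<le> c v" "sum c V = t"
    "\<And>j. (\<Sum>v\<in>V. c v * of_nat (v $ j)) \<le> of_nat (a $ j)"
  shows "a \<in> newton V t"
  using assms unfolding newton_def by blast

lemma newtonE:
  fixes a :: "nat ^ 'n::finite"
  assumes "a \<in> newton V t"
  obtains c where "\<And>v. v \<in> V \<Longrightarrow> 0 \<le> c v" "sum c V = t"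
    "\<And>j. (\<Sum>v\<in>V. c v * of_nat (v $ j)) \<le> of_nat (a $ j)"
  using assms unfolding newton_def by blast

lemma newton_add:
  assumes "a \<in> newton V s" "b \<in> newton V t" shows "a + b \<in> newton V (s + t)"
proof -
  obtain c where c: "\<And>v. v \<in> V \<Longrightarrow> 0 \<le> c v" "sum c V = s"
    "\<And>j. (\<Sum>v\<in>V. c v * of_nat (v $ j)) \<le> of_nat (a $ j)" using assms(1) by (rule newtonE) blast
  obtain c' where c': "\<And>v. v \<in> V \<Longrightarrow> 0 \<le> c' v" "sum c' V = t"
    "\<And>j. (\<Sum>v\<in>V. c' v * of_nat (v $ j)) \<le> of_nat (b $ j)" using assms(2) by (rule newtonE) blast
  show ?thesis
  proof (rule newtonI)
    show "0 \<le> c v + c' v" if "v \<in> V" for v using c(1) c'(1) that by simp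
    show "(\<Sum>v\<in>V. c v + c' v) = s + t" using c(2) c'(2) by (simp add: sum.distrib)
    show "(\<Sum>v\<in>V. (c v + c' v) * of_nat (v $ j)) \<le> of_nat ((a + b) $ j)" for j
      using add_mono[OF c(3) c'(3)] by (simp add: distrib_right sum.distrib)
  qed
qed

lemma newton_anti_mono:
  assumes "a \<in> newton V t" "0 \<le> s" "s \<le> t" shows "a \<in> newton V s"
proof (cases "t = 0")
  case False
  then have t: "0 < t" using assms by simp
  obtain c where c: "\<And>v. v \<in> V \<Longrightarrow> 0 \<le> c v" "sum c V = t"
    "\<And>j. (\<Sum>v\<in>V. c v * of_nat (v $ j)) \<le> of_nat (a $ j)" using assms(1) by (rule newtonE) blast
  show ?thesis
  proof (rule newtonI)
    show "0 \<le> s / t * c v" if "v \<in> V" for v using c(1)[OF that] assms(2) t by simp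
    have "(\<Sum>v\<in>V. s / t * c v) = s / t * sum c V" by (simp only: sum_distrib_left)
    then show "(\<Sum>v\<in>V. s / t * c v) = s" using c(2) t by simp
    fix j
    have "(\<Sum>v\<in>V. s / t * c v * of_nat (v $ j)) = s / t * (\<Sum>v\<in>V. c v * of_nat (v $ j))"
      by (simp only: sum_distrib_left mult.assoc)
    also have "\<dots> \<le> 1 * (\<Sum>v\<in>V. c v * of_nat (v $ j))"
      using assms t c(1) by (intro mult_right_mono sum_nonneg) simp_all
    also have "\<dots> \<le> of_nat (a $ j)" using c(3)[of j] by simp
    finally show "(\<Sum>v\<in>V. s / t * c v * of_nat (v $ j)) \<le> of_nat (a $ j)" .
  qed
qed (use assms in simp)

lemma newton_zero: "a \<in> newton V 0"
  by (rule newtonI[where c = "\<lambda>_. 0"]) simp_all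

lemma newton_upward:
  fixes a b :: "nat ^ 'n::finite"
  assumes "a \<in> newton V t" "\<And>j. a $ j \<le> b $ j" shows "b \<in> newton V t"
proof -
  obtain c where c: "\<And>v. v \<in> V \<Longrightarrow> 0 \<le> c v" "sum c V = t"
    "\<And>j. (\<Sum>v\<in>V. c v * of_nat (v $ j)) \<le> of_nat (a $ j)" using assms(1) by (rule newtonE) blast
  have "of_nat (a $ j) \<le> (of_nat (b $ j) :: rat)" for j using assms(2) by simp
  then show ?thesis using c order_trans by (intro newtonI[of V c]) blast+
qed

lemma newton_add_right: "a \<in> newton V t \<Longrightarrow> a + b \<in> newton V t"
  by (erule newton_upward) simp

lemma newton_generator:
  assumes "finite V" "v \<in> V" shows "v \<in> newton V 1"
proof (rule newtonI)
  show "(\<Sum>u\<in>V. if u = v then 1 else 0) = (1 :: rat)" using assms by simp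
  have "(\<Sum>u\<in>V. (if u = v then 1 else 0) * of_nat (u $ j)) = (of_nat (v $ j) :: rat)" for j
    using assms by (simp add: if_distrib[of "\<lambda>x. x * _"] cong: if_cong)
  then show "(\<Sum>u\<in>V. (if u = v then 1 else 0) * of_nat (u $ j)) \<le> (of_nat (v $ j) :: rat)" for j
    by simp
qed simp

text \<open>
  Splitting the weights into integer and fractional parts turns a point of the polyhedron into a
  product of generators times a remainder, at the cost of at most one unit of weight for each
  generator.
\<close>

lemma newton_integer_part:
  assumes "finite V" "a \<in> newton V t"
  obtains k :: "nat ^ 'n::finite \<Rightarrow> nat" and b
  where "a = (\<Sum>v\<in>V. k v *s v) + b" "of_nat (sum k V) \<le> t" "t \<le> of_nat (sum k V) + of_nat (card V)"
    "b \<in> newton V (t - of_nat (sum k V))"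
proof -
  obtain c where c: "\<And>v. v \<in> V \<Longrightarrow> 0 \<le> c v" "sum c V = t"
    "\<And>j. (\<Sum>v\<in>V. c v * of_nat (v $ j)) \<le> of_nat (a $ j)" using assms(2) by (rule newtonE) blast
  define k where "k = (\<lambda>v. nat \<lfloor>c v\<rfloor>)"
  have k: "of_nat (k v) \<le> c v" "c v \<le> of_nat (k v) + 1" if "v \<in> V" for v
  proof -
    have "of_nat (k v) = (of_int \<lfloor>c v\<rfloor> :: rat)" using c(1)[OF that] by (simp add: k_def)
    then show "of_nat (k v) \<le> c v" "c v \<le> of_nat (k v) + 1" by linarith+
  qed
  have le: "(\<Sum>v\<in>V. k v * v $ j) \<le> a $ j" for j
  proof -
    have "of_nat (\<Sum>v\<in>V. k v * v $ j) = (\<Sum>v\<in>V. of_nat (k v) * of_nat (v $ j) :: rat)" by simp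
    also have "\<dots> \<le> (\<Sum>v\<in>V. c v * of_nat (v $ j))"
      by (intro sum_mono mult_right_mono k(1)) simp_all
    also have "\<dots> \<le> of_nat (a $ j)" by (rule c(3))
    finally show ?thesis by (simp only: of_nat_le_iff)
  qed
  define b where "b = (\<chi> j. a $ j - (\<Sum>v\<in>V. k v * v $ j))"
  have eq: "a = (\<Sum>v\<in>V. k v *s v) + b" using le by (simp add: vec_eq_iff b_def)
  have bj: "of_nat (b $ j) = of_nat (a $ j) - (\<Sum>v\<in>V. of_nat (k v) * of_nat (v $ j) :: rat)" for j
    using le[of j] by (simp add: b_def of_nat_diff)
  have "of_nat (sum k V) \<le> t"
    unfolding c(2)[symmetric] of_nat_sum by (intro sum_mono k(1))
  moreover have "t \<le> of_nat (sum k V) + of_nat (card V)"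
  proof -
    have "t \<le> (\<Sum>v\<in>V. of_nat (k v) + 1)" unfolding c(2)[symmetric] by (intro sum_mono k(2))
    then show ?thesis by (simp add: sum.distrib)
  qed
  moreover have "b \<in> newton V (t - of_nat (sum k V))"
  proof (rule newtonI)
    show "0 \<le> c v - of_nat (k v)" if "v \<in> V" for v using k(1)[OF that] by simp
    show "(\<Sum>v\<in>V. c v - of_nat (k v)) = t - of_nat (sum k V)" using c(2) by (simp add: sum_subtractf)
    show "(\<Sum>v\<in>V. (c v - of_nat (k v)) * of_nat (v $ j)) \<le> of_nat (b $ j)" for j
      unfolding bj using c(3)[of j] by (simp add: left_diff_distrib sum_subtractf)
  qed
  ultimately show thesis using eq by (intro that)
qed

text \<open>
  Dickson's lemma, in the form that every sequence of exponents has a monotone subsequence.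
\<close>

lemma dickson:
  fixes f :: "nat \<Rightarrow> 's \<Rightarrow> nat"
  assumes "finite S"
  shows "\<exists>r :: nat \<Rightarrow> nat. strict_mono r \<and> (\<forall>s\<in>S. mono (\<lambda>i. f (r i) s))"
  using assms
proof (induction rule: finite_induct)
  case empty
  show ?case by (intro exI[of _ id]) (simp add: strict_mono_def)
next
  case (insert s S)
  then obtain r :: "nat \<Rightarrow> nat" where r: "strict_mono r" "\<forall>u\<in>S. mono (\<lambda>i. f (r i) u)" by blast
  define g where "g = (\<lambda>i. f (r i) s)"
  have "\<exists>h :: nat \<Rightarrow> nat. strict_mono h \<and> mono (\<lambda>i. g (h i))"
  proof -
    obtain h :: "nat \<Rightarrow> nat" where h: "strict_mono h" "monoseq (\<lambda>i. g (h i))"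
      using seq_monosub[of g] by blast
    show ?thesis
    proof (cases "mono (\<lambda>i. g (h i))")
      case False
      then have dec: "decseq (\<lambda>i. g (h i))" using h(2) by (simp add: monoseq_iff)
      define m where "m = (LEAST x. \<exists>i. g (h i) = x)"
      have "\<exists>i. g (h i) = m" unfolding m_def by (rule LeastI_ex) blast
      then obtain N where N: "g (h N) = m" by blast
      have "m \<le> g (h i)" for i unfolding m_def by (rule Least_le) blast
      moreover have "g (h (N + i)) \<le> m" for i using decseqD[OF dec, of N "N + i"] N by simp
      ultimately have "g (h (N + i)) = m" for i by (simp add: antisym)
      then have "mono (\<lambda>i. g (h (N + i)))" by (simp add: mono_def)
      moreover have "strict_mono (\<lambda>i. h (N + i))" using h(1) by (simp add: strict_mono_def)
      ultimately show ?thesis by blast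
    qed (use h in blast)
  qed
  then obtain h :: "nat \<Rightarrow> nat" where h: "strict_mono h" "mono (\<lambda>i. g (h i))" by blast
  have hm: "mono h" using h(1) by (rule strict_mono_mono)
  show ?case
  proof (intro exI[of _ "\<lambda>i. r (h i)"] conjI ballI)
    show "strict_mono (\<lambda>i. r (h i))" using r(1) h(1) by (simp add: strict_mono_def)
    show "mono (\<lambda>i. f (r (h i)) u)" if "u \<in> insert s S" for u
    proof (cases "u = s")
      case True
      then show ?thesis using h(2) by (simp add: g_def)
    next
      case False
      then have "mono (\<lambda>i. f (r i) u)" using r(2) that by blast
      then show ?thesis using hm by (simp add: mono_def)
    qed
  qed
qed

text \<open>
  The integer parts of the weights, the remainders and the bounded deficits of \<open>M *s a\<close>, for varying \<open>M\<close>, form a sequence of vectors of natural numbers. Two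
  of them with \<open>M < M'\<close> are comparable with equal deficit, and their difference represents
  \<open>(M' - M) *s a\<close> with the full weight \<open>n * (M' - M)\<close>.
\<close>

lemma newton_closed:
  fixes a :: "nat ^ 'n::finite"
  assumes "finite V" and a: "\<And>M. M *s a \<in> newton V (of_nat (n * (M - m)))"
  shows "a \<in> newton V (of_nat n)"
proof -
  have "\<forall>M. \<exists>k b. M *s a = (\<Sum>v\<in>V. k v *s v) + b \<and> sum k V \<le> n * M \<and> n * M \<le> sum k V + (card V + n * m)"
  proof
    fix M
    obtain k b where kb: "M *s a = (\<Sum>v\<in>V. k v *s v) + b"
      "of_nat (sum k V) \<le> (of_nat (n * (M - m)) :: rat)"
      "of_nat (n * (M - m)) \<le> of_nat (sum k V) + (of_nat (card V) :: rat)"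
      "b \<in> newton V (of_nat (n * (M - m)) - of_nat (sum k V))"
      by (rule newton_integer_part[OF assms(1) a[of M]])
    have "sum k V \<le> n * (M - m)" using kb(2) by (simp only: of_nat_le_iff)
    moreover have "n * (M - m) \<le> sum k V + card V"
      using kb(3) by (simp only: of_nat_add[symmetric] of_nat_le_iff)
    moreover have "n * M \<le> n * (M - m) + n * m" "n * (M - m) \<le> n * M"
      using mult_le_mono2[of M "M - m + m" n] by (simp_all add: distrib_left)
    ultimately have "sum k V \<le> n * M" "n * M \<le> sum k V + (card V + n * m)" by linarith+
    then show "\<exists>k b. M *s a = (\<Sum>v\<in>V. k v *s v) + b \<and> sum k V \<le> n * M \<and> n * M \<le> sum k V + (card V + n * m)"
      using kb(1) by blast
  qed
  from choice[OF this] obtain k where "\<forall>M. \<exists>b. M *s a = (\<Sum>v\<in>V. k M v *s v) + b \<and>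
    sum (k M) V \<le> n * M \<and> n * M \<le> sum (k M) V + (card V + n * m)" ..
  from choice[OF this] obtain b where kb: "\<forall>M. M *s a = (\<Sum>v\<in>V. k M v *s v) + b M \<and>
    sum (k M) V \<le> n * M \<and> n * M \<le> sum (k M) V + (card V + n * m)" ..
  have eq: "M *s a = (\<Sum>v\<in>V. k M v *s v) + b M" and
    le: "sum (k M) V \<le> n * M" "n * M \<le> sum (k M) V + (card V + n * m)" for M
    using kb by blast+
  define D where "D = card V + n * m"
  \<comment> \<open>the deficit \<open>n * M - sum (k M) V\<close> is bounded by \<open>D\<close>; including it and its complement
    among the coordinates forces it to agree for the two indices that Dickson's lemma provides\<close>
  define e where "e = (\<lambda>M. n * M - sum (k M) V)"
  have e: "e M \<le> D" "sum (k M) V + e M = n * M" for M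
    using le[of M] by (simp_all add: e_def D_def)
  define f where "f = (\<lambda>M x. case x of Inl v \<Rightarrow> k M v
    | Inr (Inl j) \<Rightarrow> b M $ j | Inr (Inr True) \<Rightarrow> e M | Inr (Inr False) \<Rightarrow> D - e M)"
  have "finite (Inl ` V \<union> Inr ` (UNIV :: ('n + bool) set))" using assms(1) by simp
  from dickson[OF this, of f] obtain r :: "nat \<Rightarrow> nat" where r: "strict_mono r"
    "\<forall>s\<in>Inl ` V \<union> Inr ` (UNIV :: ('n + bool) set). mono (\<lambda>i. f (r i) s)" by blast
  define M where "M = r 0"
  define M' where "M' = r 1"
  have lt: "M < M'" using r(1) by (simp add: M_def M'_def strict_mono_def)
  have mono: "f M s \<le> f M' s" if "s \<in> Inl ` V \<union> Inr ` (UNIV :: ('n + bool) set)" for s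
    using bspec[OF r(2) that] by (simp add: M_def M'_def mono_def)
  have kk: "k M v \<le> k M' v" if "v \<in> V" for v using mono[of "Inl v"] that by (simp add: f_def)
  have bb: "b M $ j \<le> b M' $ j" for j using mono[of "Inr (Inl j)"] by (simp add: f_def)
  have "e M \<le> e M'" "D - e M \<le> D - e M'"
    using mono[of "Inr (Inr True)"] mono[of "Inr (Inr False)"] by (simp_all add: f_def)
  then have ee: "e M = e M'" using e(1)[of M] e(1)[of M'] by linarith
  define q where "q = M' - M"
  have q: "0 < q" "M' = M + q" using lt by (simp_all add: q_def)
  define c where "c = (\<lambda>v. of_nat (k M' v - k M v) / of_nat q :: rat)"
  show ?thesis
  proof (rule newtonI)
    show "0 \<le> c v" for v by (simp add: c_def)
    have "sum (k M') V = sum (k M) V + n * q"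
      using e(2)[of M] e(2)[of M'] ee q(2) by (simp add: distrib_left)
    then have "(\<Sum>v\<in>V. k M' v - k M v) = n * q"
      using sum_subtractf_nat[of V "k M" "k M'"] kk by simp
    moreover have "sum c V = of_nat (\<Sum>v\<in>V. k M' v - k M v) / of_nat q"
      by (simp add: c_def sum_divide_distrib)
    ultimately show "sum c V = of_nat n" using q(1) by simp
    fix j
    have E: "N * a $ j = (\<Sum>v\<in>V. k N v * v $ j) + b N $ j" for N
      using arg_cong[OF eq[of N], of "\<lambda>x. x $ j"] by simp
    have "(\<Sum>v\<in>V. k M' v * v $ j) = (\<Sum>v\<in>V. k M v * v $ j) + (\<Sum>v\<in>V. (k M' v - k M v) * v $ j)"
      unfolding sum.distrib[symmetric] using kk by (intro sum.cong refl) (simp flip: distrib_right)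
    then have "(\<Sum>v\<in>V. (k M' v - k M v) * v $ j) \<le> q * a $ j"
      using E[of M] E[of M'] bb[of j] q(2) by (simp add: distrib_right)
    then have "of_nat (\<Sum>v\<in>V. (k M' v - k M v) * v $ j) \<le> (of_nat (q * a $ j) :: rat)"
      by (simp only: of_nat_le_iff)
    moreover have "(\<Sum>v\<in>V. c v * of_nat (v $ j)) = of_nat (\<Sum>v\<in>V. (k M' v - k M v) * v $ j) / of_nat q"
      by (simp add: c_def sum_divide_distrib)
    ultimately show "(\<Sum>v\<in>V. c v * of_nat (v $ j)) \<le> of_nat (a $ j)"
      using q(1) by (simp add: pos_divide_le_eq mult.commute)
  qed
qed

section \<open>The points below the Newton polyhedron\<close>

lemma rat_vec_nth [simp]: "rat_vec v $ j = of_nat (v $ j)"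
  by (simp add: rat_vec_def)

lemma inj_rat_vec: "inj rat_vec"
  by (auto simp: inj_def vec_eq_iff)

lemma finite_bounded_vectors: "finite {a :: nat ^ 'n::finite. \<forall>j. a $ j \<le> b j}"
proof (rule finite_subset)
  show "finite (vec_lambda ` (PiE UNIV (\<lambda>j. {..b j})) :: (nat ^ 'n) set)"
    by (simp add: finite_PiE)
  show "{a :: nat ^ 'n. \<forall>j. a $ j \<le> b j} \<subseteq> vec_lambda ` (PiE UNIV (\<lambda>j. {..b j}))"
    by (auto simp: image_iff intro!: bexI[of _ "vec_nth _"])
qed

lemma dilate_conv_rat_vec:
  fixes F :: "(nat ^ 'n::finite) set"
  assumes "finite F" "F \<noteq> {}"
  shows "rat_vec a \<in> (\<lambda>x. of_nat n *s x) ` conv (rat_vec ` F) \<longleftrightarrow>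
    (\<exists>c :: nat ^ 'n \<Rightarrow> rat. (\<forall>v\<in>F. 0 \<le> c v) \<and> sum c F = of_nat n \<and>
      (\<forall>j. of_nat (a $ j) = (\<Sum>v\<in>F. c v * of_nat (v $ j))))"
proof -
  have inj: "inj_on rat_vec F" using inj_rat_vec by (rule inj_on_subset) simp
  have fin: "finite (rat_vec ` F)" "rat_vec ` F \<noteq> {}" using assms by simp_all
  have sums: "sum c (rat_vec ` F) = (\<Sum>v\<in>F. c (rat_vec v))"
    "(\<Sum>x\<in>rat_vec ` F. c x *s x) = (\<Sum>v\<in>F. c (rat_vec v) *s rat_vec v)" for c
    unfolding sum.reindex[OF inj] o_def by (rule refl)+
  have comp: "rat_vec a = (\<Sum>v\<in>F. c v *s rat_vec v) \<longleftrightarrow>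
      (\<forall>j. of_nat (a $ j) = (\<Sum>v\<in>F. c v * of_nat (v $ j)))" for c :: "nat ^ 'n \<Rightarrow> rat"
    by (simp add: vec_eq_iff)
  show ?thesis
    unfolding dilate_conv[OF fin] sums
  proof
    assume "\<exists>c. (\<forall>v\<in>rat_vec ` F. 0 \<le> c v) \<and> (\<Sum>v\<in>F. c (rat_vec v)) = of_nat n \<and>
      rat_vec a = (\<Sum>v\<in>F. c (rat_vec v) *s rat_vec v)"
    then obtain c where c: "\<forall>v\<in>rat_vec ` F. 0 \<le> c v" "(\<Sum>v\<in>F. c (rat_vec v)) = of_nat n"
      "rat_vec a = (\<Sum>v\<in>F. c (rat_vec v) *s rat_vec v)" by blast
    show "\<exists>c :: nat ^ 'n \<Rightarrow> rat. (\<forall>v\<in>F. 0 \<le> c v) \<and> sum c F = of_nat n \<and>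
      (\<forall>j. of_nat (a $ j) = (\<Sum>v\<in>F. c v * of_nat (v $ j)))"
      by (intro exI[of _ "\<lambda>v. c (rat_vec v)"] conjI c(2) c(3)[unfolded comp]) (use c(1) in blast)
  next
    assume "\<exists>c :: nat ^ 'n \<Rightarrow> rat. (\<forall>v\<in>F. 0 \<le> c v) \<and> sum c F = of_nat n \<and>
      (\<forall>j. of_nat (a $ j) = (\<Sum>v\<in>F. c v * of_nat (v $ j)))"
    then obtain c :: "nat ^ 'n \<Rightarrow> rat" where c: "\<forall>v\<in>F. 0 \<le> c v" "sum c F = of_nat n"
      "rat_vec a = (\<Sum>v\<in>F. c v *s rat_vec v)" unfolding comp[symmetric] by blast
    define d where "d = (\<lambda>x. c (the_inv_into F rat_vec x))"
    have d: "d (rat_vec v) = c v" if "v \<in> F" for v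
      using the_inv_into_f_f[OF inj that] by (simp add: d_def)
    have "(\<Sum>v\<in>F. d (rat_vec v)) = of_nat n" using c(2) d by simp
    moreover have "rat_vec a = (\<Sum>v\<in>F. d (rat_vec v) *s rat_vec v)" using c(3) d by simp
    moreover have "\<forall>v\<in>rat_vec ` F. 0 \<le> d v" using c(1) d by simp
    ultimately show "\<exists>c. (\<forall>v\<in>rat_vec ` F. 0 \<le> c v) \<and> (\<Sum>v\<in>F. c (rat_vec v)) = of_nat n \<and>
      rat_vec a = (\<Sum>v\<in>F. c (rat_vec v) *s rat_vec v)" by blast
  qed
qed

lemma ehrhart_function_rat_vec:
  fixes F :: "(nat ^ 'n::finite) set"
  assumes "finite F" "F \<noteq> {}"
  shows "ehrhart_function (conv (rat_vec ` F)) n =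
    card {a. rat_vec a \<in> (\<lambda>x. of_nat n *s x) ` conv (rat_vec ` F)}"
proof -
  define D where "D = (\<lambda>x. of_nat n *s x) ` conv (rat_vec ` F)"
  have fin: "finite (rat_vec ` F)" "rat_vec ` F \<noteq> {}" using assms by simp_all
  have nonneg: "0 \<le> x $ j" if xD: "x \<in> D" for x j
  proof -
    obtain c where c: "\<forall>v\<in>rat_vec ` F. 0 \<le> c v" "sum c (rat_vec ` F) = of_nat n"
      "x = (\<Sum>v\<in>rat_vec ` F. c v *s v)"
      using iffD1[OF dilate_conv[OF fin] xD[unfolded D_def]] by (elim exE conjE)
    have "x $ j = (\<Sum>v\<in>rat_vec ` F. c v * v $ j)" unfolding c(3) by simp
    also have "0 \<le> \<dots>"
    proof (rule sum_nonneg)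
      fix v assume v: "v \<in> rat_vec ` F"
      then obtain u where "v = rat_vec u" by blast
      then have "0 \<le> v $ j" by simp
      moreover have "0 \<le> c v" using c(1) v by blast
      ultimately show "0 \<le> c v * v $ j" by simp
    qed
    finally show ?thesis .
  qed
  have "bij_betw (\<lambda>a :: nat ^ 'n. \<chi> j. int (a $ j)) {a. rat_vec a \<in> D} {z. of_int_vec z \<in> D}"
  proof (rule bij_betw_byWitness[where f' = "\<lambda>z. \<chi> j. nat (z $ j)"])
    have eq: "of_int_vec (\<chi> j. int (a $ j)) = rat_vec a" for a :: "nat ^ 'n"
      by (simp add: of_int_vec_def vec_eq_iff)
    have nn: "0 \<le> z $ j" if "of_int_vec z \<in> D" for z j
      using nonneg[OF that, of j] by (simp add: of_int_vec_def)
    have eq': "rat_vec (\<chi> j. nat (z $ j)) = of_int_vec z" if "of_int_vec z \<in> D" for z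
      using nn[OF that] by (simp add: of_int_vec_def vec_eq_iff)
    show "\<forall>a\<in>{a. rat_vec a \<in> D}. (\<chi> j. nat ((\<chi> j. int (a $ j)) $ j)) = a"
      by (simp add: vec_eq_iff)
    show "\<forall>z\<in>{z. of_int_vec z \<in> D}. (\<chi> j. int ((\<chi> j. nat (z $ j)) $ j)) = z"
    proof
      fix z :: "int ^ 'n" assume "z \<in> {z. of_int_vec z \<in> D}"
      then have "0 \<le> z $ j" for j using nn[of z j] by simp
      then show "(\<chi> j. int ((\<chi> j. nat (z $ j)) $ j)) = z" by (simp add: vec_eq_iff)
    qed
    show "(\<lambda>a. \<chi> j. int (a $ j)) ` {a. rat_vec a \<in> D} \<subseteq> {z. of_int_vec z \<in> D}"
      by (rule image_subsetI) (simp add: eq)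
    show "(\<lambda>z. \<chi> j. nat (z $ j)) ` {z. of_int_vec z \<in> D} \<subseteq> {a. rat_vec a \<in> D}"
      by (rule image_subsetI) (simp add: eq')
  qed
  from bij_betw_same_card[OF this, symmetric] show ?thesis
    unfolding ehrhart_function_def of_int_vec_def D_def .
qed

text \<open>The linear form \<open>\<langle>a, \<alpha>\<^sub>0\<rangle>\<close>.\<close>

definition height :: "('n::finite \<Rightarrow> nat) \<Rightarrow> nat ^ 'n \<Rightarrow> rat" where
  "height p a = (\<Sum>j\<in>UNIV. of_nat (a $ j) / of_nat (p j))"

text \<open>
  The vectors \<open>axis j (p j)\<close> are the vertices, apart from \<open>0\<close>, of the simplex \<open>S\<close>. Together with
  the generators of height less than \<open>1\<close>, called low below, they span the polytope \<open>P\<close>.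
\<close>

locale pure_generators =
  fixes V :: "(nat ^ 'n::finite) set" and p :: "'n \<Rightarrow> nat"
  assumes finite_generators: "finite V"
    and pure: "\<And>j. axis j (p j) \<in> V"
    and pure_pos: "\<And>j. 0 < p j"
begin

lemma pure_nonzero [simp]: "p j \<noteq> 0"
  using pure_pos[of j] by simp

definition pures :: "(nat ^ 'n) set" where
  "pures = range (\<lambda>j. axis j (p j))"

definition low :: "(nat ^ 'n) set" where
  "low = {v \<in> V. height p v < 1}"

lemma inj_pure: "inj (\<lambda>j. axis j (p j))"
  by (auto simp: inj_def axis_eq_axis)

lemma height_pure: "height p (axis j (p j)) = 1"
proof -
  have "height p (axis j (p j)) = (\<Sum>i\<in>UNIV. if i = j then 1 else 0)"
    unfolding height_def using pure_pos[of j] by (intro sum.cong refl) (simp add: axis_def)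
  then show ?thesis by simp
qed

lemma sum_pures: "(\<Sum>v\<in>pures. f v) = (\<Sum>j\<in>UNIV. f (axis j (p j)))"
  unfolding pures_def sum.reindex[OF inj_pure] o_def ..

lemma sum_pures_component:
  "(\<Sum>j\<in>UNIV. g j * of_nat (axis j (p j) $ i)) = g i * (of_nat (p i) :: rat)"
  for g :: "'n \<Rightarrow> rat"
proof -
  have "(\<Sum>j\<in>UNIV. g j * of_nat (axis j (p j) $ i)) = (\<Sum>j\<in>UNIV. if j = i then g i * of_nat (p i) else 0)"
    by (intro sum.cong refl) (simp add: axis_def)
  then show ?thesis by simp
qed

lemma height_combination:
  "(\<Sum>j\<in>UNIV. (\<Sum>v\<in>F. c v * of_nat (v $ j)) / of_nat (p j)) = (\<Sum>v\<in>F. c v * height p v)"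
proof -
  have "(\<Sum>j\<in>UNIV. (\<Sum>v\<in>F. c v * of_nat (v $ j)) / of_nat (p j)) =
      (\<Sum>j\<in>UNIV. \<Sum>v\<in>F. c v * (of_nat (v $ j) / of_nat (p j)))"
    by (simp add: sum_divide_distrib)
  also have "\<dots> = (\<Sum>v\<in>F. \<Sum>j\<in>UNIV. c v * (of_nat (v $ j) / of_nat (p j)))" by (rule sum.swap)
  also have "\<dots> = (\<Sum>v\<in>F. c v * height p v)" by (simp only: height_def sum_distrib_left)
  finally show ?thesis .
qed

lemma low_pures_disjoint: "low \<inter> pures = {}"
  using height_pure by (auto simp: low_def pures_def)

lemma finite_low: "finite low" and finite_pures: "finite pures"
  using finite_generators by (simp_all add: low_def pures_def)

lemma low_subset: "low \<subseteq> V" and pures_subset: "pures \<subseteq> V"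
  using pure by (auto simp: low_def pures_def)

text \<open>
  The weight \<open>g j\<close> on \<open>axis j (p j)\<close> and no weight elsewhere; the sum replaces the choice of the
  index that belongs to \<open>v\<close>.
\<close>

definition pure_weight :: "('n \<Rightarrow> rat) \<Rightarrow> nat ^ 'n \<Rightarrow> rat" where
  "pure_weight g v = (\<Sum>i\<in>UNIV. if axis i (p i) = v then g i else 0)"

lemma pure_weight_pure: "pure_weight g (axis j (p j)) = g j"
proof -
  have "pure_weight g (axis j (p j)) = (\<Sum>i\<in>UNIV. if i = j then g i else 0)"
    unfolding pure_weight_def
    by (intro sum.cong refl if_cong) (use inj_pure in \<open>auto simp: inj_def\<close>)
  then show ?thesis by simp
qed

lemma pure_weight_other: "v \<notin> pures \<Longrightarrow> pure_weight g v = 0"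
  unfolding pure_weight_def by (intro sum.neutral ballI) (auto simp: pures_def)

lemma pure_weight_nonneg: "(\<And>j. 0 \<le> g j) \<Longrightarrow> 0 \<le> pure_weight g v"
  unfolding pure_weight_def by (intro sum_nonneg) simp

lemma high_in_newton:
  assumes "of_nat n \<le> height p a" shows "a \<in> newton V (of_nat n)"
proof (rule newton_anti_mono[OF _ _ assms])
  define c where "c = pure_weight (\<lambda>j. of_nat (a $ j) / of_nat (p j))"
  have c: "c (axis j (p j)) = of_nat (a $ j) / of_nat (p j)" for j
    by (simp add: c_def pure_weight_pure)
  have sums: "(\<Sum>v\<in>V. c v * g v) = (\<Sum>j\<in>UNIV. c (axis j (p j)) * g (axis j (p j)))"
    for g :: "nat ^ 'n \<Rightarrow> rat"
  proof -
    have "(\<Sum>v\<in>V. c v * g v) = (\<Sum>v\<in>pures. c v * g v)"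
      using finite_generators pures_subset 
      by (intro sum.mono_neutral_right) (auto simp: c_def pure_weight_other)
    then show ?thesis by (simp add: sum_pures)
  qed
  show "a \<in> newton V (height p a)"
  proof (rule newtonI)
    show "0 \<le> c v" for v by (simp add: c_def pure_weight_nonneg)
    show "sum c V = height p a" using sums[of "\<lambda>_. 1"] by (simp add: c height_def)
    show "(\<Sum>v\<in>V. c v * of_nat (v $ j)) \<le> of_nat (a $ j)" for j
      unfolding sums c sum_pures_component using pure_pos[of j] by simp
  qed
qed simp

lemma dilate_simplex_iff:
  "rat_vec a \<in> (\<lambda>x. of_nat n *s x) ` conv (rat_vec ` insert 0 pures) \<longleftrightarrow> height p a \<le> of_nat n"
proof -
  have "(0 :: nat ^ 'n) \<notin> pures" by (auto simp: pures_def axis_eq_0_iff)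
  then have sums: "sum f (insert 0 pures) = f 0 + (\<Sum>j\<in>UNIV. f (axis j (p j)))"
    for f :: "nat ^ 'n \<Rightarrow> rat"
    using finite_pures by (simp add: sum_pures)
  have fin: "finite (insert 0 pures)" "insert 0 pures \<noteq> {}" using finite_pures by simp_all
  show ?thesis
    unfolding dilate_conv_rat_vec[OF fin] sums
  proof
    assume "\<exists>c :: nat ^ 'n \<Rightarrow> rat. (\<forall>v\<in>insert 0 pures. 0 \<le> c v) \<and> c 0 + (\<Sum>j\<in>UNIV. c (axis j (p j))) = of_nat n \<and>
      (\<forall>i. of_nat (a $ i) = c 0 * of_nat (0 $ i) + (\<Sum>j\<in>UNIV. c (axis j (p j)) * of_nat (axis j (p j) $ i)))"
    then obtain c :: "nat ^ 'n \<Rightarrow> rat" where c: "\<forall>v\<in>insert 0 pures. 0 \<le> c v" "c 0 + (\<Sum>j\<in>UNIV. c (axis j (p j))) = of_nat n"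
      "\<forall>i. of_nat (a $ i) = c 0 * of_nat (0 $ i) + (\<Sum>j\<in>UNIV. c (axis j (p j)) * of_nat (axis j (p j) $ i))"
      by blast
    have "of_nat (a $ i) / of_nat (p i) = c (axis i (p i))" for i
      using c(3) pure_pos[of i] unfolding sum_pures_component by simp
    then have "height p a = (\<Sum>j\<in>UNIV. c (axis j (p j)))" by (simp add: height_def)
    then show "height p a \<le> of_nat n" using c(1,2) by simp
  next
    assume h: "height p a \<le> of_nat n"
    define c where "c = (\<lambda>v. if v = 0 then of_nat n - height p a
      else pure_weight (\<lambda>j. of_nat (a $ j) / of_nat (p j)) v)"
    have c0: "c 0 = of_nat n - height p a" by (simp add: c_def)
    have c: "c (axis j (p j)) = of_nat (a $ j) / of_nat (p j)" for j
      using pure_pos[of j] by (simp add: c_def pure_weight_pure axis_eq_0_iff)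
    show "\<exists>c :: nat ^ 'n \<Rightarrow> rat. (\<forall>v\<in>insert 0 pures. 0 \<le> c v) \<and> c 0 + (\<Sum>j\<in>UNIV. c (axis j (p j))) = of_nat n \<and>
      (\<forall>i. of_nat (a $ i) = c 0 * of_nat (0 $ i) + (\<Sum>j\<in>UNIV. c (axis j (p j)) * of_nat (axis j (p j) $ i)))"
    proof (intro exI[of _ c] conjI ballI allI)
      show "0 \<le> c v" for v using h by (simp add: c_def pure_weight_nonneg)
      show "c 0 + (\<Sum>j\<in>UNIV. c (axis j (p j))) = of_nat n"
        unfolding c c0 by (simp add: height_def)
      show "of_nat (a $ i) = c 0 * of_nat (0 $ i) + (\<Sum>j\<in>UNIV. c (axis j (p j)) * of_nat (axis j (p j) $ i))" for i
        unfolding sum_pures_component c using pure_pos[of i] by simp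
    qed
  qed
qed

text \<open>
  Shifting the proportion \<open>1 - s\<close> of the weight on the low generators onto the pure ones changes
  the total weight of a representation of \<open>a\<close> linearly in \<open>s\<close>, from \<open>height p a \<le> n\<close> at \<open>s = 0\<close>
  to a value that is at least \<open>n\<close> at \<open>s = 1\<close>.
\<close>

lemma dilate_polytope_iff:
  "rat_vec a \<in> (\<lambda>x. of_nat n *s x) ` conv (rat_vec ` (pures \<union> low)) \<longleftrightarrow>
    height p a \<le> of_nat n \<and> a \<in> newton V (of_nat n)"
proof -
  have fin: "finite (pures \<union> low)" "pures \<union> low \<noteq> {}"
    using finite_pures finite_low by (simp_all add: pures_def)
  have sums: "sum f (pures \<union> low) = (\<Sum>j\<in>UNIV. f (axis j (p j))) + sum f low" for f :: "nat ^ 'n \<Rightarrow> rat"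
    using finite_pures finite_low low_pures_disjoint
    by (subst sum.union_disjoint) (auto simp: sum_pures)
  have sub: "pures \<union> low \<subseteq> V" using low_subset pures_subset by blast
  show ?thesis
  proof
    assume "rat_vec a \<in> (\<lambda>x. of_nat n *s x) ` conv (rat_vec ` (pures \<union> low))"
    then obtain c :: "nat ^ 'n \<Rightarrow> rat" where c: "\<forall>v\<in>pures \<union> low. 0 \<le> c v" "sum c (pures \<union> low) = of_nat n"
      "\<forall>j. of_nat (a $ j) = (\<Sum>v\<in>pures \<union> low. c v * of_nat (v $ j))"
      unfolding dilate_conv_rat_vec[OF fin] by blast
    have "height p a = (\<Sum>j\<in>UNIV. (\<Sum>v\<in>pures \<union> low. c v * of_nat (v $ j)) / of_nat (p j))"
      by (simp only: height_def c(3)[rule_format])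
    also have "\<dots> = (\<Sum>v\<in>pures \<union> low. c v * height p v)" by (rule height_combination)
    also have "\<dots> \<le> (\<Sum>v\<in>pures \<union> low. c v * 1)"
    proof (intro sum_mono mult_left_mono)
      show "height p v \<le> 1" if "v \<in> pures \<union> low" for v
        using that height_pure by (auto simp: pures_def low_def)
    qed (use c(1) in blast)
    also have "\<dots> = of_nat n" using c(2) by simp
    finally have "height p a \<le> of_nat n" .
    moreover have "a \<in> newton V (of_nat n)"
    proof (rule newtonI)
      define d where "d = (\<lambda>v. if v \<in> pures \<union> low then c v else 0)"
      have d: "(\<Sum>v\<in>V. d v * g v) = (\<Sum>v\<in>pures \<union> low. c v * g v)" for g :: "nat ^ 'n \<Rightarrow> rat"
      proof -
        have "(\<Sum>v\<in>V. d v * g v) = (\<Sum>v\<in>pures \<union> low. d v * g v)"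
          using finite_generators sub by (intro sum.mono_neutral_right) (auto simp: d_def)
        then show ?thesis by (simp add: d_def)
      qed
      show "0 \<le> d v" for v using c(1) by (simp add: d_def)
      show "sum d V = of_nat n" using d[of "\<lambda>_. 1"] c(2) by simp
      show "(\<Sum>v\<in>V. d v * of_nat (v $ j)) \<le> of_nat (a $ j)" for j
        unfolding d c(3)[rule_format] by (rule order_refl)
    qed
    ultimately show "height p a \<le> of_nat n \<and> a \<in> newton V (of_nat n)" ..
  next
    assume "height p a \<le> of_nat n \<and> a \<in> newton V (of_nat n)"
    then have h: "height p a \<le> of_nat n" and aN: "a \<in> newton V (of_nat n)" by simp_all
    obtain c where c: "\<And>v. v \<in> V \<Longrightarrow> 0 \<le> c v" "sum c V = of_nat n"
      "\<And>j. (\<Sum>v\<in>V. c v * of_nat (v $ j)) \<le> (of_nat (a $ j) :: rat)"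
      using aN by (rule newtonE) blast
    define gain where "gain = (\<Sum>v\<in>low. c v * (1 - height p v))"
    have cl: "0 \<le> c v" if "v \<in> low" for v using c(1) that low_subset by blast
    have gain0: "0 \<le> gain" unfolding gain_def
      using cl by (intro sum_nonneg mult_nonneg_nonneg) (auto simp: low_def)
    have gain1: "of_nat n \<le> height p a + gain"
    proof -
      have split: "sum f V = sum f low + sum f (V - low)" for f :: "nat ^ 'n \<Rightarrow> rat"
        using sum.subset_diff[OF low_subset finite_generators, of f] by simp
      have "(\<Sum>v\<in>V - low. c v * 1) \<le> (\<Sum>v\<in>V - low. c v * height p v)"
        using c(1) by (intro sum_mono mult_left_mono) (auto simp: low_def)
      then have "of_nat n \<le> gain + (\<Sum>v\<in>V. c v * height p v)"
        unfolding c(2)[symmetric] split gain_def by (simp add: right_diff_distrib sum_subtractf)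
      also have "(\<Sum>v\<in>V. c v * height p v) = (\<Sum>j\<in>UNIV. (\<Sum>v\<in>V. c v * of_nat (v $ j)) / of_nat (p j))"
        by (rule height_combination[symmetric])
      also have "\<dots> \<le> height p a"
        unfolding height_def using c(3) by (intro sum_mono divide_right_mono) simp_all
      finally show ?thesis by simp
    qed
    define s where "s = (of_nat n - height p a) / gain"
    have s: "0 \<le> s" "s \<le> 1" "height p a + s * gain = of_nat n"
    proof -
      show "0 \<le> s" using h gain0 by (simp add: s_def)
      show "s \<le> 1" using gain0 gain1
        by (cases "gain = 0") (simp_all add: s_def divide_le_eq_1 less_le)
      show "height p a + s * gain = of_nat n"
        using h gain1 by (cases "gain = 0") (simp_all add: s_def)
    qed
    define b where "b = (\<lambda>j. \<Sum>v\<in>low. c v * of_nat (v $ j))"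
    have b: "s * b j \<le> of_nat (a $ j)" for j
    proof -
      have b0: "0 \<le> b j" unfolding b_def using cl by (intro sum_nonneg) simp
      have "b j \<le> (\<Sum>v\<in>V. c v * of_nat (v $ j))" unfolding b_def
        using c(1) finite_generators low_subset by (intro sum_mono2) auto
      then have "b j \<le> of_nat (a $ j)" using c(3)[of j] by simp
      moreover have "s * b j \<le> b j" using s b0 by (simp add: mult_left_le_one_le)
      ultimately show ?thesis by simp
    qed
    define g where "g = (\<lambda>j. (of_nat (a $ j) - s * b j) / of_nat (p j))"
    define d where "d = (\<lambda>v. if v \<in> low then s * c v else pure_weight g v)"
    have d_low: "d v = s * c v" if "v \<in> low" for v using that by (simp add: d_def)
    have d_pure: "d (axis j (p j)) = g j" for j
    proof -
      have "axis j (p j) \<notin> low" using low_pures_disjoint by (auto simp: pures_def)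
      then show ?thesis by (simp add: d_def pure_weight_pure)
    qed
    have sum_low: "(\<Sum>v\<in>low. d v * f v) = s * (\<Sum>v\<in>low. c v * f v)" for f :: "nat ^ 'n \<Rightarrow> rat"
      by (simp add: d_low sum_distrib_left mult.assoc)
    show "rat_vec a \<in> (\<lambda>x. of_nat n *s x) ` conv (rat_vec ` (pures \<union> low))"
      unfolding dilate_conv_rat_vec[OF fin]
    proof (intro exI[of _ d] conjI ballI allI)
      show "0 \<le> d v" for v
        using cl s(1) b by (auto simp: d_def g_def intro!: pure_weight_nonneg mult_nonneg_nonneg)
      have "(\<Sum>v\<in>low. c v * height p v) = (\<Sum>j\<in>UNIV. b j / of_nat (p j))"
        unfolding b_def by (rule height_combination[symmetric])
      then have "sum g UNIV = height p a - s * (\<Sum>v\<in>low. c v * height p v)"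
        by (simp add: g_def height_def diff_divide_distrib sum_subtractf sum_distrib_left)
      moreover have "sum d low = s * sum c low" using sum_low[of "\<lambda>_. 1"] by simp
      ultimately have "sum d (pures \<union> low) = height p a + s * gain"
        unfolding sums d_pure gain_def by (simp add: right_diff_distrib sum_subtractf)
      then show "sum d (pures \<union> low) = of_nat n" using s(3) by simp
      have bi: "(\<Sum>v\<in>low. c v * of_nat (v $ i)) = b i" for i by (simp add: b_def)
      show "of_nat (a $ i) = (\<Sum>v\<in>pures \<union> low. d v * of_nat (v $ i))" for i
        unfolding sums d_pure sum_low bi sum_pures_component
        using pure_pos[of i] by (simp add: g_def)
    qed
  qed
qed

text \<open>
  A point outside the polyhedron has height less than \<open>n\<close>, since a point of height at least \<open>n\<close> is
  reached by the pure generators alone. So it lies in \<open>n S\<close>, and the points of \<open>n S\<close> inside the polyhedron are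
  those of \<open>n P\<close>.
\<close>

theorem card_below_newton:
  "finite {a. a \<notin> newton V (of_nat n)} \<and>
   of_nat (card {a. a \<notin> newton V (of_nat n)}) =
     (of_nat (ehrhart_function (conv (rat_vec ` insert 0 pures)) n) :: rat) -
     of_nat (ehrhart_function (conv (rat_vec ` (pures \<union> low))) n)"
proof -
  have finS: "finite (insert 0 pures)" "insert 0 pures \<noteq> {}"
    and finP: "finite (pures \<union> low)" "pures \<union> low \<noteq> {}"
    using finite_pures finite_low by (simp_all add: pures_def)
  define S where "S = {a. height p a \<le> of_nat n}"
  define P where "P = {a. height p a \<le> of_nat n \<and> a \<in> newton V (of_nat n)}"
  have "S \<subseteq> {a. \<forall>j. a $ j \<le> n * p j}"
  proof (intro subsetI CollectI allI)
    fix a j assume "a \<in> S"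
    have "of_nat (a $ j) / of_nat (p j) \<le> height p a"
      unfolding height_def by (rule member_le_sum) simp_all
    then have "of_nat (a $ j) / of_nat (p j) \<le> (of_nat n :: rat)" using \<open>a \<in> S\<close> by (simp add: S_def)
    then have "of_nat (a $ j) \<le> (of_nat (n * p j) :: rat)" using pure_pos[of j] by (simp add: divide_le_eq)
    then show "a $ j \<le> n * p j" by (simp only: of_nat_le_iff)
  qed
  then have "finite S" using finite_bounded_vectors by (rule finite_subset)
  have eq: "{a. a \<notin> newton V (of_nat n)} = S - P"
    using high_in_newton by (force simp: S_def P_def)
  have sub: "P \<subseteq> S" by (auto simp: S_def P_def)
  then have "card (S - P) = card S - card P" "card P \<le> card S"
    using \<open>finite S\<close> by (auto simp: card_Diff_subset finite_subset card_mono)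
  then have "of_nat (card (S - P)) = (of_nat (card S) - of_nat (card P) :: rat)"
    by (simp add: of_nat_diff)
  then show ?thesis
    unfolding ehrhart_function_rat_vec[OF finS] ehrhart_function_rat_vec[OF finP]
      dilate_simplex_iff dilate_polytope_iff eq
    using \<open>finite S\<close> by (simp add: S_def P_def)
qed

end

section \<open>Ideals and integral closure in the ring of a type\<close>

abbreviation type_ring :: "'a::comm_ring_1 ring" where
  "type_ring \<equiv> ring_of_type_algebra"

lemma type_ring_simps [simp]:
  "carrier (type_ring :: 'a::comm_ring_1 ring) = UNIV"
  "x \<otimes>\<^bsub>type_ring\<^esub> y = x * (y :: 'a::comm_ring_1)"
  "x \<oplus>\<^bsub>type_ring\<^esub> y = x + (y :: 'a::comm_ring_1)"
  "\<one>\<^bsub>type_ring\<^esub> = (1 :: 'a::comm_ring_1)"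
  "\<zero>\<^bsub>type_ring\<^esub> = (0 :: 'a::comm_ring_1)"
  by (simp_all add: ring_of_type_algebra_def)

lemma cring_type_ring: "cring (type_ring :: 'a::comm_ring_1 ring)"
  by (rule cring_from_type_algebra)

lemma ring_type_ring: "ring (type_ring :: 'a::comm_ring_1 ring)"
  by (rule ring_from_type_algebra)

lemma type_ring_pow [simp]: "x [^]\<^bsub>type_ring\<^esub> (n::nat) = (x :: 'a::comm_ring_1) ^ n"
  by (induction n) (simp_all add: nat_pow_def mult.commute)

lemma type_ring_finsum:
  assumes "finite A"
  shows "finsum (type_ring :: 'a::comm_ring_1 ring) f A = sum f A"
proof -
  interpret R: cring "type_ring :: 'a ring" by (rule cring_type_ring)
  show ?thesis using assms by (induction rule: finite_induct) simp_all
qed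

lemma type_ring_uminus [simp]: "\<ominus>\<^bsub>type_ring\<^esub> x = - (x :: 'a::comm_ring_1)"
proof -
  interpret R: cring "type_ring :: 'a ring" by (rule cring_type_ring)
  show ?thesis by (rule R.minus_equality) simp_all
qed

lemma ideal_type_ringI:
  fixes J :: "'a::comm_ring_1 set"
  assumes "0 \<in> J" "\<And>x y. x \<in> J \<Longrightarrow> y \<in> J \<Longrightarrow> x + y \<in> J" "\<And>x y. x \<in> J \<Longrightarrow> y * x \<in> J"
  shows "ideal J type_ring"
proof (rule idealI)
  show "ring (type_ring :: 'a ring)" by (rule ring_type_ring)
  interpret R: cring "type_ring :: 'a ring" by (rule cring_type_ring)
  show "subgroup J (add_monoid type_ring)"
  proof (rule R.add.subgroupI)
    show "\<ominus>\<^bsub>type_ring\<^esub> x \<in> J" if "x \<in> J" for x using assms(3)[OF that, of "-1"] by simp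
    show "J \<noteq> {}" using assms(1) by blast
  qed (use assms in simp_all)
  show "x \<otimes>\<^bsub>type_ring\<^esub> a \<in> J" "a \<otimes>\<^bsub>type_ring\<^esub> x \<in> J" if "a \<in> J" for a x
    using assms(3)[OF that, of x] by (simp_all add: mult.commute)
qed

lemma ideal_type_ringD:
  fixes J :: "'a::comm_ring_1 set"
  assumes "ideal J type_ring"
  shows "0 \<in> J" "x \<in> J \<Longrightarrow> y \<in> J \<Longrightarrow> x + y \<in> J" "x \<in> J \<Longrightarrow> y * x \<in> J" "x \<in> J \<Longrightarrow> - x \<in> J"
proof -
  interpret I: ideal J type_ring by (rule assms)
  have sub: "additive_subgroup J type_ring" by (rule ideal.axioms(1)[OF assms])
  show "0 \<in> J" using additive_subgroup.zero_closed[OF sub] by simp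
  show "x + y \<in> J" if "x \<in> J" "y \<in> J" using additive_subgroup.a_closed[OF sub that] by simp
  show *: "y * x \<in> J" if "x \<in> J" for y using I.I_l_closed[OF that, of y] by simp
  show "- x \<in> J" if "x \<in> J" using I.I_l_closed[OF that, of "-1"] by simp
qed

lemma ideal_type_ring_sum:
  fixes J :: "'a::comm_ring_1 set"
  assumes "ideal J type_ring" "\<And>i. i \<in> A \<Longrightarrow> f i \<in> J"
  shows "sum f A \<in> J"
  using assms(2) by (induction A rule: infinite_finite_induct) (use ideal_type_ringD[OF assms(1)] in auto)

definition ideal_pow :: "'a::comm_ring_1 set \<Rightarrow> nat \<Rightarrow> 'a set" where
  "ideal_pow J n = J [^]\<^bsub>ideals_set type_ring\<^esub> n"

lemma ideal_pow_0: "ideal_pow J 0 = UNIV"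
  and ideal_pow_Suc: "ideal_pow J (Suc n) = ideal_prod type_ring (ideal_pow J n) J"
  by (simp_all add: ideal_pow_def ideals_set_def nat_pow_def)

lemma ideal_ideal_pow: "ideal J type_ring \<Longrightarrow> ideal (ideal_pow J n) (type_ring :: 'a::comm_ring_1 ring)"
proof (induction n)
  case 0
  show ?case by (rule ideal_type_ringI) (simp_all add: ideal_pow_0)
next
  case (Suc n)
  interpret R: ring "type_ring :: 'a ring" by (rule ring_type_ring)
  show ?case unfolding ideal_pow_Suc using Suc by (intro R.ideal_prod_is_ideal)
qed

text \<open>
  The set \<open>U n\<close> stands for the \<open>n\<close>th member of a filtration.
\<close>

lemma ideal_pow_subset:
  fixes J :: "'a::comm_ring_1 set"
  assumes "J \<subseteq> U 1" "U 0 = UNIV"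
    and "\<And>n x y. x \<in> U n \<Longrightarrow> y \<in> U 1 \<Longrightarrow> x * y \<in> U (Suc n)"
    and "\<And>n x y. x \<in> U n \<Longrightarrow> y \<in> U n \<Longrightarrow> x + y \<in> U n"
  shows "ideal_pow J n \<subseteq> U n"
proof (induction n)
  case (Suc n)
  show ?case
  proof
    fix x assume "x \<in> ideal_pow J (Suc n)"
    then have "x \<in> ideal_prod type_ring (ideal_pow J n) J" by (simp add: ideal_pow_Suc)
    then show "x \<in> U (Suc n)"
    proof (induction rule: ideal_prod.induct)
      case (prod i j)
      then show ?case using Suc assms(1,3) by (simp add: subset_iff)
    next
      case (sum s1 s2)
      then show ?case using assms(4) by simp
    qed
  qed
qed (simp add: assms)

lemma ideal_pow_mult:
  fixes J :: "'a::comm_ring_1 set"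
  assumes J: "ideal J type_ring" and x: "x \<in> ideal_pow J m"
  shows "y \<in> ideal_pow J n \<Longrightarrow> x * y \<in> ideal_pow J (m + n)"
proof (induction n arbitrary: y)
  case 0
  show ?case using ideal_type_ringD(3)[OF ideal_ideal_pow[OF J] x, of y] by (simp add: mult.commute)
next
  case (Suc n)
  from Suc.prems have "y \<in> ideal_prod type_ring (ideal_pow J n) J" by (simp add: ideal_pow_Suc)
  then show ?case
  proof (induction rule: ideal_prod.induct)
    case (prod i j)
    have "x * i \<in> ideal_pow J (m + n)" using Suc.IH prod(1) by blast
    then have "(x * i) \<otimes>\<^bsub>type_ring\<^esub> j \<in> ideal_pow J (Suc (m + n))"
      unfolding ideal_pow_Suc using prod(2) by (rule ideal_prod.prod)
    then show ?case by (simp add: mult.assoc)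
  next
    case (sum s1 s2)
    then show ?case using ideal_type_ringD(2)[OF ideal_ideal_pow[OF J]] by (simp add: distrib_left)
  qed
qed

lemma ideal_pow_1:
  fixes J :: "'a::comm_ring_1 set"
  assumes "ideal J type_ring"
  shows "ideal_pow J 1 = J"
proof
  have "ideal_prod type_ring UNIV J \<subseteq> J"
  proof
    fix x assume "x \<in> ideal_prod type_ring UNIV J"
    then show "x \<in> J"
      by (induction rule: ideal_prod.induct) (simp_all add: ideal_type_ringD[OF assms])
  qed
  then show "ideal_pow J 1 \<subseteq> J" by (simp add: ideal_pow_Suc ideal_pow_0)
  show "J \<subseteq> ideal_pow J 1"
  proof
    fix x assume "x \<in> J"
    then have "1 \<otimes>\<^bsub>type_ring\<^esub> x \<in> ideal_prod type_ring UNIV J" by (intro ideal_prod.prod) simp_all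
    then show "x \<in> ideal_pow J 1" by (simp add: ideal_pow_Suc ideal_pow_0)
  qed
qed

lemma integral_closure_iff:
  fixes J :: "'a::comm_ring_1 set"
  shows "r \<in> integral_closure_ideal type_ring J \<longleftrightarrow>
    (\<exists>n\<ge>1. \<exists>c. (\<forall>i\<in>{1..n}. c i \<in> ideal_pow J i) \<and> r ^ n + (\<Sum>i=1..n. c i * r ^ (n - i)) = 0)"
  unfolding integral_closure_ideal_def ideal_pow_def by (simp add: type_ring_finsum)

subsection \<open>The determinant trick by elimination\<close>

text \<open>
  The values at \<open>f\<close> of the polynomials \<open>\<Sum>i=1..m. c i * T ^ (m - i)\<close> with \<open>c i \<in> J ^ i\<close>, and of
  the monic polynomials with these lower terms.
\<close>

primrec lower_terms :: "'a::comm_ring_1 set \<Rightarrow> 'a \<Rightarrow> nat \<Rightarrow> 'a set" where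
  "lower_terms J f 0 = {0}"
| "lower_terms J f (Suc m) = {f * g + j | g j. g \<in> lower_terms J f m \<and> j \<in> ideal_pow J (Suc m)}"

definition monic_values :: "'a::comm_ring_1 set \<Rightarrow> 'a \<Rightarrow> nat \<Rightarrow> 'a set" where
  "monic_values J f m = {f ^ m + g | g. g \<in> lower_terms J f m}"

context
  fixes J :: "'a::comm_ring_1 set" and f :: 'a
  assumes J: "ideal J type_ring"
begin

lemmas pow_add = ideal_type_ringD(2)[OF ideal_ideal_pow[OF J]]
lemmas pow_zero = ideal_type_ringD(1)[OF ideal_ideal_pow[OF J]]
lemmas pow_uminus = ideal_type_ringD(4)[OF ideal_ideal_pow[OF J]]

lemma lower_SucI: "g \<in> lower_terms J f m \<Longrightarrow> j \<in> ideal_pow J (Suc m) \<Longrightarrow> f * g + j \<in> lower_terms J f (Suc m)"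
  by auto

lemma lower_zero: "0 \<in> lower_terms J f m"
proof (induction m)
  case (Suc m)
  from lower_SucI[OF Suc pow_zero] show ?case by simp
qed simp

lemma lower_shift: "g \<in> lower_terms J f m \<Longrightarrow> f * g \<in> lower_terms J f (Suc m)"
  using lower_SucI[OF _ pow_zero] by fastforce

lemma lower_add:
  "g \<in> lower_terms J f m \<Longrightarrow> h \<in> lower_terms J f m \<Longrightarrow> g + h \<in> lower_terms J f m"
proof (induction m arbitrary: g h)
  case (Suc m)
  obtain g' i where g: "g = f * g' + i" "g' \<in> lower_terms J f m" "i \<in> ideal_pow J (Suc m)" using Suc.prems(1) by auto
  obtain h' j where h: "h = f * h' + j" "h' \<in> lower_terms J f m" "j \<in> ideal_pow J (Suc m)" using Suc.prems(2) by auto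
  have "g + h = f * (g' + h') + (i + j)" using g(1) h(1) by (simp add: algebra_simps)
  then show ?case using lower_SucI[OF Suc.IH[OF g(2) h(2)] pow_add[OF g(3) h(3)]] by simp
qed simp

lemma lower_uminus: "g \<in> lower_terms J f m \<Longrightarrow> - g \<in> lower_terms J f m"
proof (induction m arbitrary: g)
  case (Suc m)
  obtain g' i where g: "g = f * g' + i" "g' \<in> lower_terms J f m" "i \<in> ideal_pow J (Suc m)" using Suc.prems(1) by auto
  have "- g = f * (- g') + (- i)" using g(1) by simp
  then show ?case using lower_SucI[OF Suc.IH[OF g(2)] pow_uminus[OF g(3)]] by simp
qed simp

lemma lower_pow_mult: "x \<in> ideal_pow J k \<Longrightarrow> g \<in> lower_terms J f m \<Longrightarrow> x * g \<in> lower_terms J f (k + m)"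
proof (induction m arbitrary: g)
  case 0
  then show ?case using lower_zero by simp
next
  case (Suc m)
  obtain g' i where g: "g = f * g' + i" "g' \<in> lower_terms J f m" "i \<in> ideal_pow J (Suc m)" using Suc.prems(2) by auto
  have "x * i \<in> ideal_pow J (Suc (k + m))" using ideal_pow_mult[OF J Suc.prems(1) g(3)] by simp
  from lower_SucI[OF Suc.IH[OF Suc.prems(1) g(2)] this]
  show ?case using g(1) by (simp add: algebra_simps)
qed

lemma lower_power_mult: "g \<in> lower_terms J f m \<Longrightarrow> f ^ l * g \<in> lower_terms J f (l + m)"
proof (induction l)
  case (Suc l)
  from lower_shift[OF Suc.IH[OF Suc.prems]] show ?case by (simp add: mult.assoc)
qed simp

lemma lower_mult: "g \<in> lower_terms J f k \<Longrightarrow> h \<in> lower_terms J f l \<Longrightarrow> g * h \<in> lower_terms J f (k + l)"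
proof (induction k arbitrary: g)
  case 0
  then show ?case using lower_zero by simp
next
  case (Suc k)
  obtain g' i where g: "g = f * g' + i" "g' \<in> lower_terms J f k" "i \<in> ideal_pow J (Suc k)" using Suc.prems(1) by auto
  have "g * h = f * (g' * h) + i * h" using g(1) by (simp add: algebra_simps)
  moreover have "f * (g' * h) \<in> lower_terms J f (Suc k + l)"
    using lower_shift[OF Suc.IH[OF g(2) Suc.prems(2)]] by (simp del: lower_terms.simps)
  moreover have "i * h \<in> lower_terms J f (Suc k + l)" by (rule lower_pow_mult[OF g(3) Suc.prems(2)])
  ultimately show ?case using lower_add by presburger
qed

lemma monic_lower_mult:
  assumes "D \<in> monic_values J f m" "h \<in> lower_terms J f l" shows "D * h \<in> lower_terms J f (m + l)"
proof -
  obtain g where g: "D = f ^ m + g" "g \<in> lower_terms J f m" using assms(1) by (auto simp: monic_values_def)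
  have "D * h = f ^ m * h + g * h" using g(1) by (simp add: distrib_right)
  then show ?thesis using lower_add[OF lower_power_mult[OF assms(2)] lower_mult[OF g(2) assms(2)]] by simp
qed

lemma monic_diff:
  assumes "D \<in> monic_values J f m" "h \<in> lower_terms J f m" shows "D - h \<in> monic_values J f m"
proof -
  obtain g where g: "D = f ^ m + g" "g \<in> lower_terms J f m" using assms(1) by (auto simp: monic_values_def)
  have "D - h = f ^ m + (g + - h)" using g(1) by simp
  then show ?thesis using lower_add[OF g(2) lower_uminus[OF assms(2)]] unfolding monic_values_def by blast
qed

lemma monic_mult:
  assumes "D \<in> monic_values J f m" "E \<in> monic_values J f l" shows "D * E \<in> monic_values J f (m + l)"
proof -
  obtain g where g: "D = f ^ m + g" "g \<in> lower_terms J f m" using assms(1) by (auto simp: monic_values_def)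
  obtain h where h: "E = f ^ l + h" "h \<in> lower_terms J f l" using assms(2) by (auto simp: monic_values_def)
  have "D * E = f ^ (m + l) + (D * h + f ^ l * g)"
    unfolding g(1) h(1) by (simp add: algebra_simps power_add)
  moreover have "f ^ l * g \<in> lower_terms J f (m + l)" using lower_power_mult[OF g(2), of l] by (simp add: add.commute)
  then have "D * h + f ^ l * g \<in> lower_terms J f (m + l)"
    using lower_add[OF monic_lower_mult[OF assms(1) h(2)]] by blast
  ultimately show ?thesis unfolding monic_values_def by blast
qed

text \<open>
  Gaussian elimination of one unknown at a time, where multiplication by the pivot replaces the
  division by it.
\<close>

lemma eliminate:
  assumes "finite B" "B \<noteq> {}" "1 \<le> m" "F \<in> monic_values J f m"
    "\<And>i j. i \<in> B \<Longrightarrow> j \<in> B \<Longrightarrow> M i j \<in> lower_terms J f m"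
    "\<And>i. i \<in> B \<Longrightarrow> F * b i = (\<Sum>j\<in>B. M i j * b j)"
  shows "\<exists>s\<in>B. \<exists>k\<ge>1. \<exists>D\<in>monic_values J f k. D * b s = 0"
  using assms
proof (induction arbitrary: m F M rule: finite_ne_induct)
  case (singleton s)
  have "F - M s s \<in> monic_values J f m" using singleton by (intro monic_diff) simp_all
  moreover have "(F - M s s) * b s = 0" using singleton(4)[of s] by (simp add: left_diff_distrib)
  ultimately show ?case using singleton(1) by blast
next
  case (insert s B)
  define D where "D = F - M s s"
  have D: "D \<in> monic_values J f m" unfolding D_def using insert.prems by (intro monic_diff) simp_all
  have Ds: "D * b s = (\<Sum>j\<in>B. M s j * b j)"
    using insert.prems(4)[of s] insert.hyps by (simp add: D_def left_diff_distrib)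
  define M' where "M' = (\<lambda>i j. D * M i j + M i s * M s j)"
  have "\<exists>s\<in>B. \<exists>k\<ge>1. \<exists>D\<in>monic_values J f k. D * b s = 0"
  proof (rule insert.IH[of "m + m" "D * F" M'])
    show "1 \<le> m + m" using insert.prems(1) by simp
    show "D * F \<in> monic_values J f (m + m)" using D insert.prems(2) by (rule monic_mult)
    show "M' i j \<in> lower_terms J f (m + m)" if "i \<in> B" "j \<in> B" for i j
      unfolding M'_def using that D insert.prems(3)
      by (intro lower_add monic_lower_mult lower_mult) simp_all
    show "D * F * b i = (\<Sum>j\<in>B. M' i j * b j)" if "i \<in> B" for i
    proof -
      have "F * b i = M i s * b s + (\<Sum>j\<in>B. M i j * b j)"
        using insert.prems(4)[of i] that insert.hyps by simp
      then have "D * F * b i = M i s * (D * b s) + D * (\<Sum>j\<in>B. M i j * b j)"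
        by (simp add: algebra_simps)
      also have "\<dots> = (\<Sum>j\<in>B. M' i j * b j)"
        unfolding Ds by (simp add: M'_def sum_distrib_left sum.distrib algebra_simps)
      finally show ?thesis .
    qed
  qed
  then show ?case by blast
qed

lemma lower_terms_sum:
  "g \<in> lower_terms J f m \<Longrightarrow>
    \<exists>c. (\<forall>i\<in>{1..m}. c i \<in> ideal_pow J i) \<and> g = (\<Sum>i=1..m. c i * f ^ (m - i))"
proof (induction m arbitrary: g)
  case (Suc m)
  obtain g' j where g: "g = f * g' + j" "g' \<in> lower_terms J f m" "j \<in> ideal_pow J (Suc m)" using Suc.prems(1) by auto
  from Suc.IH[OF g(2)] obtain c where c: "\<forall>i\<in>{1..m}. c i \<in> ideal_pow J i" "g' = (\<Sum>i=1..m. c i * f ^ (m - i))"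
    by blast
  have "(\<Sum>i=1..m. (c(Suc m := j)) i * f ^ (Suc m - i)) = f * g'"
    unfolding c(2) sum_distrib_left
    by (intro sum.cong refl) (auto simp: Suc_diff_le algebra_simps)
  then have "g = (\<Sum>i=1..Suc m. (c(Suc m := j)) i * f ^ (Suc m - i))" using g(1) by simp
  moreover have "\<forall>i\<in>{1..Suc m}. (c(Suc m := j)) i \<in> ideal_pow J i" using c(1) g(3) by (auto simp: le_Suc_eq)
  ultimately show ?case by blast
qed simp

text \<open>
  If \<open>f N \<subseteq> J N\<close> for the module \<open>N\<close> generated by the \<open>b i\<close>, then elimination leaves a monic equation of
  the right form that kills some \<open>b i\<close>.
\<close>

theorem integral_of_finite_system:
  assumes "finite B" "B \<noteq> {}" "\<And>i j. i \<in> B \<Longrightarrow> j \<in> B \<Longrightarrow> M i j \<in> J"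
    "\<And>i. i \<in> B \<Longrightarrow> f * b i = (\<Sum>j\<in>B. M i j * b j)"
    and nonzero_divisor: "\<And>i x. i \<in> B \<Longrightarrow> x * b i = 0 \<Longrightarrow> x = 0"
  shows "f \<in> integral_closure_ideal type_ring J"
proof -
  have low: "M i j \<in> lower_terms J f 1" if "i \<in> B" "j \<in> B" for i j
    using lower_SucI[OF lower_zero, of "M i j" 0] assms(3)[OF that] ideal_pow_1[OF J] by simp
  have mon: "f \<in> monic_values J f 1" using lower_zero[of 1] by (force simp: monic_values_def)
  obtain s k D where D: "s \<in> B" "k \<ge> 1" "D \<in> monic_values J f k" "D * b s = 0"
    using eliminate[OF assms(1,2) order_refl mon low assms(4)] by blast
  then have "D = 0" using nonzero_divisor by blast
  then obtain g where g: "f ^ k + g = 0" "g \<in> lower_terms J f k" using D(3) by (auto simp: monic_values_def)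
  from lower_terms_sum[OF g(2)] show ?thesis
    unfolding integral_closure_iff using D(2) g(1) by blast
qed

end

section \<open>Integral closures of powers of monomial ideals\<close>

abbreviation keys :: "('a \<Rightarrow>\<^sub>0 'b::zero) \<Rightarrow> 'a set" where
  "keys \<equiv> Poly_Mapping.keys"

abbreviation lookup :: "('a \<Rightarrow>\<^sub>0 'b::zero) \<Rightarrow> 'a \<Rightarrow> 'b" where
  "lookup \<equiv> Poly_Mapping.lookup"

abbreviation single :: "'a \<Rightarrow> 'b \<Rightarrow> 'a \<Rightarrow>\<^sub>0 'b::zero" where
  "single \<equiv> Poly_Mapping.single"

lemma poly_mapping_sum_single:
  "f = (\<Sum>a\<in>keys f. single a (lookup f a))"
proof (rule poly_mapping_eqI)
  fix k
  have "lookup (\<Sum>a\<in>keys f. single a (lookup f a)) k =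
      (\<Sum>a\<in>keys f. if a = k then lookup f a else 0)"
    unfolding lookup_sum by (intro sum.cong refl) (simp add: lookup_single when_def)
  also have "\<dots> = lookup f k" by (simp add: in_keys_iff)
  finally show "lookup f k =
    lookup (\<Sum>a\<in>keys f. single a (lookup f a)) k" ..
qed

lemma keys_mult_subset:
  assumes "\<And>a b. a \<in> keys f \<Longrightarrow> b \<in> keys g \<Longrightarrow> a + b \<in> U"
  shows "keys (f * g) \<subseteq> U"
  using Poly_Mapping.keys_mult[of f g] assms by blast

lemma monomial_mult_eq_0:
  fixes g :: "('n::finite, 'k::field) mpoly"
  assumes "g * monomial v = 0" shows "g = 0"
proof (rule poly_mapping_eqI)
  fix k
  have "g * monomial v = (\<Sum>a\<in>keys g. single (a + v) (lookup g a))"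
    by (subst poly_mapping_sum_single[of g]) (simp add: sum_distrib_right monomial_def mult_single)
  then have "lookup (g * monomial v) (k + v) =
      (\<Sum>a\<in>keys g. if a = k then lookup g a else 0)"
    by (simp add: lookup_sum lookup_single when_def)
  also have "\<dots> = lookup g k" by (simp add: in_keys_iff)
  finally show "lookup g k = lookup 0 k" using assms by simp
qed

definition supported :: "(nat ^ 'n::finite) set \<Rightarrow> ('n, 'k::field) mpoly set" where
  "supported U = {f. keys f \<subseteq> U}"

definition upward_closed :: "(nat ^ 'n::finite) set \<Rightarrow> bool" where
  "upward_closed U \<longleftrightarrow> (\<forall>a\<in>U. \<forall>b. a + b \<in> U)"

lemma supported_zero: "0 \<in> supported U"
  by (simp add: supported_def)

lemma supported_add: "f \<in> supported U \<Longrightarrow> g \<in> supported U \<Longrightarrow> f + g \<in> supported U"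
  unfolding supported_def using Poly_Mapping.keys_add[of f g] by blast

lemma supported_uminus: "f \<in> supported U \<Longrightarrow> - f \<in> supported U"
  by (simp add: supported_def subset_iff in_keys_iff)

lemma supported_sum: "(\<And>i. i \<in> A \<Longrightarrow> f i \<in> supported U) \<Longrightarrow> sum f A \<in> supported U"
  by (induction A rule: infinite_finite_induct) (simp_all add: supported_zero supported_add)

lemma supported_mult:
  assumes "f \<in> supported U" "g \<in> supported W" "\<And>a b. a \<in> U \<Longrightarrow> b \<in> W \<Longrightarrow> a + b \<in> Y"
  shows "f * g \<in> supported Y"
  unfolding supported_def mem_Collect_eq
  by (rule keys_mult_subset) (use assms in \<open>auto simp: supported_def\<close>)

lemma supported_mono: "U \<subseteq> W \<Longrightarrow> supported U \<subseteq> supported W"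
  by (auto simp: supported_def)

lemma ideal_supported:
  assumes "upward_closed U"
  shows "ideal (supported U :: ('n::finite, 'k::field) mpoly set) type_ring"
proof (rule ideal_type_ringI)
  show "g * f \<in> supported U" if "f \<in> supported U" for f g :: "('n, 'k) mpoly"
  proof -
    have "f * g \<in> supported U"
      by (rule supported_mult[OF that, of g UNIV])
        (use assms in \<open>auto simp: supported_def upward_closed_def\<close>)
    then show ?thesis by (simp add: mult.commute)
  qed
qed (simp_all add: supported_zero supported_add)

lemma upward_closed_newton: "upward_closed (newton V t)"
  by (simp add: upward_closed_def newton_add_right)

definition monomial_ideal :: "(nat ^ 'n) set \<Rightarrow> ('n::finite, 'k::field) mpoly set" where
  "monomial_ideal V = Idl\<^bsub>mpoly_ring\<^esub> (monomial ` V)"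

lemma ideal_monomial_ideal: "ideal (monomial_ideal V :: ('n::finite, 'k::field) mpoly set) type_ring"
proof -
  interpret R: ring "type_ring :: ('n, 'k) mpoly ring" by (rule ring_type_ring)
  show ?thesis unfolding monomial_ideal_def by (rule R.genideal_ideal) simp
qed

lemma monomial_in_ideal:
  assumes "v \<in> V"
  shows "(monomial v :: ('n::finite, 'k::field) mpoly) \<in> monomial_ideal V"
proof -
  interpret R: ring "type_ring :: ('n, 'k) mpoly ring" by (rule ring_type_ring)
  show ?thesis
    unfolding monomial_ideal_def using assms R.genideal_self[of "monomial ` V"] by auto
qed

lemma monomial_ideal_minimal:
  fixes J :: "('n::finite, 'k::field) mpoly set"
  assumes "ideal J type_ring" "monomial ` V \<subseteq> J" shows "monomial_ideal V \<subseteq> J"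
proof -
  interpret R: ring "type_ring :: ('n, 'k) mpoly ring" by (rule ring_type_ring)
  show ?thesis unfolding monomial_ideal_def by (rule R.genideal_minimal[OF assms])
qed

lemma keys_monomial [simp]: "keys (monomial v :: ('n::finite, 'k::field) mpoly) = {v}"
  by (simp add: monomial_def)

lemma monomial_ideal_supported:
  assumes "upward_closed U" "V \<subseteq> U" shows "monomial_ideal V \<subseteq> supported U"
  by (rule monomial_ideal_minimal[OF ideal_supported[OF assms(1)]]) (use assms(2) in \<open>auto simp: supported_def\<close>)

lemma monomial_0: "monomial 0 = 1"
  by (simp add: monomial_def)

lemma monomial_add: "monomial (u + v) = monomial u * (monomial v :: ('n::finite, 'k::field) mpoly)"
  by (simp add: monomial_def mult_single)

lemma monomial_power_in_ideal_pow:
  assumes "finite V"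
  shows "(monomial (\<Sum>v\<in>V. k v *s v) :: ('n::finite, 'k::field) mpoly) \<in> ideal_pow (monomial_ideal V) (sum k V)"
proof -
  note J = ideal_monomial_ideal[of V, where ?'k = 'k]
  have pow: "(monomial (m *s v) :: ('n, 'k) mpoly) \<in> ideal_pow (monomial_ideal V) m" if "v \<in> V" for v m
  proof (induction m)
    case (Suc m)
    have "(monomial v :: ('n, 'k) mpoly) \<in> ideal_pow (monomial_ideal V) 1"
      unfolding ideal_pow_1[OF J] by (rule monomial_in_ideal[OF that])
    from ideal_pow_mult[OF J Suc this] have
      "(monomial (m *s v + v) :: ('n, 'k) mpoly) \<in> ideal_pow (monomial_ideal V) (m + 1)"
      by (simp only: monomial_add)
    moreover have "m *s v + v = Suc m *s v" by (simp add: vec_eq_iff)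
    ultimately show ?case by simp
  qed (simp add: ideal_pow_0)
  have "(monomial (\<Sum>v\<in>W. k v *s v) :: ('n, 'k) mpoly) \<in> ideal_pow (monomial_ideal V) (sum k W)"
    if "W \<subseteq> V" "finite W" for W
    using that(2,1)
  proof (induction rule: finite_induct)
    case (insert v W)
    then show ?case
      using ideal_pow_mult[OF J pow[of v "k v"], of "monomial (\<Sum>v\<in>W. k v *s v)" "sum k W"]
      by (simp add: monomial_add)
  qed (simp add: ideal_pow_0)
  then show ?thesis using assms by blast
qed

lemma ideal_pow_monomial_supported:
  assumes "finite V"
  shows "ideal_pow (monomial_ideal V :: ('n::finite, 'k::field) mpoly set) n \<subseteq> supported (newton V (of_nat n))"
proof (rule ideal_pow_subset[where U = "\<lambda>n. supported (newton V (of_nat n))"])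
  show "monomial_ideal V \<subseteq> supported (newton V (of_nat 1))"
    using monomial_ideal_supported[OF upward_closed_newton[of V 1]] newton_generator[OF assms] by auto
  show "(supported (newton V (of_nat 0)) :: ('n, 'k) mpoly set) = UNIV"
    by (auto simp: supported_def newton_zero)
  show "f * g \<in> supported (newton V (of_nat (Suc n)))"
    if "f \<in> supported (newton V (of_nat n))" "g \<in> supported (newton V (of_nat 1))"
    for n and f g :: "('n, 'k) mpoly"
  proof (rule supported_mult[OF that])
    fix a b assume "a \<in> newton V (of_nat n)" "b \<in> newton V (of_nat 1)"
    from newton_add[OF this] show "a + b \<in> newton V (of_nat (Suc n))" by (simp add: add.commute)
  qed
qed (rule supported_add)

lemma ideal_pow_pow_supported:
  assumes "finite V"
  shows "ideal_pow (ideal_pow (monomial_ideal V :: ('n::finite, 'k::field) mpoly set) n) i \<subseteq>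
    supported (newton V (of_nat (n * i)))"
proof (rule ideal_pow_subset[where U = "\<lambda>i. supported (newton V (of_nat (n * i)))"])
  show "ideal_pow (monomial_ideal V) n \<subseteq> supported (newton V (of_nat (n * 1)))"
    using ideal_pow_monomial_supported[OF assms, of n] by simp
  show "(supported (newton V (of_nat (n * 0))) :: ('n, 'k) mpoly set) = UNIV"
    by (auto simp: supported_def newton_zero)
  show "f * g \<in> supported (newton V (of_nat (n * Suc i)))"
    if "f \<in> supported (newton V (of_nat (n * i)))" "g \<in> supported (newton V (of_nat (n * 1)))"
    for i and f g :: "('n, 'k) mpoly"
  proof (rule supported_mult[OF that])
    fix a b assume "a \<in> newton V (of_nat (n * i))" "b \<in> newton V (of_nat (n * 1))"
    from newton_add[OF this] show "a + b \<in> newton V (of_nat (n * Suc i))"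
      by (simp add: add.commute distrib_left)
  qed
qed (rule supported_add)

subsection \<open>Integral elements are supported on the Newton polyhedron\<close>

text \<open>
  This weak form of integrality over \<open>I ^ n\<close> is stable under sums, by the binomial theorem, which is
  hard to see for integrality itself.
\<close>

definition asymptotic :: "(nat ^ 'n::finite) set \<Rightarrow> nat \<Rightarrow> ('n, 'k::field) mpoly \<Rightarrow> bool" where
  "asymptotic V n f \<longleftrightarrow> (\<exists>m. \<forall>M. f ^ M \<in> supported (newton V (of_nat (n * (M - m)))))"

lemma newton_nat_anti_mono: "a \<in> newton V (of_nat t) \<Longrightarrow> s \<le> t \<Longrightarrow> a \<in> newton V (of_nat s)"
  by (erule newton_anti_mono) simp_all

lemma supported_newton_mult:
  assumes "f \<in> supported (newton V (of_nat (n * s)))" "g \<in> supported (newton V (of_nat (n * t)))" "r \<le> s + t"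
  shows "f * g \<in> supported (newton V (of_nat (n * r)))"
proof (rule supported_mult[OF assms(1,2)])
  fix a b assume "a \<in> newton V (of_nat (n * s))" "b \<in> newton V (of_nat (n * t))"
  from newton_add[OF this] have "a + b \<in> newton V (of_nat (n * (s + t)))" by (simp add: distrib_left)
  then show "a + b \<in> newton V (of_nat (n * r))" by (rule newton_nat_anti_mono) (use assms(3) in simp)
qed

text \<open>
  The integral equation of degree \<open>m\<close> rewrites \<open>f ^ M\<close> until fewer than \<open>m\<close> factors \<open>f\<close> are left.
\<close>

lemma integral_asymptotic:
  assumes "finite V" and f: "f \<in> integral_closure_ideal type_ring (ideal_pow (monomial_ideal V) n)"
  shows "asymptotic V n f"
proof -
  obtain m c where m: "m \<ge> 1" and c: "\<forall>i\<in>{1..m}. c i \<in> ideal_pow (ideal_pow (monomial_ideal V) n) i"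
    and eq: "f ^ m + (\<Sum>i=1..m. c i * f ^ (m - i)) = 0"
    using f unfolding integral_closure_iff by blast
  have "f ^ M \<in> supported (newton V (of_nat (n * (M - m))))" for M
  proof (induction M rule: less_induct)
    case (less M)
    show ?case
    proof (cases "M < m")
      case True
      then show ?thesis by (auto simp: supported_def newton_zero)
    next
      case False
      have "f ^ M = f ^ (M - m) * f ^ m" using False by (simp flip: power_add)
      also have "f ^ m = - (\<Sum>i=1..m. c i * f ^ (m - i))" using eq by (simp add: eq_neg_iff_add_eq_0)
      also have "f ^ (M - m) * - (\<Sum>i=1..m. c i * f ^ (m - i)) = - (\<Sum>i=1..m. c i * f ^ (M - i))"
      proof -
        have "f ^ (M - m) * (c i * f ^ (m - i)) = c i * f ^ (M - i)" if "i \<in> {1..m}" for i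
        proof -
          have "M - i = (M - m) + (m - i)" using that False by auto
          then show ?thesis by (simp add: power_add algebra_simps)
        qed
        then show ?thesis by (simp add: sum_distrib_left)
      qed
      finally have eqM: "f ^ M = - (\<Sum>i=1..m. c i * f ^ (M - i))" .
      show ?thesis
        unfolding eqM
      proof (intro supported_uminus supported_sum)
        fix i assume i: "i \<in> {1..m}"
        have "c i \<in> supported (newton V (of_nat (n * i)))"
          using c i ideal_pow_pow_supported[OF assms(1), of n i] by blast
        moreover have "f ^ (M - i) \<in> supported (newton V (of_nat (n * (M - i - m))))"
          using i False m by (intro less) auto
        ultimately show "c i * f ^ (M - i) \<in> supported (newton V (of_nat (n * (M - m))))"
          by (rule supported_newton_mult) (use i in auto)
      qed
    qed
  qed
  then show ?thesis unfolding asymptotic_def by blast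
qed

lemma asymptotic_add:
  assumes "asymptotic V n f" "asymptotic V n g" shows "asymptotic V n (f + g)"
proof -
  obtain l where l: "\<And>M. f ^ M \<in> supported (newton V (of_nat (n * (M - l))))"
    using assms(1) unfolding asymptotic_def by blast
  obtain m where m: "\<And>M. g ^ M \<in> supported (newton V (of_nat (n * (M - m))))"
    using assms(2) unfolding asymptotic_def by blast
  have "(f + g) ^ M \<in> supported (newton V (of_nat (n * (M - (l + m)))))" for M
    unfolding binomial_ring
  proof (rule supported_sum)
    fix k assume "k \<in> {..M}"
    then have "f ^ k * g ^ (M - k) \<in> supported (newton V (of_nat (n * (M - (l + m)))))"
      by (intro supported_newton_mult[OF l m]) auto
    from ideal_type_ringD(3)[OF ideal_supported[OF upward_closed_newton] this]
    show "of_nat (M choose k) * f ^ k * g ^ (M - k) \<in> supported (newton V (of_nat (n * (M - (l + m)))))"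
      by (simp add: mult.assoc)
  qed
  then show ?thesis unfolding asymptotic_def by blast
qed

lemma power_single: "single a x ^ M = single (M *s a) (x ^ M)"
  for a :: "nat ^ 'n::finite" and x :: "'k::field"
proof (induction M)
  case (Suc M)
  have "a + M *s a = Suc M *s a" by (simp add: vec_eq_iff)
  then show ?case by (simp add: Suc mult_single)
next
  case 0
  have "0 *s a = 0" by (simp add: vec_eq_iff)
  then show ?case by simp
qed

lemma newton_multiple:
  assumes "a \<in> newton V (of_nat n)" shows "M *s a \<in> newton V (of_nat (n * M))"
proof (induction M)
  case (Suc M)
  have "M *s a + a = Suc M *s a" by (simp add: vec_eq_iff)
  then show ?case using newton_add[OF Suc assms] by (simp add: distrib_left add.commute)
qed (simp add: newton_zero)

lemma asymptotic_single:
  assumes "a \<in> newton V (of_nat n)" shows "asymptotic V n (single a x)"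
  unfolding asymptotic_def power_single
  by (rule exI[of _ 0]) (use newton_multiple[OF assms] in \<open>auto simp: supported_def\<close>)

definition dot :: "nat ^ 'n::finite \<Rightarrow> nat ^ 'n \<Rightarrow> nat" where
  "dot a b = (\<Sum>j\<in>UNIV. a $ j * b $ j)"

lemma dot_add: "dot a (b + c) = dot a b + dot a c"
  by (simp add: dot_def distrib_left sum.distrib)

lemma dot_less:
  assumes "dot b b \<le> dot a a" "a \<noteq> b" shows "dot a b < dot a a"
proof -
  obtain j where j: "a $ j \<noteq> b $ j" using assms(2) by (auto simp: vec_eq_iff)
  have "0 < (\<Sum>j\<in>UNIV. (int (a $ j) - int (b $ j))\<^sup>2)"
    by (rule sum_pos2[of _ j]) (use j in auto)
  also have "\<dots> = (\<Sum>j\<in>UNIV. int (a $ j * a $ j) + int (b $ j * b $ j) - 2 * int (a $ j * b $ j))"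
    by (intro sum.cong refl) (simp add: power2_eq_square algebra_simps)
  also have "\<dots> = int (dot a a) + int (dot b b) - 2 * int (dot a b)"
    by (simp add: dot_def sum.distrib sum_subtractf sum_distrib_left)
  finally show ?thesis using assms(1) by linarith
qed

text \<open>
  An exponent of maximal Euclidean norm is a vertex of the Newton polytope of \<open>f\<close>, exposed by the
  linear form that it defines itself; so its multiples survive in the powers of \<open>f\<close>.
\<close>

lemma exposed_key:
  assumes "f \<noteq> (0 :: ('n::finite, 'k::field) mpoly)"
  shows "\<exists>a\<in>keys f. \<forall>b\<in>keys f. b \<noteq> a \<longrightarrow> dot a b < dot a a"
proof -
  define N where "N = (\<lambda>b. dot b b) ` keys f"
  have N: "finite N" "N \<noteq> {}" using assms by (simp_all add: N_def keys_eq_empty)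
  obtain a where a: "a \<in> keys f" "Max N = dot a a"
    using Max_in[OF N] by (auto simp: N_def)
  have "dot b b \<le> dot a a" if "b \<in> keys f" for b
    unfolding a(2)[symmetric] using that by (intro Max_ge N) (simp add: N_def)
  then show ?thesis using a(1) dot_less by blast
qed

lemma keys_minus_single:
  "keys (f - single a (lookup f a)) = keys f - {a}"
  by (auto simp: in_keys_iff lookup_minus lookup_single when_def split: if_splits)

lemma power_exposed_key:
  fixes f :: "('n::finite, 'k::field) mpoly"
  assumes "a \<in> keys f" "\<And>b. b \<in> keys f \<Longrightarrow> b \<noteq> a \<Longrightarrow> dot a b < dot a a"
  shows "M *s a \<in> keys (f ^ M)"
proof -
  define L where "L = (\<lambda>u. {b. dot a b < dot a u})"
  define s where "s = single a (lookup f a)"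
  define r where "r = f - s"
  have r: "r \<in> supported (L a)"
    using assms(2) keys_minus_single[of f a] by (auto simp: supported_def L_def r_def s_def)
  have f: "f = s + r" by (simp add: r_def)
  have "\<exists>h. f ^ M = s ^ M + h \<and> h \<in> supported (L (M *s a))"
  proof (induction M)
    case 0
    show ?case by (intro exI[of _ 0]) (simp add: supported_zero)
  next
    case (Suc M)
    then obtain h where h: "f ^ M = s ^ M + h" "h \<in> supported (L (M *s a))" by blast
    have SM: "Suc M *s a = M *s a + a" by (simp add: vec_eq_iff)
    have sM: "s ^ M \<in> supported {M *s a}" unfolding s_def power_single by (simp add: supported_def)
    have s1: "s \<in> supported {a}" by (simp add: supported_def s_def)
    have "s ^ M * r \<in> supported (L (Suc M *s a))"
      by (rule supported_mult[OF sM r]) (simp add: L_def SM dot_add)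
    moreover have "h * s \<in> supported (L (Suc M *s a))"
      by (rule supported_mult[OF h(2) s1]) (simp add: L_def SM dot_add)
    moreover have "h * r \<in> supported (L (Suc M *s a))"
      by (rule supported_mult[OF h(2) r]) (simp add: L_def SM dot_add)
    ultimately have "s ^ M * r + h * s + h * r \<in> supported (L (Suc M *s a))"
      by (intro supported_add)
    moreover have "f ^ Suc M = f ^ M * (s + r)" unfolding f[symmetric] by (rule power_Suc2)
    then have "f ^ Suc M = s ^ Suc M + (s ^ M * r + h * s + h * r)"
      unfolding h(1) by (simp add: algebra_simps)
    ultimately show ?case by blast
  qed
  then obtain h where h: "f ^ M = s ^ M + h" "h \<in> supported (L (M *s a))" by blast
  have "M *s a \<notin> keys h" using h(2) by (auto simp: supported_def L_def)
  then have "lookup (f ^ M) (M *s a) = lookup f a ^ M"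
    by (simp add: h(1) lookup_add s_def power_single in_keys_iff)
  then show ?thesis using assms(1) by (simp add: in_keys_iff)
qed

text \<open>
  The exposed exponent lies in the polyhedron because its multiples occur in the powers of \<open>f\<close>, and
  after its term has been subtracted the remaining polynomial is still asymptotic.
\<close>

lemma asymptotic_supported:
  fixes f :: "('n::finite, 'k::field) mpoly"
  assumes "finite V"
  shows "asymptotic V n f \<Longrightarrow> f \<in> supported (newton V (of_nat n))"
proof (induction "card (keys f)" arbitrary: f rule: less_induct)
  case less
  show ?case
  proof (cases "f = 0")
    case False
    from exposed_key[OF this] obtain a where a: "a \<in> keys f"
      "\<And>b. b \<in> keys f \<Longrightarrow> b \<noteq> a \<Longrightarrow> dot a b < dot a a" by blast
    obtain m where m: "\<And>M. f ^ M \<in> supported (newton V (of_nat (n * (M - m))))"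
      using less.prems unfolding asymptotic_def by blast
    have aN: "a \<in> newton V (of_nat n)"
    proof (rule newton_closed[OF assms])
      show "M *s a \<in> newton V (of_nat (n * (M - m)))" for M
        using m[of M] power_exposed_key[OF a, of M] by (auto simp: supported_def)
    qed
    define g where "g = f + single a (- lookup f a)"
    have g: "g = f - single a (lookup f a)"
      by (simp add: g_def single_uminus)
    have kg: "keys g = keys f - {a}" unfolding g by (rule keys_minus_single)
    have "card (keys g) < card (keys f)"
      unfolding kg using a(1) by (intro card_Diff1_less) simp_all
    moreover have "asymptotic V n g" unfolding g_def
      by (rule asymptotic_add[OF less.prems asymptotic_single[OF aN]])
    ultimately have "g \<in> supported (newton V (of_nat n))" by (rule less.hyps)
    then show ?thesis using aN kg by (auto simp: supported_def)
  qed (simp add: supported_zero)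
qed

subsection \<open>Elements supported on the Newton polyhedron are integral\<close>

lemma smaller_weights:
  fixes k :: "'v \<Rightarrow> nat"
  assumes "finite V" "n \<le> sum k V"
  shows "\<exists>l. (\<forall>v. l v \<le> k v) \<and> sum l V = n"
  using assms
proof (induction arbitrary: n rule: finite_induct)
  case empty
  then show ?case by (intro exI[of _ "\<lambda>_. 0"]) simp
next
  case (insert v V)
  define m where "m = min n (k v)"
  have "n - m \<le> sum k V" using insert.prems insert.hyps by (auto simp: m_def)
  from insert.IH[OF this] obtain l where l: "\<forall>v. l v \<le> k v" "sum l V = n - m" by blast
  have "sum (l(v := m)) V = sum l V" using insert.hyps by (intro sum.cong) auto
  then have "sum (l(v := m)) (insert v V) = n" using insert.hyps l(2) by (simp add: m_def)
  moreover have "\<forall>u. (l(v := m)) u \<le> k u" using l(1) by (simp add: m_def)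
  ultimately show ?case by blast
qed

lemma newton_combination:
  assumes "finite V" shows "(\<Sum>v\<in>V. k v *s v) \<in> newton V (of_nat (sum k V))"
  by (rule newtonI[where c = "\<lambda>v. of_nat (k v)"]) simp_all

text \<open>
  No weight exceeds the total \<open>N\<close>, so coordinates of \<open>b\<close> beyond this bound are never used. This is why
  finitely many monomials generate the module below.
\<close>

lemma newton_truncate:
  assumes "finite V" "b \<in> newton V (of_nat N)"
  shows "(\<chi> j. min (b $ j) (\<Sum>v\<in>V. N * v $ j)) \<in> newton V (of_nat N)"
proof -
  obtain c where c: "\<And>v. v \<in> V \<Longrightarrow> 0 \<le> c v" "sum c V = of_nat N"
    "\<And>j. (\<Sum>v\<in>V. c v * of_nat (v $ j)) \<le> (of_nat (b $ j) :: rat)" using assms(2) by (rule newtonE) blast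
  show ?thesis
  proof (rule newtonI[OF c(1,2)])
    fix j
    have "c v \<le> of_nat N" if "v \<in> V" for v
      unfolding c(2)[symmetric] using that c(1) assms(1) by (intro member_le_sum) auto
    then have "(\<Sum>v\<in>V. c v * of_nat (v $ j)) \<le> (\<Sum>v\<in>V. of_nat N * of_nat (v $ j))"
      by (intro sum_mono mult_right_mono) simp_all
    then show "(\<Sum>v\<in>V. c v * of_nat (v $ j)) \<le> of_nat ((\<chi> j. min (b $ j) (\<Sum>v\<in>V. N * v $ j)) $ j)"
      using c(3)[of j] by (simp add: min_def)
  qed
qed

text \<open>
  The integer parts of the weights of \<open>a + b\<close> still have a sum of at least \<open>n\<close>, as \<open>b\<close> contributes a
  reserve of weight \<open>card V\<close>, which the fractional parts cannot exceed.
\<close>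

lemma split_off_power:
  assumes "finite V" and a: "a \<in> newton V (of_nat n)" and b: "b \<in> newton V (of_nat (card V))"
  shows "\<exists>l g b'. sum l V = n \<and> a + b = (\<Sum>v\<in>V. l v *s v) + g + b' \<and>
    b' \<in> newton V (of_nat (card V)) \<and> (\<forall>j. b' $ j \<le> (\<Sum>v\<in>V. card V * v $ j))"
proof -
  define N where "N = card V"
  have "a + b \<in> newton V (of_nat (n + N))" using newton_add[OF a b] by (simp add: N_def)
  then obtain k r where k: "a + b = (\<Sum>v\<in>V. k v *s v) + r"
    "of_nat (sum k V) \<le> (of_nat (n + N) :: rat)" "of_nat (n + N) \<le> (of_nat (sum k V) + of_nat (card V) :: rat)"
    "r \<in> newton V (of_nat (n + N) - of_nat (sum k V))"
    by (rule newton_integer_part[OF assms(1)])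
  have k1: "sum k V \<le> n + N" using k(2) by (simp only: of_nat_le_iff)
  have "n + N \<le> sum k V + N" using k(3) by (simp only: N_def of_nat_add[symmetric] of_nat_le_iff)
  then have "n \<le> sum k V" by simp
  from smaller_weights[OF assms(1) this] obtain l where l: "\<forall>v. l v \<le> k v" "sum l V = n" by blast
  define q where "q = (\<Sum>v\<in>V. (k v - l v) *s v) + r"
  have eq: "(\<Sum>v\<in>V. k v *s v) = (\<Sum>v\<in>V. l v *s v) + (\<Sum>v\<in>V. (k v - l v) *s v)"
    unfolding sum.distrib[symmetric]
    by (intro sum.cong refl) (use l(1) in \<open>simp add: vec_eq_iff flip: distrib_right\<close>)
  have sd: "(\<Sum>v\<in>V. k v - l v) = sum k V - n"
    using sum_subtractf_nat[of V l k] l by simp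
  have "q \<in> newton V (of_nat (sum k V - n) + (of_nat (n + N) - of_nat (sum k V)))"
    unfolding q_def by (rule newton_add[OF _ k(4)]) (use newton_combination[OF assms(1), of "\<lambda>v. k v - l v"] sd in simp)
  then have q: "q \<in> newton V (of_nat N)" using \<open>n \<le> sum k V\<close> by (simp add: of_nat_diff)
  define b' where "b' = (\<chi> j. min (q $ j) (\<Sum>v\<in>V. N * v $ j))"
  define g where "g = (\<chi> j. q $ j - b' $ j)"
  have "q = g + b'" by (simp add: vec_eq_iff g_def b'_def)
  then have "a + b = (\<Sum>v\<in>V. l v *s v) + g + b'" unfolding k(1) eq by (simp add: q_def add.assoc)
  moreover have "b' \<in> newton V (of_nat N)" unfolding b'_def by (rule newton_truncate[OF assms(1) q])
  moreover have "\<forall>j. b' $ j \<le> (\<Sum>v\<in>V. N * v $ j)" by (simp add: b'_def)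
  ultimately show ?thesis using l(2) unfolding N_def by blast
qed

text \<open>
  The monomials in the dilate by \<open>card V\<close> span a module \<open>N\<close> with \<open>f N \<subseteq> I ^ n N\<close>, and this
  module is generated by the monomials with bounded exponents.
\<close>

lemma supported_integral:
  fixes f :: "('n::finite, 'k::field) mpoly"
  assumes "finite V" and f: "f \<in> supported (newton V (of_nat n))"
  shows "f \<in> integral_closure_ideal type_ring (ideal_pow (monomial_ideal V) n)"
proof -
  define J :: "('n, 'k) mpoly set" where "J = ideal_pow (monomial_ideal V) n"
  have J: "ideal J type_ring" unfolding J_def by (rule ideal_ideal_pow[OF ideal_monomial_ideal])
  define B where "B = {b \<in> newton V (of_nat (card V)). \<forall>j. b $ j \<le> (\<Sum>v\<in>V. card V * v $ j)}"
  have "finite B"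
    unfolding B_def
    by (rule finite_subset[OF _ finite_bounded_vectors[of "\<lambda>j. \<Sum>v\<in>V. card V * v $ j"]]) blast
  have "B \<noteq> {}"
  proof -
    have "(\<Sum>v\<in>V. 1 *s v) \<in> newton V (of_nat (card V))"
      using newton_combination[OF assms(1), of "\<lambda>_. 1"] by simp
    from newton_truncate[OF assms(1) this] have
      "(\<chi> j. min ((\<Sum>v\<in>V. 1 *s v) $ j) (\<Sum>v\<in>V. card V * v $ j)) \<in> B" unfolding B_def by simp
    then show ?thesis by blast
  qed
  define Q where "Q = (\<lambda>a b (h, b'). b' \<in> B \<and> a + b = h + b' \<and> monomial h \<in> J)"
  have ex: "\<exists>x. Q a b x" if ab: "a \<in> newton V (of_nat n)" "b \<in> B" for a b
  proof -
    obtain l g b' where l: "sum l V = n" "a + b = (\<Sum>v\<in>V. l v *s v) + g + b'"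
      "b' \<in> newton V (of_nat (card V))" "\<forall>j. b' $ j \<le> (\<Sum>v\<in>V. card V * v $ j)"
      using split_off_power[OF assms(1) ab(1), of b] ab(2) unfolding B_def by blast
    have "monomial g * monomial (\<Sum>v\<in>V. l v *s v) \<in> J"
      unfolding J_def l(1)[symmetric]
      by (rule ideal_type_ringD(3)[OF ideal_ideal_pow[OF ideal_monomial_ideal] monomial_power_in_ideal_pow[OF assms(1)]])
    then have "monomial ((\<Sum>v\<in>V. l v *s v) + g) \<in> J" by (simp add: monomial_add mult.commute)
    then have "Q a b ((\<Sum>v\<in>V. l v *s v) + g, b')" using l(2,3,4) by (simp add: Q_def B_def)
    then show ?thesis by blast
  qed
  have choice: "Q a b (SOME x. Q a b x)" if "a \<in> newton V (of_nat n)" "b \<in> B" for a b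
    by (rule someI_ex[OF ex[OF that]])
  define h where "h = (\<lambda>a b. fst (SOME x. Q a b x))"
  define t where "t = (\<lambda>a b. snd (SOME x. Q a b x))"
  have ht: "t a b \<in> B" "a + b = h a b + t a b" "monomial (h a b) \<in> J"
    if "a \<in> newton V (of_nat n)" "b \<in> B" for a b
    using choice[OF that] by (simp_all add: h_def t_def Q_def split_beta)
  have keys: "a \<in> newton V (of_nat n)" if "a \<in> keys f" for a
    using f that by (auto simp: supported_def)
  define M where "M = (\<lambda>b b'. \<Sum>a\<in>keys f.
    if t a b = b' then single (h a b) (lookup f a) else 0)"
  have single: "single u x = single 0 x * monomial u"
    for u :: "nat ^ 'n" and x :: 'k by (simp add: monomial_def mult_single)
  show ?thesis
    unfolding J_def[symmetric]
  proof (rule integral_of_finite_system[OF J \<open>finite B\<close> \<open>B \<noteq> {}\<close>, where M = M and b = monomial])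
    show "M b b' \<in> J" if "b \<in> B" "b' \<in> B" for b b'
      unfolding M_def
    proof (rule ideal_type_ring_sum[OF J])
      fix a assume "a \<in> keys f"
      then have "single (h a b) (lookup f a) \<in> J"
        unfolding single[of "h a b"] using ideal_type_ringD(3)[OF J ht(3)[OF keys that(1)]] by blast
      then show "(if t a b = b' then single (h a b) (lookup f a) else 0) \<in> J"
        using ideal_type_ringD(1)[OF J] by simp
    qed
    show "x = 0" if "b \<in> B" "x * monomial b = 0" for b and x :: "('n, 'k) mpoly"
      using that(2) by (rule monomial_mult_eq_0)
    show "f * monomial b = (\<Sum>b'\<in>B. M b b' * monomial b')" if "b \<in> B" for b
    proof -
      have "(\<Sum>b'\<in>B. M b b' * monomial b') = (\<Sum>b'\<in>B. \<Sum>a\<in>keys f.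
          if t a b = b' then single (h a b) (lookup f a) * monomial b' else 0)"
        unfolding M_def sum_distrib_right by (intro sum.cong refl) simp
      also have "\<dots> = (\<Sum>a\<in>keys f. \<Sum>b'\<in>B.
          if t a b = b' then single (h a b) (lookup f a) * monomial b' else 0)"
        by (rule sum.swap)
      also have "\<dots> = (\<Sum>a\<in>keys f. single a (lookup f a) * monomial b)"
      proof (intro sum.cong refl)
        fix a assume a: "a \<in> keys f"
        have "(\<Sum>b'\<in>B. if t a b = b' then single (h a b) (lookup f a) * monomial b' else 0) =
            single (h a b) (lookup f a) * monomial (t a b)"
          using \<open>finite B\<close> ht(1)[OF keys[OF a] that] by simp
        also have "\<dots> = single a (lookup f a) * monomial b"
          using ht(2)[OF keys[OF a] that] by (simp add: monomial_def mult_single)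
        finally show "(\<Sum>b'\<in>B. if t a b = b' then single (h a b) (lookup f a) * monomial b' else 0) =
          single a (lookup f a) * monomial b" .
      qed
      also have "\<dots> = f * monomial b"
        unfolding sum_distrib_right[symmetric] poly_mapping_sum_single[of f, symmetric] ..
      finally show ?thesis ..
    qed
  qed
qed

theorem integral_closure_monomial_ideal_pow:
  fixes V :: "(nat ^ 'n::finite) set"
  assumes "finite V"
  shows "integral_closure_ideal type_ring (ideal_pow (monomial_ideal V :: ('n, 'k::field) mpoly set) n) =
    supported (newton V (of_nat n))"
  using asymptotic_supported[OF assms integral_asymptotic[OF assms]] supported_integral[OF assms] by blast

section \<open>The length of a quotient by a monomial ideal\<close>

context
  fixes J :: "'a::comm_ring_1 set"
  assumes J: "ideal J type_ring"
begin

definition coset :: "'a \<Rightarrow> 'a set" where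
  "coset f = J +>\<^bsub>type_ring\<^esub> f"

abbreviation QM :: "('a, 'a set) module" where
  "QM \<equiv> quotient_module type_ring J"

lemma quotient_module_simps:
  "carrier QM = carrier (type_ring Quot J)" "zero QM = zero (type_ring Quot J)"
  "add QM = add (type_ring Quot J)"
  "module.smult QM = (\<lambda>r A. (J +>\<^bsub>type_ring\<^esub> r) \<otimes>\<^bsub>type_ring Quot J\<^esub> A)"
  by (simp_all add: quotient_module_def ring.defs module.defs)

lemma coset_hom: "ring_hom_ring type_ring (type_ring Quot J) coset"
  using ideal.rcos_ring_hom_ring[OF J] by (simp add: coset_def[abs_def])

lemma carrier_quotient: "carrier (type_ring Quot J) = range coset"
  by (auto simp: FactRing_def A_RCOSETS_def' coset_def)

lemma coset_add: "coset f \<oplus>\<^bsub>QM\<^esub> coset g = coset (f + g)"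
proof -
  interpret h: ring_hom_ring type_ring "type_ring Quot J" coset by (rule coset_hom)
  show ?thesis using h.hom_add[of f g] by (simp add: quotient_module_simps)
qed

lemma coset_smult: "r \<odot>\<^bsub>QM\<^esub> coset f = coset (r * f)"
proof -
  interpret h: ring_hom_ring type_ring "type_ring Quot J" coset by (rule coset_hom)
  show ?thesis using h.hom_mult[of r f] by (simp add: quotient_module_simps coset_def)
qed

lemma coset_zero: "coset 0 = \<zero>\<^bsub>QM\<^esub>"
proof -
  interpret h: ring_hom_ring type_ring "type_ring Quot J" coset by (rule coset_hom)
  show ?thesis using h.hom_zero by (simp add: quotient_module_simps)
qed

lemma coset_minus: "inv\<^bsub>add_monoid QM\<^esub> (coset f) = coset (- f)"
proof -
  interpret h: ring_hom_ring type_ring "type_ring Quot J" coset by (rule coset_hom)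
  have "inv\<^bsub>add_monoid QM\<^esub> (coset f) = \<ominus>\<^bsub>type_ring Quot J\<^esub> (coset f)"
    by (simp add: a_inv_def m_inv_def quotient_module_simps)
  then show ?thesis using h.hom_a_inv[of f] by simp
qed

lemma coset_eq_iff: "coset f = coset g \<longleftrightarrow> f - g \<in> J"
proof -
  interpret R: cring "type_ring :: 'a ring" by (rule cring_type_ring)
  have "coset f = coset g \<longleftrightarrow> f \<ominus>\<^bsub>type_ring\<^esub> g \<in> J"
    unfolding coset_def by (rule R.quotient_eq_iff_same_a_r_cos[OF J, symmetric]) simp_all
  then show ?thesis by (simp add: a_minus_def)
qed

lemma submodule_cosets:
  assumes K: "ideal K type_ring"
  shows "submodule (coset ` K) type_ring QM"
proof (intro submodule.intro submodule_axioms.intro)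
  show "subgroup (coset ` K) (add_monoid QM)"
  proof (rule subgroup.intro)
    show "coset ` K \<subseteq> carrier (add_monoid QM)" by (auto simp: quotient_module_simps carrier_quotient)
    show "x \<otimes>\<^bsub>add_monoid QM\<^esub> y \<in> coset ` K" if "x \<in> coset ` K" "y \<in> coset ` K" for x y
      using that ideal_type_ringD(2)[OF K] coset_add by auto
    show "\<one>\<^bsub>add_monoid QM\<^esub> \<in> coset ` K"
      using ideal_type_ringD(1)[OF K] by (auto simp: coset_zero[symmetric])
    show "inv\<^bsub>add_monoid QM\<^esub> x \<in> coset ` K" if "x \<in> coset ` K" for x
      using that ideal_type_ringD(4)[OF K] coset_minus by auto
  qed
  show "r \<odot>\<^bsub>QM\<^esub> x \<in> coset ` K" if "r \<in> carrier type_ring" "x \<in> coset ` K" for r x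
    using that(2) ideal_type_ringD(3)[OF K] coset_smult by auto
qed

definition preimage :: "'a set set \<Rightarrow> 'a set" where
  "preimage N = {f. coset f \<in> N}"

lemma ideal_preimage:
  assumes N: "submodule N type_ring QM"
  shows "ideal (preimage N) type_ring" "J \<subseteq> preimage N" "N = coset ` preimage N"
proof -
  interpret N: submodule N type_ring QM by (rule N)
  have zero: "coset 0 \<in> N" using N.one_closed by (simp add: coset_zero)
  show "ideal (preimage N) type_ring"
  proof (rule ideal_type_ringI)
    show "0 \<in> preimage N" using zero by (simp add: preimage_def)
    show "f + g \<in> preimage N" if "f \<in> preimage N" "g \<in> preimage N" for f g
      using that N.m_closed[of "coset f" "coset g"] by (simp add: preimage_def coset_add)
    show "r * f \<in> preimage N" if "f \<in> preimage N" for f r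
      using that N.smult_closed[of r "coset f"] by (simp add: preimage_def coset_smult)
  qed
  show "J \<subseteq> preimage N"
  proof
    fix f assume "f \<in> J"
    then have "coset f = coset 0" by (simp add: coset_eq_iff)
    then show "f \<in> preimage N" using zero by (simp add: preimage_def)
  qed
  have "N \<subseteq> range coset" using N.subset by (simp add: quotient_module_simps carrier_quotient)
  then show "N = coset ` preimage N" by (auto simp: preimage_def)
qed

text \<open>
  Chains of submodules of \<open>R/J\<close> correspond to chains of ideals that contain \<open>J\<close>.
\<close>

lemma module_length_quotient:
  assumes upper: "\<And>n K. (\<And>i. i \<le> n \<Longrightarrow> ideal (K i) type_ring \<and> J \<subseteq> K i) \<Longrightarrow>
      (\<And>i. i < n \<Longrightarrow> K i \<subset> K (Suc i)) \<Longrightarrow> n \<le> m"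
    and K: "\<And>i. i \<le> m \<Longrightarrow> ideal (K i) type_ring \<and> J \<subseteq> K i" "\<And>i. i < m \<Longrightarrow> K i \<subset> K (Suc i)"
  shows "module_length type_ring QM = enat m"
  unfolding module_length_def
proof (rule antisym)
  show "(SUP n\<in>{n. \<exists>N. (\<forall>i\<le>n. submodule (N i) type_ring QM) \<and> (\<forall>i<n. N i \<subset> N (Suc i))}. enat n) \<le> enat m"
  proof (rule SUP_least)
    fix n assume "n \<in> {n. \<exists>N. (\<forall>i\<le>n. submodule (N i) type_ring QM) \<and> (\<forall>i<n. N i \<subset> N (Suc i))}"
    then obtain N where N: "\<And>i. i \<le> n \<Longrightarrow> submodule (N i) type_ring QM" "\<And>i. i < n \<Longrightarrow> N i \<subset> N (Suc i)"
      by blast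
    have "n \<le> m"
    proof (rule upper)
      show "ideal (preimage (N i)) type_ring \<and> J \<subseteq> preimage (N i)" if "i \<le> n" for i
        using ideal_preimage(1,2)[OF N(1)[OF that]] by blast
      show "preimage (N i) \<subset> preimage (N (Suc i))" if "i < n" for i
      proof
        show "preimage (N i) \<subseteq> preimage (N (Suc i))" using N(2)[OF that] by (auto simp: preimage_def)
        show "preimage (N i) \<noteq> preimage (N (Suc i))"
          using ideal_preimage(3)[OF N(1), of i] ideal_preimage(3)[OF N(1), of "Suc i"] N(2)[OF that] that
          by auto
      qed
    qed
    then show "enat n \<le> enat m" by simp
  qed
  have "m \<in> {n. \<exists>N. (\<forall>i\<le>n. submodule (N i) type_ring QM) \<and> (\<forall>i<n. N i \<subset> N (Suc i))}"
  proof (intro CollectI exI[of _ "\<lambda>i. coset ` K i"] conjI allI impI)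
    show "submodule (coset ` K i) type_ring QM" if "i \<le> m" for i
      using K(1)[OF that] by (intro submodule_cosets) blast
    show "coset ` K i \<subset> coset ` K (Suc i)" if i: "i < m" for i
    proof
      show "coset ` K i \<subseteq> coset ` K (Suc i)" using K(2)[OF i] by blast
      obtain f where f: "f \<in> K (Suc i)" "f \<notin> K i" using K(2)[OF i] by blast
      have "coset f \<notin> coset ` K i"
      proof
        assume "coset f \<in> coset ` K i"
        then obtain g where g: "g \<in> K i" "f - g \<in> J" by (auto simp: coset_eq_iff)
        have id: "ideal (K i) type_ring" "J \<subseteq> K i" using K(1)[of i] i by simp_all
        have "(f - g) + g \<in> K i" using g id by (intro ideal_type_ringD(2)[OF id(1)]) auto
        then show False using f(2) by simp
      qed
      then show "coset ` K i \<noteq> coset ` K (Suc i)" using f(1) by blast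
    qed
  qed
  then show "enat m \<le> (SUP n\<in>{n. \<exists>N. (\<forall>i\<le>n. submodule (N i) type_ring QM) \<and> (\<forall>i<n. N i \<subset> N (Suc i))}. enat n)"
    by (rule SUP_upper)
qed

end

lemma lookup_scale: "lookup (single 0 x * g) c = x * lookup g c"
  for g :: "('n::finite, 'k::field) mpoly"
  by (simp add: mult_map_scale_conv_mult[symmetric] map.rep_eq when_def)

text \<open>
  The positions in \<open>C\<close> at which some element of \<open>K\<close> has its last nonzero coefficient, in the order
  given by \<open>h\<close>. By Gaussian elimination they distinguish nested ideals that contain all polynomials
  supported outside \<open>C\<close>.
\<close>

definition pivots :: "('b \<Rightarrow> nat) \<Rightarrow> 'b set \<Rightarrow> ('b \<Rightarrow>\<^sub>0 'k::zero) set \<Rightarrow> 'b set" where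
  "pivots h C K = {c \<in> C. \<exists>f\<in>K. lookup f c \<noteq> 0 \<and>
    (\<forall>c'\<in>C. h c < h c' \<longrightarrow> lookup f c' = 0)}"

lemma pivots_determine:
  fixes K K' :: "('n::finite, 'k::field) mpoly set"
  assumes K: "ideal K type_ring" "supported (- C) \<subseteq> K" and K': "ideal K' type_ring" "K \<subseteq> K'"
    and h: "inj_on h C" "\<And>c. c \<in> C \<Longrightarrow> h c < m" and eq: "pivots h C K = pivots h C K'"
  shows "K' \<subseteq> K"
proof -
  have main: "f \<in> K" if "f \<in> K'" "\<forall>c\<in>C. k \<le> h c \<longrightarrow> lookup f c = 0" for k f
    using that
  proof (induction k arbitrary: f)
    case 0
    then have "f \<in> supported (- C)" by (auto simp: supported_def in_keys_iff)
    then show ?case using K(2) by blast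
  next
    case (Suc k)
    show ?case
    proof (cases "\<exists>c\<in>C. h c = k \<and> lookup f c \<noteq> 0")
      case False
      then have "\<forall>c\<in>C. k \<le> h c \<longrightarrow> lookup f c = 0"
        using Suc.prems(2) by (metis Suc_leI le_neq_implies_less)
      then show ?thesis using Suc.IH Suc.prems(1) by blast
    next
      case True
      then obtain c where c: "c \<in> C" "h c = k" "lookup f c \<noteq> 0" by blast
      have "c \<in> pivots h C K'" unfolding pivots_def using c Suc.prems by (auto simp: Suc_le_eq)
      then have "c \<in> pivots h C K" using eq by simp
      then obtain g where g: "g \<in> K" "lookup g c \<noteq> 0"
        "\<forall>c'\<in>C. h c < h c' \<longrightarrow> lookup g c' = 0" by (auto simp: pivots_def)
      define s :: "('n, 'k) mpoly" where
        "s = single 0 (lookup f c / lookup g c) * g"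
      have sK: "s \<in> K" unfolding s_def by (rule ideal_type_ringD(3)[OF K(1) g(1)])
      have ls: "lookup s x = lookup f c / lookup g c * lookup g x" for x
        unfolding s_def by (rule lookup_scale)
      have "f + - s \<in> K"
      proof (rule Suc.IH)
        show "f + - s \<in> K'"
          using Suc.prems(1) sK K'(2) ideal_type_ringD(4)[OF K(1) sK] by (intro ideal_type_ringD(2)[OF K'(1)]) auto
        show "\<forall>c'\<in>C. k \<le> h c' \<longrightarrow> lookup (f + - s) c' = 0"
        proof (intro ballI impI)
          fix c' assume c': "c' \<in> C" "k \<le> h c'"
          show "lookup (f + - s) c' = 0"
          proof (cases "c' = c")
            case True
            then show ?thesis using g(2) by (simp add: lookup_minus ls)
          next
            case False
            then have "h c' \<noteq> k" using h(1) c' c by (auto simp: inj_on_def)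
            then have "k < h c'" using c'(2) by simp
            then show ?thesis using Suc.prems(2) g(3) c c' by (simp add: lookup_minus ls Suc_le_eq)
          qed
        qed
      qed
      from ideal_type_ringD(2)[OF K(1) this sK] show ?thesis by simp
    qed
  qed
  show ?thesis
  proof
    fix f assume "f \<in> K'"
    then show "f \<in> K" by (rule main[of f m]) (use h(2) in force)
  qed
qed

lemma chain_length_le:
  fixes K :: "nat \<Rightarrow> ('n::finite, 'k::field) mpoly set"
  assumes "finite C" and K: "\<And>i. i \<le> n \<Longrightarrow> ideal (K i) type_ring \<and> supported (- C) \<subseteq> K i"
    and lt: "\<And>i. i < n \<Longrightarrow> K i \<subset> K (Suc i)"
  shows "n \<le> card C"
proof -
  obtain h where h: "bij_betw h C {0..<card C}" using ex_bij_betw_finite_nat[OF assms(1)] by blast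
  have h': "inj_on h C" "\<And>c. c \<in> C \<Longrightarrow> h c < card C" using h by (auto simp: bij_betw_def)
  have fin: "finite (pivots h C S)" for S :: "('n, 'k) mpoly set" using assms(1) by (simp add: pivots_def)
  have "i \<le> card (pivots h C (K i))" if "i \<le> n" for i
    using that
  proof (induction i)
    case (Suc i)
    have "pivots h C (K i) \<subseteq> pivots h C (K (Suc i))"
    proof -
      have "K i \<subseteq> K (Suc i)" using lt[of i] Suc.prems by auto
      then show ?thesis unfolding pivots_def by blast
    qed
    moreover have "pivots h C (K i) \<noteq> pivots h C (K (Suc i))"
    proof
      assume eq: "pivots h C (K i) = pivots h C (K (Suc i))"
      have "K (Suc i) \<subseteq> K i"
        by (rule pivots_determine[OF _ _ _ _ h' eq]) (use K[of i] K[of "Suc i"] lt[of i] Suc.prems in auto)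
      then show False using lt[of i] Suc.prems by auto
    qed
    ultimately have "card (pivots h C (K i)) < card (pivots h C (K (Suc i)))"
      by (intro psubset_card_mono fin) blast
    then show ?case using Suc by simp
  qed simp
  from this[of n] have "n \<le> card (pivots h C (K n))" by simp
  also have "\<dots> \<le> card C" using assms(1) by (intro card_mono) (auto simp: pivots_def)
  finally show ?thesis .
qed

text \<open>
  Adding a missing exponent of maximal degree keeps the set closed under multiplication by monomials.
\<close>

lemma upward_closed_chain:
  fixes U :: "(nat ^ 'n::finite) set"
  assumes "finite (- U)" "upward_closed U"
  shows "\<exists>W. (\<forall>i\<le>card (- U). upward_closed (W i) \<and> U \<subseteq> W i) \<and> (\<forall>i<card (- U). W i \<subset> W (Suc i))"
  using assms
proof (induction "card (- U)" arbitrary: U)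
  case 0
  then show ?case by (intro exI[of _ "\<lambda>_. U"]) simp
next
  case (Suc m)
  define deg where "deg = (\<lambda>a :: nat ^ 'n. \<Sum>j\<in>UNIV. a $ j)"
  have ne: "deg ` (- U) \<noteq> {}" "finite (deg ` (- U))" using Suc.hyps(2) Suc.prems(1) by auto
  obtain a where a: "a \<in> - U" "deg a = Max (deg ` (- U))" using Max_in[OF ne(2,1)] by auto
  have max: "deg b \<le> deg a" if "b \<in> - U" for b
    unfolding a(2) using that ne(2) by (intro Max_ge) auto
  have up: "upward_closed (insert a U)"
    unfolding upward_closed_def
  proof (intro ballI allI)
    fix c b assume c: "c \<in> insert a U"
    show "c + b \<in> insert a U"
    proof (cases "c \<in> U")
      case True
      then show ?thesis using Suc.prems(2) by (simp add: upward_closed_def)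
    next
      case False
      then have ca: "c = a" using c by simp
      show ?thesis
      proof (cases "b = 0")
        case False
        then obtain j where "b $ j \<noteq> 0" by (auto simp: vec_eq_iff)
        then have "0 < deg b" unfolding deg_def by (intro sum_pos2[of _ j]) simp_all
        then have "deg a < deg (a + b)" by (simp add: deg_def sum.distrib)
        then have "a + b \<in> U" using max[of "a + b"] by fastforce
        then show ?thesis by (simp add: ca)
      qed (simp add: ca)
    qed
  qed
  have compl: "- insert a U = - U - {a}" by blast
  have card: "m = card (- insert a U)" using Suc.hyps(2) Suc.prems(1) a(1) unfolding compl by simp
  have "finite (- insert a U)" using Suc.prems(1) unfolding compl by simp
  from Suc.hyps(1)[OF card this up] obtain W where
    W: "\<forall>i\<le>m. upward_closed (W i) \<and> insert a U \<subseteq> W i" "\<forall>i<m. W i \<subset> W (Suc i)"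
    unfolding card[symmetric] by blast
  define W' where "W' = (\<lambda>i. case i of 0 \<Rightarrow> U | Suc i \<Rightarrow> W i)"
  have "upward_closed (W' i) \<and> U \<subseteq> W' i" if "i \<le> Suc m" for i
    using that W(1) Suc.prems(2) by (cases i) (auto simp: W'_def)
  moreover have "W' i \<subset> W' (Suc i)" if "i < Suc m" for i
  proof (cases i)
    case 0
    have "insert a U \<subseteq> W 0" using W(1) by blast
    then show ?thesis using a(1) 0 by (auto simp: W'_def)
  next
    case (Suc k)
    then show ?thesis using W(2) that by (simp add: W'_def)
  qed
  ultimately show ?case unfolding Suc.hyps(2)[symmetric] by blast
qed

theorem module_length_supported:
  fixes U :: "(nat ^ 'n::finite) set"
  assumes "finite (- U)" "upward_closed U"
  shows "module_length type_ring (quotient_module type_ring (supported U :: ('n, 'k::field) mpoly set)) =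
    enat (card (- U))"
proof -
  obtain W where W: "\<forall>i\<le>card (- U). upward_closed (W i) \<and> U \<subseteq> W i" "\<forall>i<card (- U). W i \<subset> W (Suc i)"
    using upward_closed_chain[OF assms] by blast
  show ?thesis
  proof (rule module_length_quotient[OF ideal_supported[OF assms(2)], where K = "\<lambda>i. supported (W i)"])
    show "n \<le> card (- U)" if "\<And>i. i \<le> n \<Longrightarrow> ideal (K i) type_ring \<and> supported U \<subseteq> K i"
      "\<And>i. i < n \<Longrightarrow> K i \<subset> K (Suc i)" for n and K :: "nat \<Rightarrow> ('n, 'k) mpoly set"
      by (rule chain_length_le[OF assms(1), of n K]) (use that in simp_all)
    show "ideal (supported (W i)) type_ring \<and> supported U \<subseteq> (supported (W i) :: ('n, 'k) mpoly set)"
      if "i \<le> card (- U)" for i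
      using W(1) that ideal_supported supported_mono by blast
    show "supported (W i) \<subset> (supported (W (Suc i)) :: ('n, 'k) mpoly set)" if "i < card (- U)" for i
    proof
      show "supported (W i) \<subseteq> (supported (W (Suc i)) :: ('n, 'k) mpoly set)"
        using W(2) that by (intro supported_mono) blast
      have "W i \<subset> W (Suc i)" using W(2) that by simp
      then obtain a where "a \<in> W (Suc i)" "a \<notin> W i" by blast
      then have "(monomial a :: ('n, 'k) mpoly) \<in> supported (W (Suc i))" "(monomial a :: ('n, 'k) mpoly) \<notin> supported (W i)"
        by (simp_all add: supported_def)
      then show "supported (W i) \<noteq> (supported (W (Suc i)) :: ('n, 'k) mpoly set)" by blast
    qed
  qed
qed

section \<open>Zero dimensional monomial ideals contain powers of the variables\<close>

lemma keys_mult_unique: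
  fixes f g :: "('n::finite, 'k::field) mpoly"
  assumes a: "a \<in> keys f" and b: "b \<in> keys g"
    and unique: "\<And>u w. u \<in> keys f \<Longrightarrow> w \<in> keys g \<Longrightarrow> u + w = a + b \<Longrightarrow> u = a \<and> w = b"
  shows "a + b \<in> keys (f * g)"
proof -
  define s where "s = single a (lookup f a)"
  define t where "t = single b (lookup g b)"
  have ks: "keys s \<subseteq> {a}" "keys t \<subseteq> {b}" by (simp_all add: s_def t_def)
  have kf: "keys (f - s) = keys f - {a}" unfolding s_def by (rule keys_minus_single)
  have kg: "keys (g - t) = keys g - {b}" unfolding t_def by (rule keys_minus_single)
  have "s * (g - t) \<in> supported (- {a + b})"
    by (rule supported_mult[of _ "{a}" _ "keys g - {b}"]) (use ks kg in \<open>auto simp: supported_def\<close>)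
  moreover have "(f - s) * g \<in> supported (- {a + b})"
    by (rule supported_mult[of _ "keys f - {a}" _ "keys g"])
      (use kf unique in \<open>auto simp: supported_def\<close>)
  ultimately have "s * (g - t) + (f - s) * g \<in> supported (- {a + b})" by (rule supported_add)
  then have "lookup (s * (g - t) + (f - s) * g) (a + b) = 0"
    by (auto simp: supported_def in_keys_iff)
  moreover have "f * g = s * t + (s * (g - t) + (f - s) * g)" by (simp add: algebra_simps)
  ultimately have "lookup (f * g) (a + b) = lookup (s * t) (a + b)"
    by (metis lookup_add add.right_neutral)
  also have "\<dots> = lookup f a * lookup g b" by (simp add: s_def t_def mult_single)
  finally show ?thesis using a b by (simp add: in_keys_iff)
qed

definition prime_set :: "'a::comm_ring_1 set \<Rightarrow> bool" where
  "prime_set P \<longleftrightarrow> ideal P type_ring \<and> P \<noteq> UNIV \<and> (\<forall>f g. f * g \<in> P \<longrightarrow> f \<in> P \<or> g \<in> P)"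

text \<open>
  The ideal generated by the variables is \<open>supported (- {0})\<close>, and the one generated by all
  variables but the one with index \<open>i\<close> consists of the polynomials supported on
  \<open>{a. \<exists>j. j \<noteq> i \<and> a $ j \<noteq> 0}\<close>.
\<close>

lemma prime_all_variables:
  "prime_set (supported (- {0}) :: ('n::finite, 'k::field) mpoly set)"
  unfolding prime_set_def
proof (intro conjI allI impI)
  show "ideal (supported (- {0}) :: ('n, 'k) mpoly set) type_ring"
    by (rule ideal_supported) (auto simp: upward_closed_def vec_eq_iff)
  have "(1 :: ('n, 'k) mpoly) \<notin> supported (- {0})" by (simp add: supported_def)
  then show "(supported (- {0}) :: ('n, 'k) mpoly set) \<noteq> UNIV" by blast
  fix f g :: "('n, 'k) mpoly" assume fg: "f * g \<in> supported (- {0})"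
  show "f \<in> supported (- {0}) \<or> g \<in> supported (- {0})"
  proof (rule ccontr)
    assume "\<not> ?thesis"
    then have "0 \<in> keys f" "0 \<in> keys g" by (auto simp: supported_def)
    then have "0 + 0 \<in> keys (f * g)"
      by (rule keys_mult_unique) (auto simp: vec_eq_iff)
    then show False using fg by (auto simp: supported_def)
  qed
qed

lemma max_coordinate:
  fixes A :: "(nat ^ 'n::finite) set"
  assumes "finite A" "A \<noteq> {}"
  obtains a where "a \<in> A" "\<And>b. b \<in> A \<Longrightarrow> b $ i \<le> a $ i"
proof -
  have fin: "finite ((\<lambda>a. a $ i) ` A)" "(\<lambda>a. a $ i) ` A \<noteq> {}" using assms by simp_all
  obtain a where a: "a \<in> A" "a $ i = Max ((\<lambda>a. a $ i) ` A)" using Max_in[OF fin] by auto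
  show thesis
    by (rule that[OF a(1)]) (use a(2) fin in simp)
qed

lemma prime_other_variables:
  fixes i :: "'n::finite"
  shows "prime_set (supported {a. \<exists>j. j \<noteq> i \<and> a $ j \<noteq> 0} :: ('n, 'k::field) mpoly set)"
  unfolding prime_set_def
proof (intro conjI allI impI)
  define U where "U = {a :: nat ^ 'n. \<exists>j. j \<noteq> i \<and> a $ j \<noteq> 0}"
  show "ideal (supported U :: ('n, 'k) mpoly set) type_ring"
    by (rule ideal_supported) (simp add: upward_closed_def U_def, blast)
  have "(1 :: ('n, 'k) mpoly) \<notin> supported U" by (simp add: supported_def U_def)
  then show "(supported U :: ('n, 'k) mpoly set) \<noteq> UNIV" by blast
  fix f g :: "('n, 'k) mpoly" assume fg: "f * g \<in> supported U"
  show "f \<in> supported U \<or> g \<in> supported U"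
  proof (rule ccontr)
    assume neg: "\<not> ?thesis"
    have ne: "keys f - U \<noteq> {}" "keys g - U \<noteq> {}"
      using neg unfolding supported_def by blast+
    obtain a where a: "a \<in> keys f - U" "\<And>b. b \<in> keys f - U \<Longrightarrow> b $ i \<le> a $ i"
      by (rule max_coordinate[OF finite_Diff[OF finite_keys] ne(1), of i]) blast
    obtain b where b: "b \<in> keys g - U" "\<And>c. c \<in> keys g - U \<Longrightarrow> c $ i \<le> b $ i"
      by (rule max_coordinate[OF finite_Diff[OF finite_keys] ne(2), of i]) blast
    have zero: "a $ j = 0" "b $ j = 0" if "j \<noteq> i" for j proof -
      have "a \<notin> U" "b \<notin> U" using a(1) b(1) by simp_all
      then show "a $ j = 0" "b $ j = 0" using that unfolding U_def by blast+
    qed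
    have "a + b \<in> keys (f * g)"
    proof (rule keys_mult_unique)
      fix u w assume u: "u \<in> keys f" and w: "w \<in> keys g" and eq: "u + w = a + b"
      have sums: "u $ j + w $ j = a $ j + b $ j" for j using arg_cong[OF eq, of "\<lambda>x. x $ j"] by simp
      have uw: "u $ j = 0" "w $ j = 0" if "j \<noteq> i" for j using sums[of j] zero[OF that] by simp_all
      have notU: "x \<notin> U" if x: "\<And>j. j \<noteq> i \<Longrightarrow> x $ j = 0" for x
      proof
        assume "x \<in> U"
        then obtain j where "j \<noteq> i" "x $ j \<noteq> 0" unfolding U_def by blast
        then show False using x[of j] by simp
      qed
      have "u \<notin> U" by (rule notU) (rule uw(1))
      moreover have "w \<notin> U" by (rule notU) (rule uw(2))
      ultimately have "u \<in> keys f - U" "w \<in> keys g - U" using u w by simp_all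
      then have "u $ i \<le> a $ i" "w $ i \<le> b $ i" using a(2) b(2) by blast+
      then have i: "u $ i = a $ i" "w $ i = b $ i" using sums[of i] by linarith+
      have "u $ j = a $ j \<and> w $ j = b $ j" for j
      proof (cases "j = i")
        case True
        then show ?thesis using i by simp
      next
        case False
        then show ?thesis using uw[OF False] zero[OF False] by simp
      qed
      then show "u = a \<and> w = b" by (simp add: vec_eq_iff)
    qed (use a(1) b(1) in blast)+
    moreover have "a + b \<notin> U"
    proof
      assume "a + b \<in> U"
      then obtain j where "j \<noteq> i" "(a + b) $ j \<noteq> 0" unfolding U_def by blast
      then show False using zero[of j] by simp
    qed
    ultimately show False using fg unfolding supported_def by blast
  qed
qed

lemma primeideal_quotient:
  assumes I: "ideal I (type_ring :: 'a::comm_ring_1 ring)" and P: "prime_set P" "I \<subseteq> P"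
  shows "primeideal (coset I ` P) (type_ring Quot I)"
proof (rule primeidealI)
  interpret R: cring "type_ring :: 'a ring" by (rule cring_type_ring)
  have id: "ideal P type_ring" using P(1) by (simp add: prime_set_def)
  have img: "coset I f \<in> coset I ` P \<longleftrightarrow> f \<in> P" for f
  proof
    assume "coset I f \<in> coset I ` P"
    then obtain g where g: "g \<in> P" "f - g \<in> I" by (auto simp: coset_eq_iff[OF I])
    then have "(f - g) + g \<in> P" using P(2) by (intro ideal_type_ringD(2)[OF id]) auto
    then show "f \<in> P" by simp
  qed blast
  show "ideal (coset I ` P) (type_ring Quot I)"
  proof -
    have "coset I = (+>\<^bsub>type_ring\<^esub>) I" by (rule ext) (rule coset_def[OF I])
    then show ?thesis using R.ring_ideal_imp_quot_ideal[OF I id] by simp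
  qed
  show "cring (type_ring Quot I)" by (rule ideal.quotient_is_cring[OF I R.is_cring])
  obtain f where "f \<notin> P" using P(1) by (auto simp: prime_set_def)
  then show "carrier (type_ring Quot I) \<noteq> coset I ` P" using img[of f] by (auto simp: carrier_quotient[OF I])
  fix x y assume "x \<in> carrier (type_ring Quot I)" "y \<in> carrier (type_ring Quot I)"
    and xy: "x \<otimes>\<^bsub>type_ring Quot I\<^esub> y \<in> coset I ` P"
  then obtain f g where fg: "x = coset I f" "y = coset I g" by (auto simp: carrier_quotient[OF I])
  interpret h: ring_hom_ring type_ring "type_ring Quot I" "coset I" by (rule coset_hom[OF I])
  have "f * g \<in> P" using xy h.hom_mult[of f g] img[of "f * g"] by (simp add: fg)
  then show "x \<in> coset I ` P \<or> y \<in> coset I ` P" using P(1) by (auto simp: fg prime_set_def)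
qed

text \<open>
  If no power of the variable with index \<open>i\<close> is a generator, then the ideal of all other variables
  and the ideal of all variables both contain \<open>I\<close>, and their images form a chain of primes of
  length \<open>1\<close>. If \<open>1 \<in> I\<close>, then the quotient has no primes and its dimension is \<open>-\<infinity>\<close>.
\<close>

lemma zero_dimensional:
  fixes V :: "(nat ^ 'n::finite) set"
  assumes dim: "krull_dim (type_ring Quot (monomial_ideal V :: ('n, 'k::field) mpoly set)) = 0"
  shows "0 \<notin> V" "\<exists>m. axis i m \<in> V"
proof -
  define I :: "('n, 'k) mpoly set" where "I = monomial_ideal V"
  have I: "ideal I type_ring" unfolding I_def by (rule ideal_monomial_ideal)
  define Q where "Q = type_ring Quot I"
  define chain where "chain = (\<lambda>n \<pp>. (\<forall>i\<le>n. primeideal (\<pp> i) Q) \<and> (\<forall>i<n. \<pp> i \<subset> \<pp> (Suc i)))"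
  have sup: "(SUP n\<in>{n. \<exists>\<pp>. chain n \<pp>}. ereal (real n)) = 0"
    using dim unfolding krull_dim_def chain_def Q_def I_def .
  show "0 \<notin> V"
  proof
    assume "0 \<in> V"
    then have "1 \<in> I" unfolding I_def using monomial_in_ideal[of 0 V] by (simp add: monomial_0)
    then have "f \<in> I" for f using ideal_type_ringD(3)[OF I, of 1 f] by simp
    then have triv: "coset I f = coset I 0" for f unfolding coset_eq_iff[OF I] by blast
    have "\<not> chain n \<pp>" for n \<pp>
    proof
      assume "chain n \<pp>"
      then have p: "primeideal (\<pp> 0) Q" by (auto simp: chain_def)
      have sub: "additive_subgroup (\<pp> 0) Q" by (rule ideal.axioms(1)[OF primeideal.axioms(1)[OF p]])
      have zero: "coset I 0 = \<zero>\<^bsub>Q\<^esub>"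
        using coset_zero[OF I] by (simp only: quotient_module_simps[OF I] Q_def)
      have "x \<in> \<pp> 0" if "x \<in> carrier Q" for x
      proof -
        obtain f where "x = coset I f" using \<open>x \<in> carrier Q\<close> unfolding Q_def carrier_quotient[OF I] by blast
        then have "x = \<zero>\<^bsub>Q\<^esub>" using triv[of f] zero by (simp only:)
        then show ?thesis using additive_subgroup.zero_closed[OF sub] by (simp only:)
      qed
      then have "carrier Q = \<pp> 0" using additive_subgroup.a_subset[OF sub] by blast
      then show False using primeideal.I_notcarr[OF p] by (rule notE[rotated])
    qed
    then have "{n. \<exists>\<pp>. chain n \<pp>} = {}" by blast
    then show False using sup unfolding \<open>{n. \<exists>\<pp>. chain n \<pp>} = {}\<close> by (simp add: bot_ereal_def)
  qed
  show "\<exists>m. axis i m \<in> V"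
  proof (rule ccontr)
    assume none: "\<not> (\<exists>m. axis i m \<in> V)"
    define U where "U = {a :: nat ^ 'n. \<exists>j. j \<noteq> i \<and> a $ j \<noteq> 0}"
    have "V \<subseteq> U"
    proof
      fix v assume v: "v \<in> V"
      show "v \<in> U"
      proof (rule ccontr)
        assume "v \<notin> U"
        then have "v = axis i (v $ i)" by (auto simp: U_def vec_eq_iff axis_def)
        then show False using none v by metis
      qed
    qed
    have up: "upward_closed U" by (auto simp: upward_closed_def U_def)
    have sub: "I \<subseteq> supported U" unfolding I_def by (rule monomial_ideal_supported[OF up \<open>V \<subseteq> U\<close>])
    have "supported U \<subseteq> (supported (- {0}) :: ('n, 'k) mpoly set)"
      by (rule supported_mono) (auto simp: U_def)
    moreover have mono: "(monomial (axis i 1) :: ('n, 'k) mpoly) \<in> supported (- {0})"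
      "(monomial (axis i 1) :: ('n, 'k) mpoly) \<notin> supported U"
      by (auto simp: supported_def U_def axis_eq_0_iff) (auto simp: axis_def split: if_splits)
    ultimately have lt: "supported U \<subseteq> (supported (- {0}) :: ('n, 'k) mpoly set)" by blast
    define P0 where "P0 = coset I ` supported U"
    define P1 where "P1 = coset I ` supported (- {0})"
    have prime: "primeideal P0 Q" "primeideal P1 Q"
      unfolding P0_def P1_def Q_def
      by (rule primeideal_quotient[OF I prime_other_variables[of i, folded U_def] sub])
        (rule primeideal_quotient[OF I prime_all_variables order_trans[OF sub lt]])
    have "P0 \<subset> P1"
    proof
      show "P0 \<subseteq> P1" unfolding P0_def P1_def using lt by (rule image_mono)
      have "coset I (monomial (axis i 1)) \<notin> P0"
      proof
        assume "coset I (monomial (axis i 1)) \<in> P0"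
        then obtain g where g: "g \<in> supported U" "monomial (axis i 1) - g \<in> I"
          by (auto simp: coset_eq_iff[OF I] P0_def)
        then have "(monomial (axis i 1) - g) + g \<in> supported U" using sub by (intro supported_add) auto
        then show False using mono(2) by simp
      qed
      moreover have "coset I (monomial (axis i 1)) \<in> P1" unfolding P1_def using mono(1) by (rule imageI)
      ultimately show "P0 \<noteq> P1" by blast
    qed
    then have "chain 1 (\<lambda>k. if k = 0 then P0 else P1)"
      unfolding chain_def using prime by (intro conjI allI impI) simp_all
    then have "ereal (real 1) \<le> (SUP n\<in>{n. \<exists>\<pp>. chain n \<pp>}. ereal (real n))"
      by (intro SUP_upper CollectI exI[of _ "\<lambda>k. if k = 0 then P0 else P1"])
    then show False unfolding sup by simp
  qed
qed

text \<open>
  Of two powers of the same variable the larger one would be redundant.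
\<close>

lemma pure_generator_unique:
  fixes V :: "(nat ^ 'n::finite) set" and I :: "('n, 'k::field) mpoly set"
  assumes min: "minimal_monomial_generators V I" and m: "axis i m \<in> V" "axis i m' \<in> V"
  shows "m = m'"
proof -
  have no_less: False if "axis i l \<in> V" "axis i l' \<in> V" "l < l'" for l l'
  proof -
    define W where "W = V - {axis i l'}"
    have "axis i l \<in> W" using that by (simp add: W_def axis_eq_axis)
    have I: "I = monomial_ideal V" using min by (simp add: minimal_monomial_generators_def monomial_ideal_def)
    have W: "ideal (monomial_ideal W :: ('n, 'k) mpoly set) type_ring" by (rule ideal_monomial_ideal)
    have "axis i l' = axis i (l' - l) + axis i l" using that(3) by (simp add: vec_eq_iff axis_def)
    then have eq: "monomial (axis i l') = monomial (axis i (l' - l)) * (monomial (axis i l) :: ('n, 'k) mpoly)"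
      by (simp only: monomial_add)
    have mem0: "(monomial (axis i l') :: ('n, 'k) mpoly) \<in> monomial_ideal W"
      unfolding eq by (rule ideal_type_ringD(3)[OF W monomial_in_ideal[OF \<open>axis i l \<in> W\<close>]])
    have mem: "(monomial v :: ('n, 'k) mpoly) \<in> monomial_ideal W" if v: "v \<in> V" for v
    proof (cases "v = axis i l'")
      case True
      show ?thesis unfolding True by (rule mem0)
    next
      case False
      then have "v \<in> W" using v unfolding W_def by blast
      then show ?thesis by (rule monomial_in_ideal)
    qed
    have "monomial_ideal V \<subseteq> (monomial_ideal W :: ('n, 'k) mpoly set)"
      by (rule monomial_ideal_minimal[OF W], rule image_subsetI, rule mem)
    moreover have "monomial_ideal W \<subseteq> (monomial_ideal V :: ('n, 'k) mpoly set)"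
    proof (rule monomial_ideal_minimal[OF ideal_monomial_ideal], rule image_subsetI)
      show "(monomial v :: ('n, 'k) mpoly) \<in> monomial_ideal V" if "v \<in> W" for v
        using that by (intro monomial_in_ideal) (simp add: W_def)
    qed
    ultimately have "monomial_ideal W = I" unfolding I by (intro equalityI)
    have "\<forall>W. W \<subset> V \<longrightarrow> monomial_ideal W \<noteq> I"
      using min unfolding minimal_monomial_generators_def monomial_ideal_def by (elim conjE)
    moreover have "W \<subset> V" using that(2) unfolding W_def by blast
    ultimately show False using \<open>monomial_ideal W = I\<close> by simp
  qed
  show ?thesis
    using no_less[OF m] no_less[OF m(2,1)] by (cases m m' rule: linorder_cases) simp_all
qed

section \<open>The Hilbert function\<close>

theorem proposition3p6:
  fixes I :: "('n::finite, 'k::field) mpoly set"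
    and V :: "(nat ^ 'n) set"
  assumes "2 \<le> CARD('n)"
    and "minimal_monomial_generators V I"
    and "krull_dim (mpoly_ring Quot I) = 0"
  shows "(\<forall>n. of_nat (hilbert_function mpoly_ring I n) =
              poly (ehrhart_poly (polytope_S V)) (of_nat n)
                - poly (ehrhart_poly (polytope_P V)) (of_nat n))
       \<and> (\<forall>n. of_nat (hilbert_function mpoly_ring I n) =
              (\<Sum>i\<le>CARD('n). Polynomial.coeff (hilbert_poly mpoly_ring I) i * of_nat n ^ i))
       \<and> Polynomial.coeff (hilbert_poly mpoly_ring I) 0 = 0"
proof -
  define p where "p = pure_exponent V"
  have fin: "finite V" and I: "I = monomial_ideal V"
    using assms(2) by (simp_all add: minimal_monomial_generators_def monomial_ideal_def)
  note zd = zero_dimensional[OF assms(3)[unfolded I]]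
  have pV: "axis i (p i) \<in> V" for i
  proof -
    obtain m where m: "axis i m \<in> V" using zd(2) by blast
    have "pure_exponent V i = m"
      unfolding pure_exponent_def
    proof (rule the_equality)
      show "axis i m \<in> V" by (rule m)
      show "m' = m" if "axis i m' \<in> V" for m' by (rule pure_generator_unique[OF assms(2) that m])
    qed
    then show ?thesis using m by (simp add: p_def)
  qed
  have p0: "0 < p i" for i
  proof (rule ccontr)
    assume "\<not> 0 < p i"
    then have "axis i (p i) = 0" by (simp add: vec_eq_iff axis_def)
    then have "0 \<in> V" using pV[of i] by metis
    then show False using zd(1) by blast
  qed
  interpret G: pure_generators V p by unfold_locales (rule fin pV p0)+
  have pures: "pure_vectors V = G.pures" 
    unfolding pure_vectors_def G.pures_def by (simp add: p_def)
  have "scalar_product (rat_vec v) (alpha0 V) = height p v" for v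
    by (simp add: scalar_product_def alpha0_def height_def p_def)
  then have low: "{v \<in> V. scalar_product (rat_vec v) (alpha0 V) < 1} = G.low" by (simp add: G.low_def)
  have "rat_vec 0 = (0 :: rat ^ 'n)" by (simp add: vec_eq_iff)
  then have S: "polytope_S V = conv (rat_vec ` insert 0 G.pures)" by (simp add: polytope_S_def pures)
  have P: "polytope_P V = conv (rat_vec ` (G.pures \<union> G.low))" by (simp add: polytope_P_def pures low)
  have int: "integral (rat_vec v)" for v :: "nat ^ 'n" by (simp add: integral_def)
  have "finite (rat_vec ` insert 0 G.pures)" "rat_vec ` insert 0 G.pures \<noteq> {}"
    using G.finite_pures by simp_all
  from ehrhart[OF this] int obtain s :: "rat poly" where s: "degree s \<le> CARD('n)"
    "\<And>n. poly s (of_nat n) = of_nat (ehrhart_function (polytope_S V) n)"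
    unfolding S by blast
  have "finite (rat_vec ` (G.pures \<union> G.low))" "rat_vec ` (G.pures \<union> G.low) \<noteq> {}"
    using G.finite_pures G.finite_low by (simp_all add: G.pures_def)
  from ehrhart[OF this] int obtain t :: "rat poly" where t: "degree t \<le> CARD('n)"
    "\<And>n. poly t (of_nat n) = of_nat (ehrhart_function (polytope_P V) n)"
    unfolding P by blast
  have f: "hilbert_function mpoly_ring I n = card {a. a \<notin> newton V (of_nat n)}" for n
  proof (cases "n = 0")
    case False
    have compl: "- newton V (of_nat n) = {a. a \<notin> newton V (of_nat n)}" by blast
    have "finite (- newton V (of_nat n))" unfolding compl using G.card_below_newton[of n] by blast
    from module_length_supported[OF this upward_closed_newton]
    have "module_length mpoly_ring (quotient_module mpoly_ring
        (supported (newton V (of_nat n)) :: ('n, 'k) mpoly set)) = enat (card {a. a \<notin> newton V (of_nat n)})"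
      unfolding compl .
    then show ?thesis
      using False unfolding hilbert_function_def I ideal_pow_def[symmetric] integral_closure_monomial_ideal_pow[OF fin]
      by simp
  qed (simp add: hilbert_function_def newton_zero)
  have eq: "of_nat (hilbert_function mpoly_ring I n) = poly s (of_nat n) - poly t (of_nat n)" for n
    using G.card_below_newton[of n] by (simp add: f s(2) t(2) S P)
  have "ehrhart_poly (polytope_S V) = s" unfolding ehrhart_poly_def by (rule eventual_poly_eqI) (rule s(2))
  moreover have "ehrhart_poly (polytope_P V) = t" unfolding ehrhart_poly_def by (rule eventual_poly_eqI) (rule t(2))
  moreover have hp: "hilbert_poly mpoly_ring I = s - t"
    unfolding hilbert_poly_def by (rule eventual_poly_eqI) (simp add: eq)
  have "degree (s - t) \<le> CARD('n)" using s(1) t(1) by (rule degree_diff_le)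
  then have "poly (s - t) x = (\<Sum>i\<le>CARD('n). Polynomial.coeff (s - t) i * x ^ i)" for x
    unfolding poly_altdef by (intro sum.mono_neutral_left) (auto simp: coeff_eq_0 simp del: coeff_diff)
  then have "of_nat (hilbert_function mpoly_ring I n) =
      (\<Sum>i\<le>CARD('n). Polynomial.coeff (hilbert_poly mpoly_ring I) i * of_nat n ^ i)" for n
    unfolding hp using eq[of n] by simp
  moreover have "Polynomial.coeff (hilbert_poly mpoly_ring I) 0 = 0"
    using eq[of 0] unfolding hp by (simp add: hilbert_function_def poly_0_coeff_0)
  ultimately show ?thesis using eq by simp
qed

end
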